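(* There exist positive constants $C_1,C_2,\delta_0,\epsilon_0$ such that for all $0<\delta<\delta_0$ and all $h>0$ and integers $K\ge1$ with $h+\frac1{h^2}e^{-C_1Kh}\le\epsilon_0$ the following holds. If $\psi^0=(\psi^0_j)_{j=-K}^K\in V_{h,K}$ satisfies $$\operatorname{dist}(i_{h,K}\psi^0,\Gamma)\le\delta,$$ then the solution $\psi(t)=(\psi_j(t))_{j=-K}^K$, with $\psi(0)=\psi^0$, of $$i\dot\psi_\ell=-\frac1{h^2}(\psi_{\ell+1}+\psi_{\ell-1}-2\psi_\ell)-|\psi_\ell|^2\psi_\ell,\quad -K\le\ell\le K,\qquad \psi_{\pm(K+1)}=0,$$ satisfies $$\forall\,t\ge0,\qquad \operatorname{dist}(i_{h,K}\psi(t),\Gamma)\le C_2\Big(\delta+h+\frac1{h^2}e^{-C_1Kh}\Big).$$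
   Context: Let $H(\psi)=\int_{\mathbb{R}}\big[|\psi_x|^2-\tfrac12|\psi|^4\big]dx$ and $N(\psi)=\int_{\mathbb{R}}|\psi|^2dx$ for $\psi\in H^1(\mathbb{R};\mathbb{C})$. Let $\eta$ be the positive even minimizer of $H$ under the constraint $N=1$, explicitly $\eta(x)=\frac{1}{2\sqrt2}\,\mathrm{sech}(x/4)$, and let $\Gamma=\{e^{i\alpha}\eta:\alpha\in\mathbb{R}\}$. The distance $\operatorname{dist}(\varphi,\Gamma)=\inf_{\nu\in\Gamma}\|\varphi-\nu\|_{H^1}$ is measured in the norm $\|\varphi\|_{H^1}^2=\int_{\mathbb{R}}(|\varphi|^2+|\partial_x\varphi|^2)\,dx$. For $h>0$ and an integer $K\ge1$, $V_{h,K}$ is the space of complex sequences $(\psi_j)_{j\in\mathbb{Z}}$ with $\psi_j=\psi_{-j}$ for all $j$ and $\psi_j=0$ for $|j|\ge K+1$; its elements are written $(\psi_j)_{j=-K}^K$, with implicit extension by $0$. Let $s:\mathbb{R}\to\mathbb{R}$, $s(x)=\max(0,1-|x|)$. The map $i_{h,K}:V_{h,K}\to H^1(\mathbb{R};\mathbb{C})$ is $(i_{h,K}\psi)(x)=\sum_{j\in\mathbb{Z}}\psi_j\,s\!\left(\frac{x}{h}-j\right)$. *)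

theory Defs
  imports "HOL-Analysis.Analysis"
begin

subsection \<open>The space $H^1(\mathbb{R};\mathbb{C})$\<close>

text \<open>Elements are represented by Borel functions; everything below is invariant under
  modification on a Lebesgue null set.\<close>

definition square_integrable :: "(real \<Rightarrow> complex) \<Rightarrow> bool" where
  "square_integrable f \<longleftrightarrow>
     f \<in> borel_measurable lborel \<and> integrable lborel (\<lambda>x. (cmod (f x))\<^sup>2)"

definition test_function :: "(real \<Rightarrow> real) \<Rightarrow> bool" where
  "test_function \<phi> \<longleftrightarrow> \<phi> C1_differentiable_on UNIV \<and> compact (closure {x. \<phi> x \<noteq> 0})"

text \<open>\<open>f\<close> lies in $H^1$ iff \<open>H1_derivative f g\<close> holds for some \<open>g\<close>, which is then unique
  almost everywhere.\<close>

definition H1_derivative :: "(real \<Rightarrow> complex) \<Rightarrow> (real \<Rightarrow> complex) \<Rightarrow> bool" where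
  "H1_derivative f g \<longleftrightarrow>
     square_integrable f \<and> square_integrable g \<and>
     (\<forall>\<phi>. test_function \<phi> \<longrightarrow>
        (LINT x|lborel. deriv \<phi> x *\<^sub>R f x) = - (LINT x|lborel. \<phi> x *\<^sub>R g x))"

definition weak_deriv :: "(real \<Rightarrow> complex) \<Rightarrow> real \<Rightarrow> complex" where
  "weak_deriv f = (SOME g. H1_derivative f g)"

text \<open>Meaningful only for \<open>f\<close> in $H^1$.\<close>

definition H1_norm :: "(real \<Rightarrow> complex) \<Rightarrow> real" where
  "H1_norm f = sqrt (LINT x|lborel. (cmod (f x))\<^sup>2 + (cmod (weak_deriv f x))\<^sup>2)"

definition H1_dist :: "(real \<Rightarrow> complex) \<Rightarrow> (real \<Rightarrow> complex) set \<Rightarrow> real" where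
  "H1_dist \<phi> A = (INF \<nu>\<in>A. H1_norm (\<lambda>x. \<phi> x - \<nu> x))"

subsection \<open>The ground state\<close>

text \<open>The positive even minimizer of $\int |\psi_x|^2 - \frac12 |\psi|^4$ subject to
  $\int |\psi|^2 = 1$, in closed form.\<close>

definition eta :: "real \<Rightarrow> real" where
  "eta x = 1 / (2 * sqrt 2) * (1 / cosh (x / 4))"

definition Gamma_orbit :: "(real \<Rightarrow> complex) set" where
  "Gamma_orbit = {\<nu>. \<exists>\<alpha>::real. \<nu> = (\<lambda>x. exp (\<i> * of_real \<alpha>) * of_real (eta x))}"

subsection \<open>Lattice sequences\<close>

text \<open>The space $V_{h,K}$; as a set of sequences it does not depend on $h$.\<close>

definition V :: "nat \<Rightarrow> (int \<Rightarrow> complex) set" where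
  "V K = {\<psi>. (\<forall>j. \<psi> j = \<psi> (- j)) \<and> (\<forall>j. \<bar>j\<bar> \<ge> int K + 1 \<longrightarrow> \<psi> j = 0)}"

definition hat :: "real \<Rightarrow> real" where
  "hat x = max 0 (1 - \<bar>x\<bar>)"

definition interp :: "real \<Rightarrow> (int \<Rightarrow> complex) \<Rightarrow> real \<Rightarrow> complex" where
  "interp h \<psi> x = (\<Sum>\<^sub>\<infinity>j\<in>UNIV. \<psi> j * of_real (hat (x / h - of_int j)))"

text \<open>Solutions on \<open>[0,\<infinity>)\<close>, extended by zero outside \<open>-K..K\<close>; the derivative at \<open>t = 0\<close> is
  one-sided. The symmetry \<open>\<psi> t j = \<psi> t (-j)\<close> is required only of the initial
  datum.\<close>

definition DNLS_solution ::
    "real \<Rightarrow> nat \<Rightarrow> (int \<Rightarrow> complex) \<Rightarrow> (real \<Rightarrow> int \<Rightarrow> complex) \<Rightarrow> bool" where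
  "DNLS_solution h K \<psi>0 \<psi> \<longleftrightarrow>
     \<psi> 0 = \<psi>0 \<and>
     (\<forall>t\<ge>0. \<forall>l. \<bar>l\<bar> \<ge> int K + 1 \<longrightarrow> \<psi> t l = 0) \<and>
     (\<forall>t\<ge>0. \<forall>l\<in>{- int K..int K}. \<exists>d.
        ((\<lambda>s. \<psi> s l) has_vector_derivative d) (at t within {0..}) \<and>
        \<i> * d = - (1 / of_real (h\<^sup>2)) * (\<psi> t (l + 1) + \<psi> t (l - 1) - 2 * \<psi> t l)
                - of_real ((cmod (\<psi> t l))\<^sup>2) * \<psi> t l)"

end

theory Submission
  imports Defs "HOL-Real_Asymp.Real_Asymp"
begin

text \<open>The theorem is orbital stability of the soliton, transported to the lattice by comparing conserved
quantities. With the multiplier \<open>1/16\<close> the soliton \<open>\<eta>\<close> is a critical point of the action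
\<open>E = H + N/16\<close>, and near the orbit the functional \<open>E(u) - E(\<eta>) + 4 (N(u) - N(\<eta>))\<^sup>2\<close> controls the
squared distance of an even function \<open>u\<close> to the orbit (\<open>orbital_coercivity\<close>). The lattice equation
conserves its own mass \<open>N\<^sub>h\<close> and energy \<open>H\<^sub>h\<close>, and for the piecewise linear interpolant of a lattice
sequence these differ from \<open>N\<close> and \<open>H\<close> by \<open>O(h\<^sup>2)\<close>, uniformly on bounded sets of \<open>H\<^sup>1\<close>
(\<open>interp_consistency\<close>). Hence the functional, initially \<open>O(\<delta>\<^sup>2)\<close> by \<open>energy_upper\<close>, stays
\<open>O(\<delta>\<^sup>2 + h\<^sup>2)\<close> as long as the interpolant stays in the region where coercivity is valid, and a
continuity argument (\<open>bootstrap\<close>) shows that it never leaves. The soliton itself thus serves as the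
reference profile, and the bound obtained in \<open>stability_estimate\<close> is of order \<open>\<delta> + h\<close>.

Coercivity rests on the second variation of \<open>E\<close> at \<open>\<eta>\<close>, which splits into a quadratic form
\<open>L\<^sub>+\<close> in the real part and a form \<open>L\<^sub>-\<close> in the imaginary part of the perturbation. Both are written as
explicit squares. The phase of the reference soliton is chosen so that the imaginary part vanishes at
the origin (\<open>rephase\<close>); on such functions \<open>L\<^sub>-\<close> dominates a Hardy-type square
(\<open>Lminus_coercive\<close>). On functions vanishing at the origin \<open>L\<^sub>+\<close> is the integral of
\<open>(r' - q r)\<^sup>2\<close>, where \<open>q\<close> is the logarithmic derivative of the odd kernel element \<open>\<eta>'\<close>
(\<open>Lplus_square\<close>), which leaves one degenerate even direction \<open>|\<eta>'|\<close> (\<open>Lplus_Dirichlet\<close>). A general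
even function is reduced to this case by subtracting a multiple of the derivative of the soliton family
in its scale, whose image under \<open>L\<^sub>+\<close> is proportional to \<open>\<eta>\<close>; this costs exactly the first-order mass
defect (\<open>Lplus_coercive\<close>).

All functions that occur, interpolants as well as solitons, are continuous, decay exponentially and are
differentiable off a finite set. Every integral identity is therefore the vanishing of the integral of
an explicit derivative (\<open>FTC_line\<close>), and the weak derivative in the \<open>H\<^sup>1\<close> norm is the pointwise one
(\<open>H1_norm_profile\<close>).\<close>

section \<open>Exponentially decaying functions and integration by parts\<close>

text \<open>The rate \<open>1/8\<close> is half the decay rate \<open>1/4\<close> of the soliton, so that the scaling derivative of the
soliton, which carries a factor \<open>x\<close>, still belongs to the class.\<close>
definition exp_decaying :: "(real \<Rightarrow> 'a::euclidean_space) \<Rightarrow> bool" where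
  "exp_decaying f \<longleftrightarrow> f \<in> borel_measurable borel \<and> (\<exists>C. \<forall>x. norm (f x) \<le> C * exp (- (\<bar>x\<bar> / 8)))"

text \<open>The finite exceptional set admits the corners of piecewise linear interpolants and of \<open>|\<eta>'|\<close>.\<close>
definition H1_profile :: "(real \<Rightarrow> 'a::euclidean_space) \<Rightarrow> (real \<Rightarrow> 'a) \<Rightarrow> bool" where
  "H1_profile f f' \<longleftrightarrow> continuous_on UNIV f \<and> exp_decaying f \<and> exp_decaying f' \<and>
     (\<exists>S. finite S \<and> (\<forall>x\<in>-S. (f has_vector_derivative f' x) (at x)))"

named_theorems dec_intros

lemma exp_decayingI:
  assumes "f \<in> borel_measurable borel" "\<And>x. norm (f x) \<le> C * exp (- (\<bar>x\<bar> / 8))"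
  shows "exp_decaying f"
  using assms unfolding exp_decaying_def by blast

lemma exp_decaying_measurable [measurable_dest]: "exp_decaying f \<Longrightarrow> f \<in> borel_measurable borel"
  by (simp add: exp_decaying_def)

lemma exp_decaying_bound:
  assumes "exp_decaying f"
  shows "\<exists>C\<ge>0. (\<forall>x. norm (f x) \<le> C * exp (- (\<bar>x\<bar> / 8))) \<and> (\<forall>x. norm (f x) \<le> C)"
proof -
  obtain C where C: "\<And>x. norm (f x) \<le> C * exp (- (\<bar>x\<bar> / 8))"
    using assms unfolding exp_decaying_def by blast
  have C0: "C \<ge> 0"
    using order_trans[OF norm_ge_zero C[of 0]] by simp
  have "norm (f x) \<le> C" for x
    using order_trans[OF C[of x], of C] C0 by (simp add: mult_left_le)
  with C C0 show ?thesis by blast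
qed

lemma integrable_exp_abs: "integrable lborel (\<lambda>x::real. exp (- (\<bar>x\<bar> / 8)))"
proof -
  have 1: "(\<lambda>x::real. exp (- (1/8) * x)) integrable_on {0..}"
    by (rule integrable_on_exp_minus_to_infinity) simp
  have "(\<lambda>x::real. exp (- (1/8) * x)) absolutely_integrable_on {0..}"
    by (rule nonnegative_absolutely_integrable_1[OF 1]) simp
  hence "set_integrable lborel {0..} (\<lambda>x::real. exp (- (1/8) * x))"
    unfolding set_integrable_def
    by (subst integrable_completion[symmetric]) auto
  hence i: "integrable lborel (\<lambda>x::real. indicator {0..} x *\<^sub>R exp (- (1/8) * x))"
    unfolding set_integrable_def by simp
  have i2: "integrable lborel (\<lambda>x::real. indicator {0..} (0 + (-1) * x) *\<^sub>R exp (- (1/8) * (0 + (-1) * x)))"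
    by (rule lborel_integrable_real_affine[OF i]) simp
  have le: "norm (exp (- (\<bar>x\<bar> / 8))) \<le>
        norm (indicat_real {0..} x *\<^sub>R exp (- (1/8) * x) +
          indicat_real {0..} (0 + (-1) * x) *\<^sub>R exp (- (1/8) * (0 + (-1) * x)))" for x :: real
  proof -
    consider "x = 0" | "x > 0" | "x < 0" by linarith
    thus ?thesis by cases (simp_all add: indicator_def)
  qed
  show ?thesis
    by (rule Bochner_Integration.integrable_bound[OF Bochner_Integration.integrable_add[OF i i2]])
       (measurable, rule AE_I2, rule le)
qed

lemma exp_decaying_integrable:
  assumes "exp_decaying f" shows "integrable lborel f"
proof -
  obtain C where C: "C \<ge> 0" "\<And>x. norm (f x) \<le> C * exp (- (\<bar>x\<bar> / 8))"
    using exp_decaying_bound[OF assms] by blast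
  show ?thesis
  proof (rule Bochner_Integration.integrable_bound)
    show "integrable lborel (\<lambda>x. C * exp (- (\<bar>x\<bar> / 8)))"
      using integrable_exp_abs by simp
    show "f \<in> borel_measurable lborel" using assms by (simp add: exp_decaying_def)
    show "AE x in lborel. norm (f x) \<le> norm (C * exp (- (\<bar>x\<bar> / 8)))"
      using C by simp
  qed
qed

lemma exp_decaying_scaled:
  fixes f :: "real \<Rightarrow> 'a::euclidean_space" and g :: "real \<Rightarrow> 'b::euclidean_space"
  assumes f: "exp_decaying f" and g: "g \<in> borel_measurable borel" and b: "\<And>x. norm (g x) \<le> B * norm (f x)"
  shows "exp_decaying g"
proof -
  obtain C where C: "C \<ge> 0" "\<And>x. norm (f x) \<le> C * exp (- (\<bar>x\<bar> / 8))"
    using exp_decaying_bound[OF f] by blast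
  show ?thesis
  proof (rule exp_decayingI[OF g])
    fix x
    have "norm (g x) \<le> \<bar>B\<bar> * norm (f x)"
      using b[of x] by (meson abs_ge_self mult_right_mono norm_ge_zero order_trans)
    also have "\<dots> \<le> \<bar>B\<bar> * (C * exp (- (\<bar>x\<bar> / 8)))" by (intro mult_left_mono C) simp
    finally show "norm (g x) \<le> (\<bar>B\<bar> * C) * exp (- (\<bar>x\<bar> / 8))" by simp
  qed
qed

lemma exp_decaying_bounded_mult:
  fixes f g :: "real \<Rightarrow> real"
  assumes f: "exp_decaying f" and g: "g \<in> borel_measurable borel" and b: "\<And>x. \<bar>g x\<bar> \<le> B"
  shows "exp_decaying (\<lambda>x. g x * f x)"
  by (rule exp_decaying_scaled[OF f, where B=B])
     (use f g b in \<open>auto simp: abs_mult exp_decaying_def intro!: mult_right_mono\<close>)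

lemma exp_decaying_add [dec_intros]:
  assumes "exp_decaying f" "exp_decaying g" shows "exp_decaying (\<lambda>x. f x + g x)"
proof -
  obtain C where C: "\<And>x. norm (f x) \<le> C * exp (- (\<bar>x\<bar> / 8))"
    using exp_decaying_bound[OF assms(1)] by blast
  obtain D where D: "\<And>x. norm (g x) \<le> D * exp (- (\<bar>x\<bar> / 8))"
    using exp_decaying_bound[OF assms(2)] by blast
  show ?thesis
    by (rule exp_decayingI[where C="C+D"])
       (use assms in \<open>auto simp: exp_decaying_def distrib_right intro!: norm_triangle_le add_mono C D\<close>)
qed

lemma exp_decaying_linear:
  fixes f :: "real \<Rightarrow> 'a::euclidean_space" and L :: "'a \<Rightarrow> 'b::euclidean_space"
  assumes L: "bounded_linear L" and f: "exp_decaying f"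
  shows "exp_decaying (\<lambda>x. L (f x))"
proof -
  have m: "(\<lambda>x. L (f x)) \<in> borel_measurable borel"
    using borel_measurable_continuous_onI[OF linear_continuous_on[OF L]] f
    by (auto simp: exp_decaying_def intro: measurable_compose)
  show ?thesis
    by (rule exp_decaying_scaled[OF f m, where B="onorm L"]) (rule onorm[OF L])
qed

lemma exp_decaying_uminus [dec_intros]: "exp_decaying f \<Longrightarrow> exp_decaying (\<lambda>x. - f x)"
  by (rule exp_decaying_linear[OF bounded_linear_minus[OF bounded_linear_ident]])

lemma exp_decaying_diff [dec_intros]:
  assumes "exp_decaying f" "exp_decaying g" shows "exp_decaying (\<lambda>x. f x - g x)"
  using exp_decaying_add[OF assms(1) exp_decaying_uminus[OF assms(2)]] by simp

lemma exp_decaying_cmult [dec_intros]: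
  fixes f :: "real \<Rightarrow> 'a::{euclidean_space,real_normed_algebra}"
  shows "exp_decaying f \<Longrightarrow> exp_decaying (\<lambda>x. c * f x)"
  by (rule exp_decaying_linear) (auto intro: bounded_linear_mult_right)

lemma exp_decaying_multc [dec_intros]:
  fixes f :: "real \<Rightarrow> 'a::{euclidean_space,real_normed_algebra}"
  shows "exp_decaying f \<Longrightarrow> exp_decaying (\<lambda>x. f x * c)"
  by (rule exp_decaying_linear) (auto intro: bounded_linear_mult_left)

lemma exp_decaying_divide [dec_intros]:
  fixes f :: "real \<Rightarrow> real"
  shows "exp_decaying f \<Longrightarrow> exp_decaying (\<lambda>x. f x / c)"
  using exp_decaying_multc[of f "inverse c"] by (simp add: divide_inverse)

lemma exp_decaying_mult [dec_intros]:
  fixes f g :: "real \<Rightarrow> real"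
  assumes "exp_decaying f" "exp_decaying g" shows "exp_decaying (\<lambda>x. f x * g x)"
proof -
  obtain C where C: "\<And>x. norm (f x) \<le> C" using exp_decaying_bound[OF assms(1)] by blast
  show ?thesis
    by (rule exp_decaying_bounded_mult[OF assms(2), where B=C])
       (use C assms in \<open>auto simp: exp_decaying_def\<close>)
qed

lemma exp_decaying_power2 [dec_intros]:
  fixes f :: "real \<Rightarrow> real"
  shows "exp_decaying f \<Longrightarrow> exp_decaying (\<lambda>x. (f x)\<^sup>2)"
  unfolding power2_eq_square by (rule exp_decaying_mult)

lemma exp_decaying_tendsto:
  fixes f :: "real \<Rightarrow> 'a::euclidean_space"
  assumes "exp_decaying f"
  shows "(f \<longlongrightarrow> 0) at_top" "(f \<longlongrightarrow> 0) at_bot"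
proof -
  obtain C where C: "\<And>x. norm (f x) \<le> C * exp (- (\<bar>x\<bar> / 8))"
    using exp_decaying_bound[OF assms(1)] by blast
  have g: "((\<lambda>x::real. C * exp (- (x / 8))) \<longlongrightarrow> 0) at_top" by real_asymp
  have g': "((\<lambda>x::real. C * exp (x / 8)) \<longlongrightarrow> 0) at_bot" by real_asymp
  show "(f \<longlongrightarrow> 0) at_top"
    by (rule Lim_null_comparison[OF eventually_at_top_linorderI[of 0] g]) (use C in \<open>force intro: order_trans[OF C]\<close>)
  show "(f \<longlongrightarrow> 0) at_bot"
    by (rule Lim_null_comparison[OF eventually_at_bot_linorderI[of 0] g']) (use C in \<open>force intro: order_trans[OF C]\<close>)
qed

lemma integrable_imp_set_integrable:
  fixes G :: "real \<Rightarrow> 'a::euclidean_space"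
  shows "integrable lborel G \<Longrightarrow> A \<in> sets borel \<Longrightarrow> set_integrable lborel A G"
  unfolding set_integrable_def by (rule integrable_mult_indicator) auto

lemma FTC_tail:
  fixes F :: "real \<Rightarrow> real"
  assumes cont: "continuous_on UNIV F" and S: "finite S"
    and D: "\<And>x. x \<notin> S \<Longrightarrow> (F has_real_derivative G x) (at x)"
    and F0: "(F \<longlongrightarrow> 0) at_top" and G: "integrable lborel G"
  shows "(LINT x:{a..}|lborel. G x) = - F a"
proof -
  have 1: "((\<lambda>y. LINT x:{a..y}|lborel. G x) \<longlongrightarrow> (LINT x:{a..}|lborel. G x)) at_top"
    by (rule tendsto_set_lebesgue_integral_at_top)
       (auto intro!: integrable_imp_set_integrable G)
  have e: "(LINT x:{a..y}|lborel. G x) = F y - F a" if "y \<ge> a" for y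
  proof -
    have "(G has_integral (F y - F a)) {a..y}"
      by (rule fundamental_theorem_of_calculus_interior_strong[OF S that])
         (auto intro: continuous_on_subset[OF cont] D simp flip: has_real_derivative_iff_has_vector_derivative)
    moreover have "set_integrable lborel {a..y} G"
      by (auto intro!: integrable_imp_set_integrable G)
    ultimately show ?thesis
      by (simp add: set_borel_integral_eq_integral(2) integral_unique)
  qed
  have "((\<lambda>y. F y - F a) \<longlongrightarrow> 0 - F a) at_top"
    by (intro tendsto_intros F0)
  hence "((\<lambda>y. LINT x:{a..y}|lborel. G x) \<longlongrightarrow> 0 - F a) at_top"
    by (rule Lim_transform_eventually) (auto simp: e intro!: eventually_at_top_linorderI[of a])
  from tendsto_unique[OF _ this 1] show ?thesis by simp
qed

text \<open>The tails starting at \<open>-n\<close> have integral \<open>-F(-n)\<close>, which tends to zero. Each integral identity for the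
quadratic forms below is this lemma for a suitable \<open>F\<close>.\<close>
lemma FTC_line:
  fixes F :: "real \<Rightarrow> real"
  assumes cont: "continuous_on UNIV F" and S: "finite S"
    and D: "\<And>x. x \<notin> S \<Longrightarrow> (F has_real_derivative G x) (at x)"
    and F: "exp_decaying F" and G: "exp_decaying G"
  shows "(LINT x|lborel. G x) = 0"
proof -
  note Gi = exp_decaying_integrable[OF G]
  have "(\<lambda>n. LINT x:{- real n..}|lborel. G x) \<longlonglongrightarrow> (LINT x|lborel. G x)"
    unfolding set_lebesgue_integral_def
  proof (rule integral_dominated_convergence[where w="\<lambda>x. norm (G x)"])
    show "AE x in lborel. (\<lambda>n. indicat_real {- real n..} x *\<^sub>R G x) \<longlonglongrightarrow> G x"
    proof (rule AE_I2)
      fix x :: real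
      obtain N :: nat where N: "- x \<le> real N" using real_arch_simple by blast
      have "\<forall>\<^sub>F n in sequentially. G x = indicat_real {- real n..} x *\<^sub>R G x"
        using N by (intro eventually_sequentiallyI[of N]) (auto simp: indicator_def)
      thus "(\<lambda>n. indicat_real {- real n..} x *\<^sub>R G x) \<longlonglongrightarrow> G x"
        by (rule Lim_transform_eventually[OF tendsto_const])
    qed
  qed (use Gi in \<open>auto simp: indicator_def\<close>)
  moreover have "(LINT x:{- real n..}|lborel. G x) = - F (- real n)" for n
    by (rule FTC_tail[OF cont S D exp_decaying_tendsto(1)[OF F] Gi])
  ultimately have "(\<lambda>n. - F (- real n)) \<longlonglongrightarrow> (LINT x|lborel. G x)" by simp
  moreover have "(\<lambda>n. - F (- real n)) \<longlonglongrightarrow> - 0"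
    by (intro tendsto_minus filterlim_compose[OF exp_decaying_tendsto(2)[OF F]]
        filterlim_uminus_at_bot[THEN iffD2]) (simp add: filterlim_real_sequentially)
  ultimately show ?thesis using LIMSEQ_unique by fastforce
qed

lemma H1_profileD:
  assumes "H1_profile f f'"
  shows "continuous_on UNIV f" "exp_decaying f" "exp_decaying f'"
    "\<exists>S. finite S \<and> (\<forall>x\<in>-S. (f has_vector_derivative f' x) (at x))"
  using assms by (auto simp: H1_profile_def)

lemma H1_profile_linear:
  fixes L :: "'a::euclidean_space \<Rightarrow> 'b::euclidean_space"
  assumes L: "bounded_linear L" and f: "H1_profile f f'"
  shows "H1_profile (\<lambda>x. L (f x)) (\<lambda>x. L (f' x))"
  using H1_profileD[OF f] exp_decaying_linear[OF L]
  unfolding H1_profile_def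
  by (auto intro!: bounded_linear.continuous_on[OF L] bounded_linear.has_vector_derivative[OF L])

lemma H1_profile_add:
  assumes "H1_profile f f'" "H1_profile g g'"
  shows "H1_profile (\<lambda>x. f x + g x) (\<lambda>x. f' x + g' x)"
proof -
  obtain S T where "finite S" "\<And>x. x \<notin> S \<Longrightarrow> (f has_vector_derivative f' x) (at x)"
    "finite T" "\<And>x. x \<notin> T \<Longrightarrow> (g has_vector_derivative g' x) (at x)"
    using assms unfolding H1_profile_def by blast
  hence "\<exists>S. finite S \<and> (\<forall>x\<in>-S. ((\<lambda>x. f x + g x) has_vector_derivative (f' x + g' x)) (at x))"
    by (intro exI[of _ "S \<union> T"]) (auto intro!: derivative_intros)
  thus ?thesis using H1_profileD[OF assms(1)] H1_profileD[OF assms(2)]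
    unfolding H1_profile_def by (auto intro!: dec_intros continuous_intros)
qed

lemma H1_profile_cmult:
  fixes f :: "real \<Rightarrow> 'a::{euclidean_space,real_normed_algebra}"
  assumes "H1_profile f f'" shows "H1_profile (\<lambda>x. c * f x) (\<lambda>x. c * f' x)"
  by (rule H1_profile_linear[OF bounded_linear_mult_right assms])

lemma H1_profile_diff:
  assumes "H1_profile f f'" "H1_profile g g'"
  shows "H1_profile (\<lambda>x. f x - g x) (\<lambda>x. f' x - g' x)"
  using H1_profile_add[OF assms(1) H1_profile_linear[OF bounded_linear_minus[OF bounded_linear_ident] assms(2)]]
  by simp

lemma H1_profile_diff_real:
  fixes f :: "real \<Rightarrow> real"
  assumes "H1_profile f f'"
  shows "\<exists>S. finite S \<and> (\<forall>x. x \<notin> S \<longrightarrow> (f has_real_derivative f' x) (at x))"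
  using assms unfolding H1_profile_def has_real_derivative_iff_has_vector_derivative by blast

lemma H1_profile_Lipschitz:
  fixes f :: "real \<Rightarrow> real"
  assumes f: "H1_profile f f'"
  shows "\<exists>L\<ge>0. \<forall>x y. \<bar>f x - f y\<bar> \<le> L * \<bar>x - y\<bar>"
proof -
  obtain L where L: "L \<ge> 0" "\<And>x. norm (f' x) \<le> L"
    using exp_decaying_bound[OF H1_profileD(3)[OF f]] by blast
  obtain S where S: "finite S" "\<And>x. x \<notin> S \<Longrightarrow> (f has_vector_derivative f' x) (at x)"
    using f unfolding H1_profile_def by blast
  have le: "\<bar>f y - f x\<bar> \<le> L * (y - x)" if "x \<le> y" for x y
  proof -
    have "(f' has_integral (f y - f x)) {x..y}"
      by (rule fundamental_theorem_of_calculus_interior_strong[OF S(1) that])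
         (auto intro: S continuous_on_subset[OF H1_profileD(1)[OF f]])
    from has_integral_bound_real[OF L(1) _ this, of "{}"] that L(2) show ?thesis by (simp add: content_real)
  qed
  have "\<bar>f x - f y\<bar> \<le> L * \<bar>x - y\<bar>" for x y
    using le[of x y] le[of y x] by (cases "x \<le> y") (auto simp: abs_minus_commute)
  with L show ?thesis by blast
qed

text \<open>Integrating \<open>(f\<^sup>2)' = 2 f f'\<close> over the half-line to the right of \<open>x\<close>.\<close>
lemma H1_profile_sup_bound:
  fixes f :: "real \<Rightarrow> real"
  assumes f: "H1_profile f f'"
  shows "(f x)\<^sup>2 \<le> (LINT x|lborel. (f x)\<^sup>2 + (f' x)\<^sup>2)"
proof -
  obtain S where S: "finite S" "\<And>x. x \<notin> S \<Longrightarrow> (f has_real_derivative f' x) (at x)"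
    using H1_profile_diff_real[OF f] by blast
  note d = H1_profileD[OF f]
  have e: "exp_decaying (\<lambda>y. 2 * f y * f' y)" "exp_decaying (\<lambda>y. (f y)\<^sup>2 + (f' y)\<^sup>2)"
    by (intro dec_intros d)+
  have "(LINT y:{x..}|lborel. 2 * f y * f' y) = - (f x)\<^sup>2"
    by (rule FTC_tail[OF _ S(1)])
       (use d in \<open>auto intro!: continuous_intros derivative_eq_intros S exp_decaying_integrable[OF e(1)]
          exp_decaying_tendsto dec_intros\<close>)
  hence "(f x)\<^sup>2 = (LINT y|lborel. - (indicator {x..} y * (2 * f y * f' y)))"
    by (simp add: set_lebesgue_integral_def)
  also have "\<dots> \<le> (LINT y|lborel. (f y)\<^sup>2 + (f' y)\<^sup>2)"
  proof (rule integral_mono)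
    show "integrable lborel (\<lambda>y. - (indicator {x..} y * (2 * f y * f' y)))"
      using integrable_mult_indicator[OF _ exp_decaying_integrable[OF e(1)], of "{x..}"] by simp
    show "integrable lborel (\<lambda>y. (f y)\<^sup>2 + (f' y)\<^sup>2)" by (rule exp_decaying_integrable[OF e(2)])
    fix y show "- (indicator {x..} y * (2 * f y * f' y)) \<le> (f y)\<^sup>2 + (f' y)\<^sup>2"
      using zero_le_power2[of "f y + f' y"] by (auto simp: indicator_def power2_sum)
  qed
  finally show ?thesis .
qed

lemma lint_add: "exp_decaying f \<Longrightarrow> exp_decaying g \<Longrightarrow>
    (LINT x|lborel. f x + g x) = (LINT x|lborel. f x) + (LINT x|lborel. g x)"
  by (intro Bochner_Integration.integral_add exp_decaying_integrable)

lemma lint_diff: "exp_decaying f \<Longrightarrow> exp_decaying g \<Longrightarrow>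
    (LINT x|lborel. f x - g x) = (LINT x|lborel. f x) - (LINT x|lborel. g x)"
  by (intro Bochner_Integration.integral_diff exp_decaying_integrable)

lemma lint_mono:
  fixes f g :: "real \<Rightarrow> real"
  shows "exp_decaying f \<Longrightarrow> exp_decaying g \<Longrightarrow> (\<And>x. f x \<le> g x) \<Longrightarrow>
    (LINT x|lborel. f x) \<le> (LINT x|lborel. g x)"
  by (intro integral_mono exp_decaying_integrable)

text \<open>The quadratic \<open>\<integral>(f - l g)\<^sup>2\<close> in \<open>l\<close> is nonnegative; the optimal \<open>l\<close> gives the inequality.\<close>
lemma lint_Cauchy_Schwarz:
  fixes f g :: "real \<Rightarrow> real"
  assumes f: "exp_decaying f" and g: "exp_decaying g"
  shows "(LINT x|lborel. f x * g x)\<^sup>2 \<le> (LINT x|lborel. (f x)\<^sup>2) * (LINT x|lborel. (g x)\<^sup>2)"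
    (is "?B\<^sup>2 \<le> ?A * ?C")
proof -
  note d = f g dec_intros
  have q: "0 \<le> ?A - 2 * l * ?B + l\<^sup>2 * ?C" for l
  proof -
    have "0 \<le> (LINT x|lborel. (f x - l * g x)\<^sup>2)" by simp
    also have "\<dots> = (LINT x|lborel. (f x)\<^sup>2 - (2 * l) * (f x * g x) + l\<^sup>2 * (g x)\<^sup>2)"
      by (intro Bochner_Integration.integral_cong) (auto simp: power2_eq_square algebra_simps)
    also have "\<dots> = ?A - 2 * l * ?B + l\<^sup>2 * ?C"
      by (simp add: lint_add lint_diff d)
    finally show ?thesis .
  qed
  have C0: "?C \<ge> 0" by simp
  show ?thesis
  proof (cases "?C = 0")
    case True
    have "?B = 0"
    proof (rule ccontr)
      assume "?B \<noteq> 0"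
      with q[of "(?A + 1) / (2 * ?B)"] True show False by (simp add: field_simps)
    qed
    thus ?thesis using True by simp
  next
    case False
    with C0 have C: "?C > 0" by linarith
    have "?A - 2 * (?B / ?C) * ?B + (?B / ?C)\<^sup>2 * ?C = ?A - ?B\<^sup>2 / ?C"
      using C by (simp add: power2_eq_square)
    with q[of "?B / ?C"] have "?B\<^sup>2 / ?C \<le> ?A" by linarith
    with C show ?thesis by (simp add: pos_divide_le_eq)
  qed
qed

section \<open>The hyperbolic profiles\<close>

definition sech4 :: "real \<Rightarrow> real" where "sech4 x = 1 / cosh (x / 4)"
definition tanh4 :: "real \<Rightarrow> real" where "tanh4 x = tanh (x / 4)"

lemma sech4_pos: "sech4 x > 0" by (simp add: sech4_def)
lemma sech4_le1: "sech4 x \<le> 1" by (simp add: sech4_def cosh_real_ge_1)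
lemma tanh4_sq: "(tanh4 x)\<^sup>2 = 1 - (sech4 x)\<^sup>2"
proof -
  have "(cosh (x/4))\<^sup>2 \<noteq> 0" by simp
  thus ?thesis
    by (simp add: tanh4_def sech4_def tanh_def power_divide field_simps cosh_square_eq)
qed
lemma tanh4_abs: "\<bar>tanh4 x\<bar> \<le> 1"
  using tanh4_sq[of x] by (simp add: abs_square_le_1[symmetric])
lemma sech4_0 [simp]: "sech4 0 = 1" and tanh4_0 [simp]: "tanh4 0 = 0"
  by (auto simp: sech4_def tanh4_def)
lemma sech4_even [simp]: "sech4 (-x) = sech4 x" and tanh4_odd [simp]: "tanh4 (-x) = - tanh4 x"
  by (auto simp: sech4_def tanh4_def)

lemma sech4_deriv [derivative_intros]:
  "(f has_real_derivative f') (at x) \<Longrightarrow>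
   ((\<lambda>x. sech4 (f x)) has_real_derivative (- (sech4 (f x) * tanh4 (f x) / 4) * f')) (at x)"
  unfolding sech4_def tanh4_def
  by (auto intro!: derivative_eq_intros simp: tanh_def field_simps power2_eq_square)

lemma tanh4_deriv [derivative_intros]:
  "(f has_real_derivative f') (at x) \<Longrightarrow>
   ((\<lambda>x. tanh4 (f x)) has_real_derivative ((sech4 (f x))\<^sup>2 / 4 * f')) (at x)"
proof -
  assume f: "(f has_real_derivative f') (at x)"
  have "((\<lambda>x. tanh (f x / 4)) has_real_derivative (1 - (tanh (f x / 4))\<^sup>2) * (f' / 4)) (at x)"
    by (auto intro!: derivative_eq_intros f)
  thus ?thesis using tanh4_sq[of "f x"] unfolding tanh4_def[abs_def] by (simp add: mult.commute)
qed

lemma continuous_on_sech4 [continuous_intros]: "continuous_on A f \<Longrightarrow> continuous_on A (\<lambda>x. sech4 (f x))"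
  unfolding sech4_def by (intro continuous_intros) auto
lemma continuous_on_tanh4 [continuous_intros]: "continuous_on A f \<Longrightarrow> continuous_on A (\<lambda>x. tanh4 (f x))"
  unfolding tanh4_def by (intro continuous_intros) auto
lemma sech4_measurable [measurable]: "sech4 \<in> borel_measurable borel"
  by (intro borel_measurable_continuous_onI continuous_intros)
lemma tanh4_measurable [measurable]: "tanh4 \<in> borel_measurable borel"
  by (intro borel_measurable_continuous_onI continuous_intros)

lemma sech4_le_exp: "sech4 x \<le> 2 * exp (- (\<bar>x\<bar> / 4))"
proof -
  have "cosh (x/4) \<ge> exp (\<bar>x\<bar>/4) / 2"
    by (cases "x \<ge> 0") (auto simp: cosh_def)
  hence "1 / cosh (x/4) \<le> 1 / (exp (\<bar>x\<bar>/4) / 2)"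
    by (intro divide_left_mono) auto
  thus ?thesis by (simp add: sech4_def exp_minus field_simps)
qed

lemma exp_decaying_sech4 [dec_intros]: "exp_decaying sech4"
proof (rule exp_decayingI[where C=2])
  fix x :: real
  have e: "exp (- (\<bar>x\<bar> / 4)) \<le> exp (- (\<bar>x\<bar> / 8))" by simp
  show "norm (sech4 x) \<le> 2 * exp (- (\<bar>x\<bar> / 8))"
    using sech4_pos[of x] order_trans[OF sech4_le_exp[of x] mult_left_mono[OF e, of 2]] by simp
qed simp

lemma exp_decaying_x_sech4 [dec_intros]: "exp_decaying (\<lambda>x. x * sech4 x)"
proof (rule exp_decayingI[where C=16])
  fix x :: real
  have "\<bar>x\<bar> / 8 \<le> exp (\<bar>x\<bar> / 8)" using exp_ge_add_one_self[of "\<bar>x\<bar>/8"] by linarith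
  hence "\<bar>x\<bar> * exp (- (\<bar>x\<bar> / 4)) \<le> (8 * exp (\<bar>x\<bar> / 8)) * exp (- (\<bar>x\<bar> / 4))"
    by (intro mult_right_mono) auto
  also have "\<dots> = 8 * exp (- (\<bar>x\<bar> / 8))" by (simp add: exp_add[symmetric])
  finally have 1: "\<bar>x\<bar> * exp (- (\<bar>x\<bar> / 4)) \<le> 8 * exp (- (\<bar>x\<bar> / 8))" .
  have "\<bar>x\<bar> * sech4 x \<le> \<bar>x\<bar> * (2 * exp (- (\<bar>x\<bar> / 4)))"
    by (intro mult_left_mono sech4_le_exp) auto
  with 1 show "norm (x * sech4 x) \<le> 16 * exp (- (\<bar>x\<bar> / 8))"
    using sech4_pos[of x] by (simp add: abs_mult)
qed simp

lemma exp_decaying_tanh4_mult [dec_intros]: "exp_decaying f \<Longrightarrow> exp_decaying (\<lambda>x. tanh4 x * f x)"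
  by (rule exp_decaying_bounded_mult[where B=1]) (auto simp: tanh4_abs)

lemma sech4_profile: "H1_profile sech4 (\<lambda>x. - (tanh4 x * sech4 x) / 4)"
  unfolding H1_profile_def
  by (auto intro!: dec_intros continuous_intros derivative_eq_intros exI[of _ "{}"]
      simp flip: has_real_derivative_iff_has_vector_derivative simp: continuous_on_sech4[OF continuous_on_id, simplified])

section \<open>The linearized forms on functions vanishing at the origin\<close>

text \<open>With \<open>w\<close> this weight, \<open>w' + w\<^sup>2 = - sech\<^sup>2(x/4) / 8\<close> away from the origin: \<open>w\<close> is the logarithmic
derivative of \<open>tanh(x/4)\<close>, the zero-energy solution vanishing at the origin for the potential of \<open>L\<^sub>-\<close>
without its mass term.\<close>
definition hardy_weight :: "real \<Rightarrow> real" where "hardy_weight x = 1 / (2 * sinh (x / 2))"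

lemma sinh_ge_self: "(x::real) \<ge> 0 \<Longrightarrow> sinh x \<ge> x"
proof -
  assume "x \<ge> 0"
  have "sinh 0 - 0 \<le> sinh x - x"
    by (rule DERIV_nonneg_imp_nondecreasing[OF \<open>x \<ge> 0\<close>])
       (auto intro!: exI derivative_eq_intros simp: cosh_real_ge_1)
  thus ?thesis by simp
qed

lemma hardy_weight_abs: "\<bar>hardy_weight x\<bar> * \<bar>x\<bar> \<le> 1"
proof -
  have "\<bar>x / 2\<bar> \<le> \<bar>sinh (x / 2)\<bar>"
    using sinh_ge_self[of "x/2"] sinh_ge_self[of "-x/2"] by (cases "x \<ge> 0") auto
  thus ?thesis by (auto simp: hardy_weight_def abs_mult divide_simps)
qed

lemma double_angle4: "sinh (x / 2) = 2 * sinh (x / 4) * cosh (x / 4)"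
  "cosh (x / 2) = 2 * (cosh (x / 4))\<^sup>2 - 1" "cosh (x / 2) = 2 * (sinh (x / 4))\<^sup>2 + 1" for x :: real
  using sinh_double[of "x/4"] cosh_double_cosh[of "x/4"] cosh_square_eq[of "x/4"] by simp_all

lemma hardy_weight_tanh4: "x \<noteq> 0 \<Longrightarrow> hardy_weight x * tanh4 x = (sech4 x)\<^sup>2 / 4"
  by (simp add: hardy_weight_def tanh4_def sech4_def tanh_def double_angle4 field_simps power2_eq_square)

lemma hardy_weight_deriv:
  assumes "x \<noteq> 0" shows "(hardy_weight has_real_derivative (- ((hardy_weight x)\<^sup>2 + (sech4 x)\<^sup>2 / 8))) (at x)"
proof -
  have s: "sinh (x/2) \<noteq> 0" "sinh (x/4) \<noteq> 0" using assms by auto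
  have "(hardy_weight has_real_derivative - (cosh (x/2) / (4 * (sinh (x/2))\<^sup>2))) (at x)"
    unfolding hardy_weight_def[abs_def] using s
    by (auto intro!: derivative_eq_intros simp: field_simps power2_eq_square)
  moreover have "cosh (x/2) / (4 * (sinh (x/2))\<^sup>2) = (hardy_weight x)\<^sup>2 + (sech4 x)\<^sup>2 / 8"
  proof -
    have "cosh (x/2) = 1 + (sinh (x/2))\<^sup>2 / (2 * (cosh (x/4))\<^sup>2)"
      using s by (simp add: double_angle4(1,3) field_simps power2_eq_square)
    thus ?thesis using s by (simp add: hardy_weight_def sech4_def field_simps power2_eq_square)
  qed
  ultimately show ?thesis by simp
qed

lemma hardy_weight_measurable [measurable]: "hardy_weight \<in> borel_measurable borel"
proof -
  have "(\<lambda>x. sinh (x/2) :: real) \<in> borel_measurable borel"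
    by (intro borel_measurable_continuous_onI continuous_intros) auto
  thus ?thesis unfolding hardy_weight_def[abs_def] by measurable
qed

text \<open>The weight has a simple pole at the origin, which a Lipschitz function vanishing there compensates.\<close>
lemma exp_decaying_hardy_weight:
  assumes b: "H1_profile b b'" and b0: "b 0 = 0"
  shows "exp_decaying (\<lambda>x. hardy_weight x * b x)" "continuous_on UNIV (\<lambda>x. hardy_weight x * b x * b x)"
proof -
  obtain C where C: "C \<ge> 0" "\<And>x. norm (b x) \<le> C * exp (- (\<bar>x\<bar> / 8))"
    using exp_decaying_bound[OF H1_profileD(2)[OF b]] by blast
  obtain L where L: "L \<ge> 0" "\<And>x y. \<bar>b x - b y\<bar> \<le> L * \<bar>x - y\<bar>"
    using H1_profile_Lipschitz[OF b] by blast
  have bL: "\<bar>b x\<bar> \<le> L * \<bar>x\<bar>" for x using L(2)[of x 0] b0 by simp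
  have pL: "\<bar>hardy_weight x * b x\<bar> \<le> L" for x
  proof -
    have "\<bar>hardy_weight x * b x\<bar> \<le> \<bar>hardy_weight x\<bar> * (L * \<bar>x\<bar>)"
      unfolding abs_mult by (intro mult_left_mono bL) auto
    also have "\<dots> = L * (\<bar>hardy_weight x\<bar> * \<bar>x\<bar>)" by simp
    also have "\<dots> \<le> L * 1" by (intro mult_left_mono hardy_weight_abs L)
    finally show ?thesis by simp
  qed
  show "exp_decaying (\<lambda>x. hardy_weight x * b x)"
  \<comment> \<open>The weight is at most \<open>1\<close> for \<open>|x| \<ge> 1\<close>; for \<open>|x| < 1\<close> the product is at most \<open>L\<close>, and \<open>exp (1/8)\<close> undoes the decay factor.\<close>
  proof (rule exp_decayingI[where C="C + L * exp (1/8)"])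
    show "(\<lambda>x. hardy_weight x * b x) \<in> borel_measurable borel"
      using H1_profileD(2)[OF b] by (auto simp: exp_decaying_def)
    fix x
    show "norm (hardy_weight x * b x) \<le> (C + L * exp (1/8)) * exp (- (\<bar>x\<bar> / 8))"
    proof (cases "\<bar>x\<bar> \<ge> 1")
      case True
      have "\<bar>hardy_weight x\<bar> \<le> \<bar>hardy_weight x\<bar> * \<bar>x\<bar>" using mult_left_mono[OF True, of "\<bar>hardy_weight x\<bar>"] by simp
      hence "\<bar>hardy_weight x\<bar> \<le> 1" using hardy_weight_abs[of x] by linarith
      hence "\<bar>hardy_weight x * b x\<bar> \<le> 1 * \<bar>b x\<bar>" unfolding abs_mult by (intro mult_right_mono) auto
      also have "\<dots> \<le> C * exp (- (\<bar>x\<bar> / 8))" using C by simp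
      also have "\<dots> \<le> (C + L * exp (1/8)) * exp (- (\<bar>x\<bar> / 8))" using L by (intro mult_right_mono) auto
      finally show ?thesis by simp
    next
      case False
      hence "1 \<le> exp (1/8 - \<bar>x\<bar> / 8)" by simp
      also have "\<dots> = exp (1/8) * exp (- (\<bar>x\<bar> / 8))" by (simp add: exp_add[symmetric])
      finally have "L * 1 \<le> L * (exp (1/8) * exp (- (\<bar>x\<bar> / 8)))" using L(1) by (rule mult_left_mono)
      also have "\<dots> \<le> (C + L * exp (1/8)) * exp (- (\<bar>x\<bar> / 8))"
        using C(1) by (simp add: algebra_simps)
      finally show ?thesis using pL[of x] by simp
    qed
  qed
  show "continuous_on UNIV (\<lambda>x. hardy_weight x * b x * b x)"
    unfolding continuous_on_eq_continuous_at[OF open_UNIV]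
  proof
    fix x :: real
    have cb: "isCont b y" for y
      using H1_profileD(1)[OF b] by (simp add: continuous_on_eq_continuous_at)
    show "isCont (\<lambda>x. hardy_weight x * b x * b x) x"
    proof (cases "x = 0")
      case False
      thus ?thesis by (intro continuous_mult DERIV_isCont[OF hardy_weight_deriv] cb)
    next
      case True
      have "((\<lambda>x. hardy_weight x * b x * b x) \<longlongrightarrow> 0) (at 0)"
      proof (rule Lim_null_comparison)
        show "\<forall>\<^sub>F x in at 0. norm (hardy_weight x * b x * b x) \<le> L * \<bar>b x\<bar>"
          unfolding real_norm_def abs_mult
          by (intro always_eventually allI mult_right_mono pL[unfolded abs_mult]) auto
        have "((\<lambda>x. L * \<bar>b x\<bar>) \<longlongrightarrow> L * \<bar>b 0\<bar>) (at 0)"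
          using cb[of 0] by (intro tendsto_intros) (simp add: isCont_def)
        thus "((\<lambda>x. L * \<bar>b x\<bar>) \<longlongrightarrow> 0) (at 0)" using b0 by simp
      qed
      thus ?thesis using True b0 by (simp add: isCont_def)
    qed
  qed
qed

text \<open>Integrate the derivative of \<open>w b\<^sup>2\<close> and use the Riccati equation for \<open>w\<close>.\<close>
lemma hardy_weight_completion:
  assumes b: "H1_profile b b'" and b0: "b 0 = 0"
  shows "2 * (LINT x|lborel. hardy_weight x * b x * b' x) =
     (LINT x|lborel. (hardy_weight x * b x)\<^sup>2) + (LINT x|lborel. (sech4 x)\<^sup>2 * (b x)\<^sup>2) / 8"
proof -
  note d = H1_profileD(2,3)[OF b] exp_decaying_hardy_weight(1)[OF b b0] dec_intros
  obtain S where S: "finite S" "\<And>x. x \<notin> S \<Longrightarrow> (b has_real_derivative b' x) (at x)"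
    using H1_profile_diff_real[OF b] by blast
  have "(LINT x|lborel. 2 * ((hardy_weight x * b x) * b' x) - (hardy_weight x * b x)\<^sup>2 - ((sech4 x)\<^sup>2 * (b x)\<^sup>2) / 8) = 0"
  proof (rule FTC_line[where S = "insert 0 S" and F = "\<lambda>x. hardy_weight x * b x * b x"])
    show "continuous_on UNIV (\<lambda>x. hardy_weight x * b x * b x)" by (rule exp_decaying_hardy_weight(2)[OF b b0])
    fix x assume "x \<notin> insert 0 S"
    hence "((\<lambda>x. hardy_weight x * b x * b x) has_real_derivative
       (- ((hardy_weight x)\<^sup>2 + (sech4 x)\<^sup>2 / 8) * b x + hardy_weight x * b' x) * b x + hardy_weight x * b x * b' x) (at x)"
      by (auto intro!: derivative_eq_intros hardy_weight_deriv S)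
    thus "((\<lambda>x. hardy_weight x * b x * b x) has_real_derivative
       2 * ((hardy_weight x * b x) * b' x) - (hardy_weight x * b x)\<^sup>2 - ((sech4 x)\<^sup>2 * (b x)\<^sup>2) / 8) (at x)"
      by (simp add: algebra_simps power2_eq_square)
  qed (use S(1) in \<open>auto intro!: d\<close>)
  thus ?thesis by (simp add: lint_diff d)
qed

text \<open>By \<open>hardy_weight_completion\<close> the difference of the two sides is \<open>\<integral>(b' - w b)\<^sup>2\<close>.\<close>
lemma Lminus_nonneg:
  assumes b: "H1_profile b b'" and b0: "b 0 = 0"
  shows "(LINT x|lborel. (sech4 x)\<^sup>2 * (b x)\<^sup>2) / 8 \<le> (LINT x|lborel. (b' x)\<^sup>2)"
proof -
  note d = H1_profileD(2,3)[OF b] exp_decaying_hardy_weight(1)[OF b b0] dec_intros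
  have "0 \<le> (LINT x|lborel. (b' x - hardy_weight x * b x)\<^sup>2)" by simp
  also have "\<dots> = (LINT x|lborel. (b' x)\<^sup>2 - 2 * ((hardy_weight x * b x) * b' x) + (hardy_weight x * b x)\<^sup>2)"
    by (intro Bochner_Integration.integral_cong) (auto simp: power2_eq_square algebra_simps)
  also have "\<dots> = (LINT x|lborel. (b' x)\<^sup>2) - (LINT x|lborel. (sech4 x)\<^sup>2 * (b x)\<^sup>2) / 8"
    using hardy_weight_completion[OF b b0] by (simp add: lint_add lint_diff d)
  finally show ?thesis by simp
qed

text \<open>The function \<open>q = w - tanh(x/4)/4\<close> is \<open>k'/k\<close> for \<open>k = sech(x/4) tanh(x/4)\<close>, which spans the kernel of \<open>L\<^sub>+\<close> and
vanishes only at the origin. Completing the square with \<open>q\<close> therefore reproduces the potential of \<open>L\<^sub>+\<close>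
exactly. The cross terms are evaluated by \<open>hardy_weight_completion\<close> and by integrating the derivative of
\<open>tanh(x/4) b\<^sup>2\<close>.\<close>
lemma Lplus_square:
  assumes b: "H1_profile b b'" and b0: "b 0 = 0"
  shows "(LINT x|lborel. (b' x - hardy_weight x * b x + tanh4 x * b x / 4)\<^sup>2) =
    (LINT x|lborel. (b' x)\<^sup>2) + (LINT x|lborel. (b x)\<^sup>2) / 16
      - 3 / 8 * (LINT x|lborel. (sech4 x)\<^sup>2 * (b x)\<^sup>2)"
proof -
  note d = H1_profileD(2,3)[OF b] exp_decaying_hardy_weight(1)[OF b b0] dec_intros
  obtain S where S: "finite S" "\<And>x. x \<notin> S \<Longrightarrow> (b has_real_derivative b' x) (at x)"
    using H1_profile_diff_real[OF b] by blast
  have "(LINT x|lborel. tanh4 x * (b x * b' x) / 2 + (sech4 x)\<^sup>2 * (b x)\<^sup>2 / 16) = 0"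
  proof (rule FTC_line[where S = S and F = "\<lambda>x. tanh4 x * (b x * b x) / 4"])
    show "continuous_on UNIV (\<lambda>x. tanh4 x * (b x * b x) / 4)"
      using H1_profileD(1)[OF b] by (intro continuous_intros) auto
    fix x assume "x \<notin> S"
    thus "((\<lambda>x. tanh4 x * (b x * b x) / 4) has_real_derivative
       tanh4 x * (b x * b' x) / 2 + (sech4 x)\<^sup>2 * (b x)\<^sup>2 / 16) (at x)"
      by (auto intro!: derivative_eq_intros S simp: field_simps power2_eq_square)
  qed (use S(1) in \<open>auto intro!: d\<close>)
  hence t: "(LINT x|lborel. tanh4 x * (b x * b' x)) / 2 + (LINT x|lborel. (sech4 x)\<^sup>2 * (b x)\<^sup>2) / 16 = 0"
    by (simp add: lint_add d)
  have "(b' x - hardy_weight x * b x + tanh4 x * b x / 4)\<^sup>2 =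
     (b' x)\<^sup>2 - 2 * (hardy_weight x * b x * b' x) + (hardy_weight x * b x)\<^sup>2 + tanh4 x * (b x * b' x) / 2
       + (b x)\<^sup>2 / 16 - 3 / 16 * ((sech4 x)\<^sup>2 * (b x)\<^sup>2)" for x
  proof -
    have "hardy_weight x * tanh4 x * (b x)\<^sup>2 = (sech4 x)\<^sup>2 / 4 * (b x)\<^sup>2"
      using hardy_weight_tanh4[of x] b0 by (cases "x = 0") auto
    moreover have "(tanh4 x)\<^sup>2 * (b x)\<^sup>2 = (b x)\<^sup>2 - (sech4 x)\<^sup>2 * (b x)\<^sup>2"
      by (simp add: tanh4_sq algebra_simps)
    moreover have "(b' x - hardy_weight x * b x + tanh4 x * b x / 4)\<^sup>2 =
       (b' x)\<^sup>2 - 2 * (hardy_weight x * b x * b' x) + (hardy_weight x * b x)\<^sup>2 + tanh4 x * (b x * b' x) / 2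
         + ((tanh4 x)\<^sup>2 * (b x)\<^sup>2) / 16 - (hardy_weight x * tanh4 x * (b x)\<^sup>2) / 2"
      by (simp add: power2_eq_square algebra_simps)
    ultimately show ?thesis by argo
  qed
  hence "(LINT x|lborel. (b' x - hardy_weight x * b x + tanh4 x * b x / 4)\<^sup>2) =
     (LINT x|lborel. (b' x)\<^sup>2 - 2 * (hardy_weight x * b x * b' x) + (hardy_weight x * b x)\<^sup>2 + tanh4 x * (b x * b' x) / 2
       + (b x)\<^sup>2 / 16 - 3 / 16 * ((sech4 x)\<^sup>2 * (b x)\<^sup>2))"
    by (intro Bochner_Integration.integral_cong) auto
  also have "\<dots> = (LINT x|lborel. (b' x)\<^sup>2) - 2 * (LINT x|lborel. hardy_weight x * b x * b' x)
     + (LINT x|lborel. (hardy_weight x * b x)\<^sup>2) + (LINT x|lborel. tanh4 x * (b x * b' x)) / 2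
     + (LINT x|lborel. (b x)\<^sup>2) / 16 - 3 / 16 * (LINT x|lborel. (sech4 x)\<^sup>2 * (b x)\<^sup>2)"
    by (simp add: lint_add lint_diff d)
  finally show ?thesis using t hardy_weight_completion[OF b b0] by linarith
qed

text \<open>The absolute value of the kernel element of \<open>L\<^sub>+\<close>: up to a constant factor \<open>|\<eta>'|\<close>. It is the even
direction along which the square in \<open>Lplus_square\<close> degenerates.\<close>
definition kernel_profile :: "real \<Rightarrow> real" where
  "kernel_profile x = sech4 x * \<bar>tanh4 x\<bar>"

definition kernel_profile' :: "real \<Rightarrow> real" where
  "kernel_profile' x = sgn x * (sech4 x ^ 3 - sech4 x * (tanh4 x)\<^sup>2) / 4"

lemma tanh4_sgn: "\<bar>tanh4 x\<bar> = sgn x * tanh4 x"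
  by (cases x "0::real" rule: linorder_cases) (auto simp: tanh4_def)

lemma kernel_profile_even [simp]: "kernel_profile (- x) = kernel_profile x"
  by (simp add: kernel_profile_def)

lemma kernel_profile: "H1_profile kernel_profile kernel_profile'"
  unfolding H1_profile_def
proof (intro conjI exI[of _ "{0}"] ballI)
  show c: "continuous_on UNIV kernel_profile"
    unfolding kernel_profile_def[abs_def] by (intro continuous_intros)
  have "exp_decaying (\<lambda>x. \<bar>tanh4 x\<bar> * sech4 x)"
    by (rule exp_decaying_bounded_mult[where B=1]) (auto simp: tanh4_abs intro: dec_intros)
  thus "exp_decaying kernel_profile"
    unfolding kernel_profile_def[abs_def] by (simp add: mult.commute)
  have "exp_decaying (\<lambda>x. sgn x * (((sech4 x)\<^sup>2 * sech4 x - tanh4 x * (tanh4 x * sech4 x)) / 4))"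
    by (rule exp_decaying_bounded_mult[where B=1]) (auto simp: abs_sgn_eq intro!: dec_intros)
  moreover have "kernel_profile' = (\<lambda>x. sgn x * (((sech4 x)\<^sup>2 * sech4 x - tanh4 x * (tanh4 x * sech4 x)) / 4))"
    by (auto simp: kernel_profile'_def fun_eq_iff power2_eq_square power3_eq_cube)
  ultimately show "exp_decaying kernel_profile'" by simp
  fix x :: real assume "x \<in> - {0}"
  hence x: "x \<noteq> 0" by simp
  have "((\<lambda>y. sgn x * (sech4 y * tanh4 y)) has_real_derivative kernel_profile' x) (at x)"
    unfolding kernel_profile'_def
    by (auto intro!: derivative_eq_intros simp: field_simps power2_eq_square power3_eq_cube)
  hence "(kernel_profile has_real_derivative kernel_profile' x) (at x)"
  proof (rule DERIV_cong_ev[THEN iffD1, rotated -1])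
    have "\<forall>\<^sub>F y in nhds x. sgn y = sgn x"
    proof (cases "x > 0")
      case True
      hence "\<forall>\<^sub>F y in nhds x. y > 0" using eventually_nhds_in_open[of "{0<..}" x] by simp
      thus ?thesis by eventually_elim (use True in auto)
    next
      case False
      with x have "\<forall>\<^sub>F y in nhds x. y < 0" using eventually_nhds_in_open[of "{..<0}" x] by simp
      thus ?thesis by eventually_elim (use False x in auto)
    qed
    thus "\<forall>\<^sub>F y in nhds x. sgn x * (sech4 y * tanh4 y) = kernel_profile y"
      by eventually_elim (simp add: kernel_profile_def tanh4_sgn mult_ac)
  qed simp_all
  thus "(kernel_profile has_vector_derivative kernel_profile' x) (at x)"
    by (simp add: has_real_derivative_iff_has_vector_derivative)
qed simp

lemma kernel_profile_annihilated:
  "kernel_profile' x - hardy_weight x * kernel_profile x + tanh4 x * kernel_profile x / 4 = 0"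
proof (cases "x = 0")
  case False
  have "hardy_weight x * kernel_profile x = sgn x * sech4 x * (hardy_weight x * tanh4 x)"
    by (simp add: kernel_profile_def tanh4_sgn mult_ac)
  also have "\<dots> = sgn x * sech4 x ^ 3 / 4"
    using hardy_weight_tanh4[OF False] by (simp add: power2_eq_square power3_eq_cube)
  finally have 1: "hardy_weight x * kernel_profile x = sgn x * sech4 x ^ 3 / 4" .
  have 2: "tanh4 x * kernel_profile x = sgn x * sech4 x * (tanh4 x)\<^sup>2"
    by (simp add: kernel_profile_def tanh4_sgn power2_eq_square)
  show ?thesis unfolding 1 2 kernel_profile'_def by (simp add: field_simps)
qed (simp add: kernel_profile_def kernel_profile'_def)

text \<open>A spectral gap for the first-order operator \<open>B g = g' - q g\<close> follows from a multiplier \<open>J\<close> with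
\<open>J' + 2 J q \<ge> 1\<close>, by integrating the derivative of \<open>J g\<^sup>2\<close>. Near the origin \<open>J = (2/3) sinh(x/2)\<close>
solves \<open>J' + 2 J q = 1\<close>. Far out \<open>q\<close> has the sign of \<open>-x\<close>, and the constant \<open>J = -4 sgn x\<close> satisfies the
inequality once \<open>2 (cosh(x/2) - 3) / cosh(x/2) \<ge> 1\<close>, that is \<open>cosh(x/2) \<ge> 6\<close>. The two pieces
do not match at the radius where \<open>cosh(x/2) = 6\<close>, so \<open>g\<close> has to vanish there.\<close>
definition gap_radius :: real where "gap_radius = 2 * arcosh 6"

lemma gap_radius: "gap_radius > 0" "cosh (gap_radius / 2) = 6" "\<And>x. cosh (x / 2) \<le> 6 \<longleftrightarrow> \<bar>x\<bar> \<le> gap_radius"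
proof -
  have a: "arcosh 6 > (0::real)" unfolding arcosh_real_def[of 6, simplified] by (rule ln_gt_zero) (simp add: add_strict_increasing)
  show "gap_radius > 0" using a by (simp add: gap_radius_def)
  show c: "cosh (gap_radius / 2) = 6" by (simp add: gap_radius_def cosh_arcosh_real)
  show "cosh (x / 2) \<le> 6 \<longleftrightarrow> \<bar>x\<bar> \<le> gap_radius" for x
  proof -
    have e: "cosh (x / 2) = cosh (\<bar>x\<bar> / 2)" by (metis abs_divide abs_numeral cosh_real_abs)
    have "cosh (\<bar>x\<bar> / 2) \<le> cosh (gap_radius / 2) \<longleftrightarrow> \<bar>x\<bar> / 2 \<le> gap_radius / 2"
      by (rule cosh_real_nonneg_le_iff) (use a in \<open>auto simp: gap_radius_def\<close>)
    thus ?thesis unfolding e c by simp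
  qed
qed

definition gap_weight :: "real \<Rightarrow> real" where
  "gap_weight x = (if \<bar>x\<bar> \<le> gap_radius then 2 / 3 * sinh (x / 2) else - 4 * sgn x)"

lemma gap_weight_bound: "\<bar>gap_weight x\<bar> \<le> 4"
proof (cases "\<bar>x\<bar> \<le> gap_radius")
  case True
  hence "cosh (x/2) \<le> 6" using gap_radius by blast
  moreover have "\<bar>sinh (x/2)\<bar> \<le> cosh (x/2)"
    using sinh_less_cosh_real[of "x/2"] sinh_less_cosh_real[of "-x/2"] by (auto simp: abs_if)
  ultimately show ?thesis using True by (simp add: gap_weight_def abs_mult)
qed (auto simp: gap_weight_def abs_mult abs_sgn_eq)

lemma gap_weight_measurable [measurable]: "gap_weight \<in> borel_measurable borel"
proof -
  have "(\<lambda>x. sinh (x/2) :: real) \<in> borel_measurable borel"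
    by (intro borel_measurable_continuous_onI continuous_intros) auto
  thus ?thesis unfolding gap_weight_def[abs_def] by measurable
qed

definition gap_weight' :: "real \<Rightarrow> real" where
  "gap_weight' x = (if \<bar>x\<bar> \<le> gap_radius then cosh (x / 2) / 3 else 0)"

lemma gap_weight'_bound: "\<bar>gap_weight' x\<bar> \<le> 2"
  using gap_radius(3)[of x] by (auto simp: gap_weight'_def)

lemma gap_weight'_measurable [measurable]: "gap_weight' \<in> borel_measurable borel"
proof -
  have "(\<lambda>x. cosh (x/2) :: real) \<in> borel_measurable borel"
    by (intro borel_measurable_continuous_onI continuous_intros) auto
  thus ?thesis unfolding gap_weight'_def[abs_def] by measurable
qed

lemma gap_weight_ineq:
  assumes "x \<noteq> 0"
  shows "1 \<le> gap_weight' x + 2 * gap_weight x * (hardy_weight x - tanh4 x / 4)"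
proof -
  have s: "sinh (x/2) \<noteq> 0" "sinh (x/4) \<noteq> 0" using assms by auto
  have t: "tanh4 x = sinh (x/2) / (1 + cosh (x/2))"
    using s by (simp add: tanh4_def tanh_def double_angle4(1,2) field_simps power2_eq_square)
  have sq: "(sinh (x/2))\<^sup>2 = (cosh (x/2) - 1) * (cosh (x/2) + 1)"
    using cosh_square_eq[of "x/2"] by (simp add: power2_eq_square algebra_simps)
  have c1: "1 + cosh (x/2) > 0" using cosh_real_pos[of "x/2"] by linarith
  have st: "sinh (x/2) * tanh4 x = cosh (x/2) - 1"
    using c1 sq by (simp add: t power2_eq_square field_simps)
  have sh: "sinh (x/2) * hardy_weight x = 1 / 2" using s by (simp add: hardy_weight_def)
  show ?thesis
  proof (cases "\<bar>x\<bar> \<le> gap_radius")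
    case True
    have "gap_weight' x + 2 * gap_weight x * (hardy_weight x - tanh4 x / 4) =
       cosh (x/2) / 3 + 4/3 * (sinh (x/2) * hardy_weight x) - 1/3 * (sinh (x/2) * tanh4 x)"
      using True by (simp add: gap_weight_def gap_weight'_def field_simps)
    thus ?thesis unfolding st sh by (simp add: field_simps)
  next
    case False
    hence c6: "cosh (x/2) > 6" using gap_radius(3)[of x] by linarith
    have "sinh (x/2) * (tanh4 x / 4 - hardy_weight x) = (cosh (x/2) - 3) / 4"
      using st sh by (simp add: algebra_simps)
    hence e: "tanh4 x / 4 - hardy_weight x = (cosh (x/2) - 3) / (4 * sinh (x/2))"
      using s by (simp add: field_simps)
    have "sgn x * (tanh4 x / 4 - hardy_weight x) = (cosh (x/2) - 3) / (4 * \<bar>sinh (x/2)\<bar>)"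
      unfolding e by (cases x "0::real" rule: linorder_cases) (use assms in \<open>auto simp: divide_simps\<close>)
    also have "\<dots> \<ge> (cosh (x/2) - 3) / (4 * cosh (x/2))"
      using c6 sinh_less_cosh_real[of "x/2"] sinh_less_cosh_real[of "-x/2"] s
      by (intro divide_left_mono mult_left_mono) (auto simp: abs_if)
    moreover have "(cosh (x/2) - 3) / (4 * cosh (x/2)) \<ge> 1/8"
      using c6 by (simp add: field_simps)
    ultimately have "sgn x * (tanh4 x / 4 - hardy_weight x) \<ge> 1/8" by linarith
    thus ?thesis using False by (simp add: gap_weight_def gap_weight'_def algebra_simps)
  qed
qed

text \<open>On the positive half-line the integrand is \<open>(- 2 sech\<^sup>2(x/4))'\<close>.\<close>
lemma kernel_overlap: "(LINT x|lborel. kernel_profile x * sech4 x) \<ge> 2"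
proof -
  note d = H1_profileD(2)[OF kernel_profile] dec_intros
  have e: "exp_decaying (\<lambda>x. tanh4 x * (sech4 x)\<^sup>2)" by (intro d)
  have "(LINT x:{0..}|lborel. tanh4 x * (sech4 x)\<^sup>2) = - (- (2 * (sech4 0)\<^sup>2))"
  proof (rule FTC_tail[where S="{}"])
    show "((\<lambda>x. - (2 * (sech4 x)\<^sup>2)) \<longlongrightarrow> 0) at_top"
      by (intro exp_decaying_tendsto d)
    show "integrable lborel (\<lambda>x. tanh4 x * (sech4 x)\<^sup>2)" by (rule exp_decaying_integrable[OF e])
  qed (auto intro!: continuous_intros derivative_eq_intros simp: power2_eq_square)
  hence "2 = (LINT x|lborel. indicator {0..} x * (tanh4 x * (sech4 x)\<^sup>2))"
    by (simp add: set_lebesgue_integral_def)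
  also have "\<dots> \<le> (LINT x|lborel. kernel_profile x * sech4 x)"
  proof (rule lint_mono)
    show "exp_decaying (\<lambda>x. indicator {0..} x * (tanh4 x * (sech4 x)\<^sup>2))"
      by (rule exp_decaying_bounded_mult[OF e, where B=1]) (auto simp: indicator_def)
    show "exp_decaying (\<lambda>x. kernel_profile x * sech4 x)" by (intro d)
    show "indicator {0..} x * (tanh4 x * (sech4 x)\<^sup>2) \<le> kernel_profile x * sech4 x" for x
      using abs_ge_self[of "tanh4 x"] sech4_pos[of x]
      by (auto simp: indicator_def kernel_profile_def power2_eq_square mult_ac intro!: mult_left_mono)
  qed
  finally show ?thesis .
qed

lemma sech4_mass: "(LINT x|lborel. (sech4 x)\<^sup>2) \<ge> 2"
proof -
  note d = H1_profileD(2)[OF kernel_profile] dec_intros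
  have "(LINT x|lborel. kernel_profile x * sech4 x) \<le> (LINT x|lborel. (sech4 x)\<^sup>2)"
  proof (rule lint_mono)
    show "kernel_profile x * sech4 x \<le> (sech4 x)\<^sup>2" for x
      using mult_left_le[OF tanh4_abs, of "sech4 x * sech4 x" x]
      by (simp add: kernel_profile_def power2_eq_square mult_ac)
  qed (intro d)+
  with kernel_overlap show ?thesis by linarith
qed

text \<open>With the multiplier \<open>J\<close>, \<open>(J g\<^sup>2)' = (J' + 2 J q) g\<^sup>2 + 2 J g (B g) \<ge> g\<^sup>2 / 2 - 2 J\<^sup>2 (B g)\<^sup>2\<close>, and \<open>|J| \<le> 4\<close>.
The zeros of \<open>g\<close> at the jumps of \<open>J\<close> make \<open>J g\<^sup>2\<close> continuous.\<close>
lemma Lplus_gap_pinned: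
  assumes g: "H1_profile g g'" and g0: "g 0 = 0" and gx: "g gap_radius = 0" "g (- gap_radius) = 0"
  shows "(LINT x|lborel. (g x)\<^sup>2) \<le> 64 * (LINT x|lborel. (g' x - hardy_weight x * g x + tanh4 x * g x / 4)\<^sup>2)"
proof -
  define B where "B x = g' x - hardy_weight x * g x + tanh4 x * g x / 4" for x
  note d0 = H1_profileD(2,3)[OF g] exp_decaying_hardy_weight(1)[OF g g0] dec_intros
  have B: "exp_decaying B" unfolding B_def[abs_def] by (intro d0)
  have J: "exp_decaying (\<lambda>x. gap_weight x * f x)" "exp_decaying (\<lambda>x. gap_weight' x * f x)"
    if "exp_decaying f" for f
    using that by (auto intro!: exp_decaying_bounded_mult gap_weight_bound gap_weight'_bound)
  note d = d0 B J
  obtain S where S: "finite S" "\<And>x. x \<notin> S \<Longrightarrow> (g has_real_derivative g' x) (at x)"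
    using H1_profile_diff_real[OF g] by blast
  note gc = H1_profileD(1)[OF g]
  have gl: "4 * (g x)\<^sup>2 = gap_weight x * (g x)\<^sup>2" if "x \<le> - gap_radius" for x
    using that gap_radius(1) gx by (cases "x = - gap_radius") (simp_all add: gap_weight_def)
  have gr: "- 4 * (g x)\<^sup>2 = gap_weight x * (g x)\<^sup>2" if "x \<ge> gap_radius" for x
    using that gap_radius(1) gx by (cases "x = gap_radius") (simp_all add: gap_weight_def)
  let ?G = "\<lambda>x. gap_weight' x * (g x)\<^sup>2 + 2 * (gap_weight x * (g x * g' x))"
  have z: "(LINT x|lborel. ?G x) = 0"
  proof (rule FTC_line[where S = "S \<union> {gap_radius, - gap_radius}" and F = "\<lambda>x. gap_weight x * (g x)\<^sup>2"])
    have "continuous_on ({..- gap_radius} \<union> ({- gap_radius..gap_radius} \<union> {gap_radius..})) (\<lambda>x. gap_weight x * (g x)\<^sup>2)"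
    proof (intro continuous_on_closed_Un)
      have "continuous_on {..- gap_radius} (\<lambda>x. 4 * (g x)\<^sup>2)"
        by (intro continuous_intros continuous_on_subset[OF gc]) auto
      thus "continuous_on {..- gap_radius} (\<lambda>x. gap_weight x * (g x)\<^sup>2)"
        by (rule continuous_on_eq) (simp add: gl)
      have "continuous_on {gap_radius..} (\<lambda>x. - 4 * (g x)\<^sup>2)"
        by (intro continuous_intros continuous_on_subset[OF gc]) auto
      thus "continuous_on {gap_radius..} (\<lambda>x. gap_weight x * (g x)\<^sup>2)"
        by (rule continuous_on_eq) (simp only: gr atLeast_iff)
      have "continuous_on {- gap_radius..gap_radius} (\<lambda>x. 2 / 3 * sinh (x / 2) * (g x)\<^sup>2)"
        by (intro continuous_intros continuous_on_subset[OF gc]) auto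
      thus "continuous_on {- gap_radius..gap_radius} (\<lambda>x. gap_weight x * (g x)\<^sup>2)"
        by (rule continuous_on_eq) (auto simp: gap_weight_def)
    qed (intro closed_Un closed_atMost closed_atLeast closed_atLeastAtMost)+
    moreover have "{..- gap_radius} \<union> ({- gap_radius..gap_radius} \<union> {gap_radius..}) = (UNIV :: real set)" using gap_radius(1) by auto
    ultimately show "continuous_on UNIV (\<lambda>x. gap_weight x * (g x)\<^sup>2)" by simp
    fix x assume x: "x \<notin> S \<union> {gap_radius, - gap_radius}"
    hence gd: "(g has_real_derivative g' x) (at x)" using S by blast
    consider "x < - gap_radius" | "- gap_radius < x" "x < gap_radius" | "x > gap_radius" using x by force
    thus "((\<lambda>x. gap_weight x * (g x)\<^sup>2) has_real_derivative ?G x) (at x)"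
    proof cases
      case 1
      have "((\<lambda>x. 4 * (g x)\<^sup>2) has_real_derivative ?G x) (at x)"
        using 1 gap_radius(1) by (auto intro!: derivative_eq_intros gd simp: gap_weight_def gap_weight'_def)
      moreover have "\<forall>\<^sub>F y in nhds x. 4 * (g y)\<^sup>2 = gap_weight y * (g y)\<^sup>2"
        by (rule eventually_mono[OF eventually_nhds_in_open[of "{..< - gap_radius}" x]]) (simp, use 1 in simp, rule gl, simp)
      ultimately show ?thesis by (rule DERIV_cong_ev[THEN iffD1, rotated -1, OF _ refl _ refl])
    next
      case 3
      have "((\<lambda>x. - 4 * (g x)\<^sup>2) has_real_derivative ?G x) (at x)"
        using 3 gap_radius(1) by (auto intro!: derivative_eq_intros gd simp: gap_weight_def gap_weight'_def)
      moreover have "\<forall>\<^sub>F y in nhds x. - 4 * (g y)\<^sup>2 = gap_weight y * (g y)\<^sup>2"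
        using eventually_nhds_in_open[of "{gap_radius <..}" x] 3 gr by (auto elim!: eventually_mono simp del: mult_minus_left)
      ultimately show ?thesis by (rule DERIV_cong_ev[THEN iffD1, rotated -1, OF _ refl _ refl])
    next
      case 2
      have "((\<lambda>x. 2 / 3 * sinh (x / 2) * (g x)\<^sup>2) has_real_derivative ?G x) (at x)"
        using 2 by (auto intro!: derivative_eq_intros gd simp: gap_weight_def gap_weight'_def field_simps)
      moreover have "\<forall>\<^sub>F y in nhds x. 2 / 3 * sinh (y / 2) * (g y)\<^sup>2 = gap_weight y * (g y)\<^sup>2"
        using eventually_nhds_in_open[of "{- gap_radius <..< gap_radius}" x] 2
        by (auto elim!: eventually_mono simp: gap_weight_def)
      ultimately show ?thesis by (rule DERIV_cong_ev[THEN iffD1, rotated -1, OF _ refl _ refl])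
    qed
  qed (use S(1) in \<open>auto intro!: d\<close>)
  have pw: "(g x)\<^sup>2 / 2 - 32 * (B x)\<^sup>2 \<le> ?G x" for x
  proof (cases "x = 0")
    case True
    have "0 \<le> 1/2 * (g x)\<^sup>2 + 32 * (B x)\<^sup>2" by simp
    thus ?thesis using True g0 by (simp add: gap_weight'_def gap_weight_def)
  next
    case False
    have G: "?G x = (g x)\<^sup>2 * (gap_weight' x + 2 * gap_weight x * (hardy_weight x - tanh4 x / 4)) + 2 * (gap_weight x * B x) * g x"
      by (simp add: B_def power2_eq_square algebra_simps)
    have 1: "(g x)\<^sup>2 * 1 \<le> (g x)\<^sup>2 * (gap_weight' x + 2 * gap_weight x * (hardy_weight x - tanh4 x / 4))"
      by (intro mult_left_mono gap_weight_ineq False) auto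
    have "0 \<le> (g x + 2 * (gap_weight x * B x))\<^sup>2" by simp
    hence 2: "2 * (gap_weight x * B x) * g x \<ge> - ((g x)\<^sup>2 / 2) - 2 * ((gap_weight x)\<^sup>2 * (B x)\<^sup>2)"
      by (simp add: power2_eq_square algebra_simps)
    have "(gap_weight x)\<^sup>2 \<le> 4\<^sup>2" using gap_weight_bound[of x] by (intro abs_le_square_iff[THEN iffD1]) auto
    hence "(gap_weight x)\<^sup>2 * (B x)\<^sup>2 \<le> 16 * (B x)\<^sup>2" by (intro mult_right_mono) auto
    with 1 2 show ?thesis unfolding G by linarith
  qed
  have "(LINT x|lborel. (g x)\<^sup>2 / 2 - 32 * (B x)\<^sup>2) \<le> (LINT x|lborel. ?G x)"
    by (rule lint_mono[OF _ _ pw]) (intro d)+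
  hence "(LINT x|lborel. (g x)\<^sup>2) / 2 - 32 * (LINT x|lborel. (B x)\<^sup>2) \<le> 0"
    unfolding z by (simp add: lint_diff d)
  thus ?thesis unfolding B_def by simp
qed

text \<open>Even functions vanishing at the origin. After subtracting a multiple of \<open>kernel_profile\<close>, which leaves the
square in \<open>Lplus_square\<close> unchanged, \<open>Lplus_gap_pinned\<close> applies to the remainder. The multiple is then bounded
by the pairing with the soliton, because \<open>kernel_profile\<close> has positive overlap with it.\<close>
lemma Lplus_Dirichlet:
  "\<exists>C>0. \<forall>r r' :: real \<Rightarrow> real. H1_profile r r' \<longrightarrow> (\<forall>x. r (- x) = r x) \<longrightarrow> r 0 = 0 \<longrightarrow>
     (LINT x|lborel. (r x)\<^sup>2) \<le> C * ((LINT x|lborel. (r' x)\<^sup>2) + (LINT x|lborel. (r x)\<^sup>2) / 16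
        - 3 / 8 * (LINT x|lborel. (sech4 x)\<^sup>2 * (r x)\<^sup>2) + (LINT x|lborel. r x * sech4 x)\<^sup>2)
     \<and> 0 \<le> (LINT x|lborel. (r' x)\<^sup>2) + (LINT x|lborel. (r x)\<^sup>2) / 16
        - 3 / 8 * (LINT x|lborel. (sech4 x)\<^sup>2 * (r x)\<^sup>2)"
proof -
  let ?s = "LINT x|lborel. (sech4 x)\<^sup>2"
  let ?m = "LINT x|lborel. kernel_profile x * sech4 x"
  let ?k = "LINT x|lborel. (kernel_profile x)\<^sup>2"
  note kd = H1_profileD(2,3)[OF kernel_profile]
  have k0: "?k \<ge> 0" "?s \<ge> 0" by simp_all
  define C where "C = 128 + 64 * ?s * ?k + 1 + ?k"
  have C: "C > 0" unfolding C_def using k0 by (simp add: add_pos_nonneg)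
  show ?thesis
  proof (rule exI[of _ C], rule conjI[OF C], intro allI impI)
    fix r r' :: "real \<Rightarrow> real" assume r: "H1_profile r r'" and "\<forall>x. r (- x) = r x" and r0: "r 0 = 0"
    hence ev: "\<And>x. r (- x) = r x" by blast
    define Q where "Q = (LINT x|lborel. (r' x)\<^sup>2) + (LINT x|lborel. (r x)\<^sup>2) / 16
        - 3 / 8 * (LINT x|lborel. (sech4 x)\<^sup>2 * (r x)\<^sup>2)"
    define M where "M = (LINT x|lborel. r x * sech4 x)"
    have Q: "Q = (LINT x|lborel. (r' x - hardy_weight x * r x + tanh4 x * r x / 4)\<^sup>2)"
      unfolding Q_def by (rule Lplus_square[OF r r0, symmetric])
    hence Q0: "Q \<ge> 0" by simp
    have kx: "kernel_profile gap_radius \<noteq> 0"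
      using gap_radius(1) sech4_pos[of gap_radius] by (simp add: kernel_profile_def tanh4_def)
    \<comment> \<open>By evenness one coefficient makes the remainder vanish at both points.\<close>
    define c where "c = r gap_radius / kernel_profile gap_radius"
    define g where "g x = r x - c * kernel_profile x" for x
    define g' where "g' x = r' x - c * kernel_profile' x" for x
    have g: "H1_profile g g'"
      unfolding g_def[abs_def] g'_def[abs_def] by (intro H1_profile_diff r H1_profile_cmult kernel_profile)
    note d = H1_profileD(2,3)[OF r] H1_profileD(2,3)[OF g] kd dec_intros
    have "g 0 = 0" "g gap_radius = 0" "g (- gap_radius) = 0"
      using kx r0 by (auto simp: g_def ev c_def kernel_profile_def[of 0])
    note pin = Lplus_gap_pinned[OF g this]
    have "(\<lambda>x. g' x - hardy_weight x * g x + tanh4 x * g x / 4) = (\<lambda>x. r' x - hardy_weight x * r x + tanh4 x * r x / 4)"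
    proof
      fix x
      have "g' x - hardy_weight x * g x + tanh4 x * g x / 4 = (r' x - hardy_weight x * r x + tanh4 x * r x / 4)
         - c * (kernel_profile' x - hardy_weight x * kernel_profile x + tanh4 x * kernel_profile x / 4)"
        by (simp add: g_def g'_def field_simps)
      thus "g' x - hardy_weight x * g x + tanh4 x * g x / 4 = r' x - hardy_weight x * r x + tanh4 x * r x / 4"
        unfolding kernel_profile_annihilated by simp
    qed
    hence eq: "(LINT x|lborel. (g' x - hardy_weight x * g x + tanh4 x * g x / 4)\<^sup>2) = Q"
      unfolding Q by metis
    with pin have P: "(LINT x|lborel. (g x)\<^sup>2) \<le> 64 * Q" by simp
    have "(LINT x|lborel. r x * sech4 x) = (LINT x|lborel. g x * sech4 x + c * (kernel_profile x * sech4 x))"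
      by (intro Bochner_Integration.integral_cong) (auto simp: g_def algebra_simps)
    also have "\<dots> = (LINT x|lborel. g x * sech4 x) + c * ?m"
      by (simp add: lint_add d)
    finally have cm: "c * ?m = M - (LINT x|lborel. g x * sech4 x)" by (simp add: M_def)
    have cs: "(LINT x|lborel. g x * sech4 x)\<^sup>2 \<le> 64 * Q * ?s"
      using lint_Cauchy_Schwarz[of g sech4] mult_right_mono[OF P k0(2)] by (simp add: d)
    \<comment> \<open>The overlap integral is at least \<open>2\<close>.\<close>
    have "(2 * c)\<^sup>2 \<le> (c * ?m)\<^sup>2"
      using power_mono[OF kernel_overlap, of 2] by (simp add: power_mult_distrib mult.commute[of _ "c\<^sup>2"] mult_left_mono)
    also have "\<dots> \<le> 2 * M\<^sup>2 + 2 * (LINT x|lborel. g x * sech4 x)\<^sup>2"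
      unfolding cm using zero_le_power2[of "M + (LINT x|lborel. g x * sech4 x)"]
      by (simp add: power2_sum power2_diff)
    finally have c2: "c\<^sup>2 \<le> M\<^sup>2 / 2 + 32 * Q * ?s" using cs by (simp add: power_mult_distrib)
    have "(LINT x|lborel. (r x)\<^sup>2) \<le> (LINT x|lborel. 2 * (g x)\<^sup>2 + 2 * c\<^sup>2 * (kernel_profile x)\<^sup>2)"
    proof (rule lint_mono)
      fix x
      have "r x = g x + c * kernel_profile x" by (simp add: g_def)
      thus "(r x)\<^sup>2 \<le> 2 * (g x)\<^sup>2 + 2 * c\<^sup>2 * (kernel_profile x)\<^sup>2"
        using zero_le_power2[of "g x - c * kernel_profile x"]
        by (simp add: power2_sum power2_diff power_mult_distrib)
    qed (intro d)+
    also have "\<dots> = 2 * (LINT x|lborel. (g x)\<^sup>2) + 2 * c\<^sup>2 * ?k"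
      by (simp add: lint_add d)
    also have "\<dots> \<le> 2 * (64 * Q) + 2 * (M\<^sup>2 / 2 + 32 * Q * ?s) * ?k"
      using P c2 k0 by (intro add_mono mult_left_mono mult_right_mono) auto
    also have "\<dots> = (128 + 64 * ?s * ?k) * Q + ?k * M\<^sup>2" by (simp add: algebra_simps)
    also have "\<dots> \<le> C * Q + C * M\<^sup>2"
      using k0 Q0 by (intro add_mono mult_right_mono) (auto simp: C_def)
    finally have "(LINT x|lborel. (r x)\<^sup>2) \<le> C * (Q + M\<^sup>2)" by (simp add: algebra_simps)
    thus "(LINT x|lborel. (r x)\<^sup>2) \<le> C * ((LINT x|lborel. (r' x)\<^sup>2) + (LINT x|lborel. (r x)\<^sup>2) / 16
        - 3 / 8 * (LINT x|lborel. (sech4 x)\<^sup>2 * (r x)\<^sup>2) + (LINT x|lborel. r x * sech4 x)\<^sup>2)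
     \<and> 0 \<le> (LINT x|lborel. (r' x)\<^sup>2) + (LINT x|lborel. (r x)\<^sup>2) / 16
        - 3 / 8 * (LINT x|lborel. (sech4 x)\<^sup>2 * (r x)\<^sup>2)"
      using Q0 unfolding Q_def M_def by simp
  qed
qed

section \<open>Coercivity on even functions\<close>

text \<open>The derivative at \<open>\<mu> = 1\<close> of the family \<open>\<mu> sech(\<mu> x / 4)\<close> of solitons of varying mass.\<close>
definition scaling_profile :: "real \<Rightarrow> real" where
  "scaling_profile x = sech4 x - tanh4 x * (x * sech4 x) / 4"

definition scaling_profile' :: "real \<Rightarrow> real" where
  "scaling_profile' x = - (tanh4 x * sech4 x) / 2 + (x * sech4 x) / 16 - (sech4 x)\<^sup>2 * (x * sech4 x) / 8"

lemma scaling_profile_deriv: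
  "(scaling_profile has_real_derivative scaling_profile' x) (at x)"
proof -
  have 1: "(scaling_profile has_real_derivative (- (sech4 x * tanh4 x / 4)
      - ((sech4 x)\<^sup>2 / 4 * (x * sech4 x) + tanh4 x * (sech4 x - x * (sech4 x * tanh4 x / 4))) / 4)) (at x)"
    unfolding scaling_profile_def[abs_def] by (auto intro!: derivative_eq_intros simp: algebra_simps add_divide_distrib diff_divide_distrib power2_eq_square)
  have 2: "x * (sech4 x * (tanh4 x)\<^sup>2) = x * sech4 x - x * (sech4 x * (sech4 x)\<^sup>2)"
    by (simp add: tanh4_sq algebra_simps)
  have "- (sech4 x * tanh4 x / 4)
      - ((sech4 x)\<^sup>2 / 4 * (x * sech4 x) + tanh4 x * (sech4 x - x * (sech4 x * tanh4 x / 4))) / 4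
     = - (tanh4 x * sech4 x) / 2 - (sech4 x)\<^sup>2 * (x * sech4 x) / 16 + x * (sech4 x * (tanh4 x)\<^sup>2) / 16"
    by (simp add: algebra_simps add_divide_distrib diff_divide_distrib power2_eq_square)
  also have "\<dots> = scaling_profile' x" unfolding 2 scaling_profile'_def by (simp add: algebra_simps add_divide_distrib diff_divide_distrib power2_eq_square)
  finally show ?thesis using 1 by simp
qed

text \<open>In terms of the operator, \<open>L\<^sub>+ \<phi> = - sech(x/4) / 8\<close>: differentiate the profile equation of the family
with respect to the scale.\<close>
lemma scaling_profile'_deriv:
  "(scaling_profile' has_real_derivative
      scaling_profile x / 16 - 3 / 8 * (sech4 x)\<^sup>2 * scaling_profile x + sech4 x / 8) (at x)"
proof -
  let ?S = "sech4 x" and ?T = "tanh4 x"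
  have 1: "(scaling_profile' has_real_derivative
      - (?S\<^sup>2 / 4 * ?S - ?T * (?S * ?T / 4)) / 2 + (?S - x * (?S * ?T / 4)) / 16
       - (- (2 * ?S * (?S * ?T / 4)) * (x * ?S) + ?S\<^sup>2 * (?S - x * (?S * ?T / 4))) / 8) (at x)"
    unfolding scaling_profile'_def[abs_def]
    by (auto intro!: derivative_eq_intros simp: algebra_simps add_divide_distrib diff_divide_distrib power2_eq_square)
  have 2: "?S * ?T\<^sup>2 = ?S - ?S * ?S\<^sup>2" by (simp add: tanh4_sq algebra_simps)
  have "- (?S\<^sup>2 / 4 * ?S - ?T * (?S * ?T / 4)) / 2 + (?S - x * (?S * ?T / 4)) / 16
       - (- (2 * ?S * (?S * ?T / 4)) * (x * ?S) + ?S\<^sup>2 * (?S - x * (?S * ?T / 4))) / 8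
    = - (?S * ?S\<^sup>2) / 8 + (?S * ?T\<^sup>2) / 8 + ?S / 16 - x * ?S * ?T / 64 + 3 / 32 * (x * ?S * ?T * ?S\<^sup>2) - ?S * ?S\<^sup>2 / 8"
    by (simp add: power2_eq_square field_simps)
  also have "\<dots> = scaling_profile x / 16 - 3 / 8 * ?S\<^sup>2 * scaling_profile x + ?S / 8"
    unfolding 2 scaling_profile_def by (simp add: power2_eq_square field_simps)
  finally show ?thesis using 1 by simp
qed

lemma scaling_profile: "H1_profile scaling_profile scaling_profile'"
  unfolding H1_profile_def
proof (intro conjI exI[of _ "{}"] ballI)
  show "continuous_on UNIV scaling_profile"
    by (intro DERIV_continuous_on[where D=scaling_profile'] DERIV_subset[OF scaling_profile_deriv]) auto
  show "exp_decaying scaling_profile"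
    unfolding scaling_profile_def[abs_def] by (intro dec_intros)
  show "exp_decaying scaling_profile'"
    unfolding scaling_profile'_def[abs_def] by (intro dec_intros)
  show "(scaling_profile has_vector_derivative scaling_profile' x) (at x)" for x
    using scaling_profile_deriv[of x] by (simp add: has_real_derivative_iff_has_vector_derivative)
qed simp

lemma scaling_profile_pairing:
  assumes r: "H1_profile r r'"
  shows "(LINT x|lborel. scaling_profile' x * r' x) + (LINT x|lborel. scaling_profile x * r x) / 16
     - 3 / 8 * (LINT x|lborel. (sech4 x)\<^sup>2 * (scaling_profile x * r x)) = - (LINT x|lborel. r x * sech4 x) / 8"
proof -
  note d = H1_profileD(2,3)[OF r] H1_profileD(2,3)[OF scaling_profile] dec_intros
  obtain S where S: "finite S" "\<And>x. x \<notin> S \<Longrightarrow> (r has_real_derivative r' x) (at x)"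
    using H1_profile_diff_real[OF r] by blast
  have "(LINT x|lborel. scaling_profile' x * r' x + scaling_profile x * r x / 16
     - 3 / 8 * ((sech4 x)\<^sup>2 * (scaling_profile x * r x)) + r x * sech4 x / 8) = 0"
  proof (rule FTC_line[where S=S and F = "\<lambda>x. scaling_profile' x * r x"])
    have "continuous_on UNIV scaling_profile'"
      by (rule DERIV_continuous_on[OF DERIV_subset[OF scaling_profile'_deriv]]) auto
    thus "continuous_on UNIV (\<lambda>x. scaling_profile' x * r x)"
      using H1_profileD(1)[OF r] by (intro continuous_intros)
    fix x assume "x \<notin> S"
    thus "((\<lambda>x. scaling_profile' x * r x) has_real_derivative scaling_profile' x * r' x + scaling_profile x * r x / 16
     - 3 / 8 * ((sech4 x)\<^sup>2 * (scaling_profile x * r x)) + r x * sech4 x / 8) (at x)"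
      by (auto intro!: derivative_eq_intros scaling_profile'_deriv S simp: algebra_simps)
  qed (use S(1) in \<open>auto intro!: d\<close>)
  thus ?thesis by (simp add: lint_add lint_diff d)
qed

text \<open>Half the derivative of the mass \<open>\<integral>\<mu>\<^sup>2 sech\<^sup>2(\<mu> x / 4) = \<mu> \<integral>sech\<^sup>2(x/4)\<close> at \<open>\<mu> = 1\<close>.
Its positivity is the slope condition for stability.\<close>
lemma scaling_profile_overlap:
  "(LINT x|lborel. scaling_profile x * sech4 x) = (LINT x|lborel. (sech4 x)\<^sup>2) / 2"
proof -
  note d = dec_intros
  have e: "exp_decaying (\<lambda>x. tanh4 x * ((x * sech4 x) * sech4 x))" by (intro d)
  have "(LINT x|lborel. (sech4 x)\<^sup>2 / 2 - tanh4 x * ((x * sech4 x) * sech4 x) / 4) = 0"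
  proof (rule FTC_line[where S="{}" and F = "\<lambda>x. (x * sech4 x) * sech4 x / 2"])
    show "((\<lambda>x. (x * sech4 x) * sech4 x / 2) has_real_derivative
        (sech4 x)\<^sup>2 / 2 - tanh4 x * ((x * sech4 x) * sech4 x) / 4) (at x)" for x
      by (auto intro!: derivative_eq_intros simp: algebra_simps add_divide_distrib diff_divide_distrib power2_eq_square)
  qed (auto intro!: d continuous_intros)
  hence 1: "(LINT x|lborel. tanh4 x * ((x * sech4 x) * sech4 x)) / 4 = (LINT x|lborel. (sech4 x)\<^sup>2) / 2"
    by (simp add: lint_diff d e)
  have "(LINT x|lborel. scaling_profile x * sech4 x) =
      (LINT x|lborel. (sech4 x)\<^sup>2 - tanh4 x * ((x * sech4 x) * sech4 x) / 4)"
    by (intro Bochner_Integration.integral_cong) (auto simp: scaling_profile_def power2_eq_square algebra_simps)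
  also have "\<dots> = (LINT x|lborel. (sech4 x)\<^sup>2) - (LINT x|lborel. tanh4 x * ((x * sech4 x) * sech4 x)) / 4"
    by (simp add: lint_diff d e)
  finally show ?thesis using 1 by simp
qed

lemma square_add_le: "(p + q)\<^sup>2 \<le> 2 * p\<^sup>2 + 2 * q\<^sup>2" for p q :: real
proof -
  have "0 \<le> (p - q)\<^sup>2" by simp
  thus ?thesis unfolding power2_sum power2_diff by linarith
qed

lemma lint_quadratic:
  fixes f g h :: "real \<Rightarrow> real"
  assumes "exp_decaying f" "exp_decaying g" "exp_decaying h"
  shows "(LINT x|lborel. f x + c * g x + e * h x) =
    (LINT x|lborel. f x) + c * (LINT x|lborel. g x) + e * (LINT x|lborel. h x)"
  using assms by (simp add: lint_add dec_intros)

text \<open>Write \<open>a = a(0) \<phi> + r\<close> with \<open>\<phi>\<close> the scaling profile, so that \<open>r(0) = 0\<close>. Since \<open>L\<^sub>+ \<phi>\<close> is a multiple of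
the soliton, the form at \<open>a\<close> equals the form at \<open>r\<close> plus \<open>a(0)\<^sup>2 s / 16 - a(0) M / 4\<close>, where \<open>s = \<integral>sech\<^sup>2(x/4)\<close>
and \<open>M\<close> is the pairing of \<open>a\<close> with \<open>sech(x/4)\<close>. So the form and \<open>M\<^sup>2\<close> together control \<open>a(0)\<close>, and \<open>r\<close> by
\<open>Lplus_Dirichlet\<close>.\<close>
lemma Lplus_coercive:
  "\<exists>C>0. \<forall>a a' :: real \<Rightarrow> real. H1_profile a a' \<longrightarrow> (\<forall>x. a (- x) = a x) \<longrightarrow>
     (LINT x|lborel. (a x)\<^sup>2) + (LINT x|lborel. (a' x)\<^sup>2) \<le>
       C * ((LINT x|lborel. (a' x)\<^sup>2) + (LINT x|lborel. (a x)\<^sup>2) / 16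
        - 3 / 8 * (LINT x|lborel. (sech4 x)\<^sup>2 * (a x)\<^sup>2) + (LINT x|lborel. a x * sech4 x)\<^sup>2)"
proof -
  obtain D where D0: "D > 0" and D1: "\<forall>r r' :: real \<Rightarrow> real. H1_profile r r' \<longrightarrow> (\<forall>x. r (- x) = r x) \<longrightarrow> r 0 = 0 \<longrightarrow>
     (LINT x|lborel. (r x)\<^sup>2) \<le> D * ((LINT x|lborel. (r' x)\<^sup>2) + (LINT x|lborel. (r x)\<^sup>2) / 16
        - 3 / 8 * (LINT x|lborel. (sech4 x)\<^sup>2 * (r x)\<^sup>2) + (LINT x|lborel. r x * sech4 x)\<^sup>2)
     \<and> 0 \<le> (LINT x|lborel. (r' x)\<^sup>2) + (LINT x|lborel. (r x)\<^sup>2) / 16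
        - 3 / 8 * (LINT x|lborel. (sech4 x)\<^sup>2 * (r x)\<^sup>2)"
    using Lplus_Dirichlet by (elim exE conjE)
  note D = D0 D1[rule_format]
  define s where "s = (LINT x|lborel. (sech4 x)\<^sup>2)"
  define p where "p = (LINT x|lborel. (scaling_profile x)\<^sup>2)"
  have s2: "s \<ge> 2" using sech4_mass by (simp add: s_def)
  have p0: "p \<ge> 0" by (simp add: p_def)
  \<comment> \<open>The summands are the coefficients of the form at \<open>r\<close>, of \<open>a(0)\<^sup>2\<close> and of \<open>M\<^sup>2\<close> in the closing estimate of \<open>main\<close>; the last \<open>1\<close> makes the sum positive.\<close>
  define E where "E = 2 * D + (2 * p + D * s\<^sup>2) * 16 + 8 * D + 1"
  have E: "E > 0" unfolding E_def using D(1) p0 by (intro add_nonneg_pos add_nonneg_nonneg mult_nonneg_nonneg) auto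
  have main: "(LINT x|lborel. (a x)\<^sup>2) \<le>
       E * ((LINT x|lborel. (a' x)\<^sup>2) + (LINT x|lborel. (a x)\<^sup>2) / 16
        - 3 / 8 * (LINT x|lborel. (sech4 x)\<^sup>2 * (a x)\<^sup>2) + (LINT x|lborel. a x * sech4 x)\<^sup>2)"
    if a: "H1_profile a a'" and ev: "\<And>x. a (- x) = a x" for a a' :: "real \<Rightarrow> real"
  proof -
    let ?\<phi> = scaling_profile and ?\<phi>' = scaling_profile'
    define a0 where "a0 = a 0"
    define r where "r x = a x - a0 * ?\<phi> x" for x
    define r' where "r' x = a' x - a0 * ?\<phi>' x" for x
    have r: "H1_profile r r'"
      unfolding r_def[abs_def] r'_def[abs_def] by (intro H1_profile_diff a H1_profile_cmult scaling_profile)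
    have rev: "r (- x) = r x" for x by (simp add: r_def ev scaling_profile_def)
    have r0: "r 0 = 0" by (simp add: r_def a0_def scaling_profile_def)
    note d = H1_profileD(2,3)[OF r] H1_profileD(2,3)[OF a] H1_profileD(2,3)[OF scaling_profile] dec_intros
    have ar: "a x = r x + a0 * ?\<phi> x" "a' x = r' x + a0 * ?\<phi>' x" for x by (auto simp: r_def r'_def)
    define Qr where "Qr = (LINT x|lborel. (r' x)\<^sup>2) + (LINT x|lborel. (r x)\<^sup>2) / 16
        - 3 / 8 * (LINT x|lborel. (sech4 x)\<^sup>2 * (r x)\<^sup>2)"
    define Qa where "Qa = (LINT x|lborel. (a' x)\<^sup>2) + (LINT x|lborel. (a x)\<^sup>2) / 16
        - 3 / 8 * (LINT x|lborel. (sech4 x)\<^sup>2 * (a x)\<^sup>2)"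
    define M where "M = (LINT x|lborel. a x * sech4 x)"
    define N where "N = (LINT x|lborel. r x * sech4 x)"
    have "M = (LINT x|lborel. r x * sech4 x + a0 * (?\<phi> x * sech4 x))"
      unfolding M_def by (intro Bochner_Integration.integral_cong) (auto simp: ar algebra_simps)
    hence MN: "M = N + a0 * s / 2"
      using scaling_profile_overlap by (simp add: lint_add d N_def s_def)
    note pr = scaling_profile_pairing[OF r] and pp = scaling_profile_pairing[OF scaling_profile]
    have e1: "(a' x)\<^sup>2 = (r' x)\<^sup>2 + 2 * a0 * (?\<phi>' x * r' x) + a0\<^sup>2 * (?\<phi>' x * ?\<phi>' x)" for x
      by (simp add: ar power2_eq_square algebra_simps)
    have e2: "(a x)\<^sup>2 = (r x)\<^sup>2 + 2 * a0 * (?\<phi> x * r x) + a0\<^sup>2 * (?\<phi> x * ?\<phi> x)" for x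
      by (simp add: ar power2_eq_square algebra_simps)
    have e3: "(sech4 x)\<^sup>2 * ((r x)\<^sup>2 + 2 * a0 * (?\<phi> x * r x) + a0\<^sup>2 * (?\<phi> x * ?\<phi> x)) =
       (sech4 x)\<^sup>2 * (r x)\<^sup>2 + 2 * a0 * ((sech4 x)\<^sup>2 * (?\<phi> x * r x))
            + a0\<^sup>2 * ((sech4 x)\<^sup>2 * (?\<phi> x * ?\<phi> x))" for x
      by (simp add: algebra_simps)
    have q1: "(LINT x|lborel. (r' x)\<^sup>2 + 2 * a0 * (?\<phi>' x * r' x) + a0\<^sup>2 * (?\<phi>' x * ?\<phi>' x)) =
       (LINT x|lborel. (r' x)\<^sup>2) + 2 * a0 * (LINT x|lborel. ?\<phi>' x * r' x) + a0\<^sup>2 * (LINT x|lborel. ?\<phi>' x * ?\<phi>' x)"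
      by (rule lint_quadratic) (intro d)+
    have q2: "(LINT x|lborel. (r x)\<^sup>2 + 2 * a0 * (?\<phi> x * r x) + a0\<^sup>2 * (?\<phi> x * ?\<phi> x)) =
       (LINT x|lborel. (r x)\<^sup>2) + 2 * a0 * (LINT x|lborel. ?\<phi> x * r x) + a0\<^sup>2 * (LINT x|lborel. ?\<phi> x * ?\<phi> x)"
      by (rule lint_quadratic) (intro d)+
    have q3: "(LINT x|lborel. (sech4 x)\<^sup>2 * (r x)\<^sup>2 + 2 * a0 * ((sech4 x)\<^sup>2 * (?\<phi> x * r x))
            + a0\<^sup>2 * ((sech4 x)\<^sup>2 * (?\<phi> x * ?\<phi> x))) =
       (LINT x|lborel. (sech4 x)\<^sup>2 * (r x)\<^sup>2) + 2 * a0 * (LINT x|lborel. (sech4 x)\<^sup>2 * (?\<phi> x * r x))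
         + a0\<^sup>2 * (LINT x|lborel. (sech4 x)\<^sup>2 * (?\<phi> x * ?\<phi> x))"
      by (rule lint_quadratic; intro exp_decaying_mult exp_decaying_power2 exp_decaying_sech4 d(1,5))
    \<comment> \<open>Expand the form at \<open>r + a(0) \<phi>\<close> and evaluate both pairings with \<open>\<phi>\<close>.\<close>
    have "Qa = (LINT x|lborel. (r' x)\<^sup>2 + 2 * a0 * (?\<phi>' x * r' x) + a0\<^sup>2 * (?\<phi>' x * ?\<phi>' x))
        + (LINT x|lborel. (r x)\<^sup>2 + 2 * a0 * (?\<phi> x * r x) + a0\<^sup>2 * (?\<phi> x * ?\<phi> x)) / 16
        - 3 / 8 * (LINT x|lborel. (sech4 x)\<^sup>2 * (r x)\<^sup>2 + 2 * a0 * ((sech4 x)\<^sup>2 * (?\<phi> x * r x))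
            + a0\<^sup>2 * ((sech4 x)\<^sup>2 * (?\<phi> x * ?\<phi> x)))"
      by (simp only: Qa_def e1 e2 e3)
    also have "\<dots> = Qr + 2 * a0 * ((LINT x|lborel. ?\<phi>' x * r' x) + (LINT x|lborel. ?\<phi> x * r x) / 16
            - 3 / 8 * (LINT x|lborel. (sech4 x)\<^sup>2 * (?\<phi> x * r x)))
         + a0\<^sup>2 * ((LINT x|lborel. ?\<phi>' x * ?\<phi>' x) + (LINT x|lborel. ?\<phi> x * ?\<phi> x) / 16
            - 3 / 8 * (LINT x|lborel. (sech4 x)\<^sup>2 * (?\<phi> x * ?\<phi> x)))"
      unfolding Qr_def q1 q2 q3 by argo
    also have "\<dots> = Qr - a0 * N / 4 - a0\<^sup>2 * s / 16"
      unfolding pr pp scaling_profile_overlap by (simp add: N_def s_def)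
    also have "\<dots> = Qr + a0\<^sup>2 * s / 16 - a0 * M / 4"
      unfolding MN by (simp add: power2_eq_square algebra_simps add_divide_distrib)
    finally have QaQr: "Qa = Qr + a0\<^sup>2 * s / 16 - a0 * M / 4" .
    from D(2)[OF r rev r0] have Dr: "(LINT x|lborel. (r x)\<^sup>2) \<le> D * (Qr + N\<^sup>2)" "0 \<le> Qr"
      unfolding Qr_def N_def by auto
    have s8: "a0\<^sup>2 * 2 \<le> a0\<^sup>2 * s" using s2 by (intro mult_left_mono) auto
    have "0 \<le> (a0 / 4 - M / 2)\<^sup>2" by simp
    hence am: "a0 * M / 4 \<le> a0\<^sup>2 / 16 + M\<^sup>2 / 4" by (simp add: power2_eq_square field_simps)
    have a02: "a0\<^sup>2 \<le> 16 * (Qa + M\<^sup>2)"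
    proof -
      have "a0\<^sup>2 / 8 \<le> a0\<^sup>2 * s / 16" using s8 by simp
      with QaQr Dr(2) am have "a0\<^sup>2 / 8 \<le> Qa + (a0\<^sup>2 / 16 + M\<^sup>2 / 4)" by linarith
      moreover have "u \<le> 16 * (Q + m)" if "u / 8 \<le> Q + (u / 16 + m / 4)" "0 \<le> m" for u m Q :: real
        using that by argo
      ultimately show ?thesis using zero_le_power2 by blast
    qed
    have Qr2: "Qr \<le> Qa + M\<^sup>2"
      using QaQr s8 am zero_le_power2[of M] zero_le_power2[of a0] by linarith
    have "N\<^sup>2 \<le> 2 * M\<^sup>2 + a0\<^sup>2 * s\<^sup>2 / 2"
    proof -
      have "N = M - a0 * s / 2" using MN by simp
      hence "N\<^sup>2 = M\<^sup>2 - M * (a0 * s) + (a0 * s)\<^sup>2 / 4" by (simp add: power2_diff power_divide)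
      moreover have "0 \<le> (M + a0 * s / 2)\<^sup>2" by simp
      ultimately show ?thesis by (simp add: power2_sum power_divide power_mult_distrib)
    qed
    hence N2: "D * N\<^sup>2 \<le> D * (2 * M\<^sup>2 + a0\<^sup>2 * s\<^sup>2 / 2)" using D(1) by (intro mult_left_mono) auto
    have M2: "M\<^sup>2 \<le> 2 * (Qa + M\<^sup>2)"
    proof -
      have "a0\<^sup>2 / 8 \<le> a0\<^sup>2 * s / 16" using s8 by simp
      with QaQr Dr(2) am have "a0\<^sup>2 / 8 \<le> Qa + (a0\<^sup>2 / 16 + M\<^sup>2 / 4)" by linarith
      moreover have "m \<le> 2 * (Q + m)" if "u / 8 \<le> Q + (u / 16 + m / 4)" "0 \<le> m" "0 \<le> u" for u m Q :: real
        using that by argo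
      ultimately show ?thesis using zero_le_power2 by blast
    qed
    have "(LINT x|lborel. (a x)\<^sup>2) \<le> (LINT x|lborel. 2 * (r x)\<^sup>2 + 2 * a0\<^sup>2 * (?\<phi> x)\<^sup>2)"
    proof (rule lint_mono)
      show "(a x)\<^sup>2 \<le> 2 * (r x)\<^sup>2 + 2 * a0\<^sup>2 * (?\<phi> x)\<^sup>2" for x
        unfolding ar using square_add_le[of "r x" "a0 * ?\<phi> x"] by (simp add: power_mult_distrib)
    qed (intro d)+
    also have "\<dots> = 2 * (LINT x|lborel. (r x)\<^sup>2) + 2 * a0\<^sup>2 * p"
      by (simp add: lint_add d p_def)
    also have "\<dots> \<le> 2 * (D * Qr + D * (2 * M\<^sup>2 + a0\<^sup>2 * s\<^sup>2 / 2)) + 2 * a0\<^sup>2 * p"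
      using Dr(1) N2 by (simp add: algebra_simps)
    also have "\<dots> = 2 * D * Qr + a0\<^sup>2 * (2 * p + D * s\<^sup>2) + 4 * D * M\<^sup>2" by (simp add: algebra_simps)
    also have "\<dots> \<le> 2 * D * (Qa + M\<^sup>2) + (16 * (Qa + M\<^sup>2)) * (2 * p + D * s\<^sup>2) + 4 * D * (2 * (Qa + M\<^sup>2))"
      using Qr2 a02 M2 D(1) p0 by (intro add_mono mult_left_mono mult_right_mono) auto
    also have "\<dots> = E * (Qa + M\<^sup>2) - (Qa + M\<^sup>2)" by (simp add: E_def algebra_simps)
    also have "\<dots> \<le> E * (Qa + M\<^sup>2)"
    proof -
      have "0 \<le> Qa + M\<^sup>2" using order_trans[OF zero_le_power2[of M] M2] by simp
      thus ?thesis by simp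
    qed
    finally show ?thesis unfolding Qa_def M_def .
  qed
  show ?thesis
  proof (intro exI[of _ "2 * E + 1"] conjI allI impI)
    show "2 * E + 1 > 0" using E by simp
    fix a a' :: "real \<Rightarrow> real" assume a: "H1_profile a a'" and "\<forall>x. a (- x) = a x"
    hence ev: "\<And>x. a (- x) = a x" by blast
    note d = H1_profileD(2,3)[OF a] dec_intros
    let ?A = "LINT x|lborel. (a x)\<^sup>2" and ?B = "LINT x|lborel. (a' x)\<^sup>2"
    let ?X = "?B + ?A / 16 - 3 / 8 * (LINT x|lborel. (sech4 x)\<^sup>2 * (a x)\<^sup>2) + (LINT x|lborel. a x * sech4 x)\<^sup>2"
    have 1: "?A \<le> E * ?X" by (rule main[OF a ev])
    have 2: "(LINT x|lborel. (sech4 x)\<^sup>2 * (a x)\<^sup>2) \<le> ?A"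
    proof (rule lint_mono)
      show "(sech4 x)\<^sup>2 * (a x)\<^sup>2 \<le> (a x)\<^sup>2" for x
        using sech4_le1[of x] sech4_pos[of x] mult_right_mono[OF power_le_one[of "sech4 x" 2], of "(a x)\<^sup>2"] by simp
    qed (intro d)+
    have 3: "0 \<le> ?A" by simp
    define X where "X = ?X"
    have "?B \<le> X + ?A" using 2 3 zero_le_power2[of "LINT x|lborel. a x * sech4 x"] unfolding X_def by linarith
    with 1 have "?A + ?B \<le> 2 * (E * X) + X" unfolding X_def by linarith
    hence "?A + ?B \<le> (2 * E + 1) * X" by (simp add: algebra_simps)
    thus "?A + ?B \<le> (2 * E + 1) * ?X" unfolding X_def .
  qed
qed

lemma exp_decaying_norm [dec_intros]:
  fixes f :: "real \<Rightarrow> 'a::euclidean_space"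
  assumes "exp_decaying f" shows "exp_decaying (\<lambda>x. norm (f x))"
  by (rule exp_decaying_scaled[OF assms, where B=1]) (use assms in \<open>auto simp: exp_decaying_def\<close>)

section \<open>The action near the soliton\<close>

definition eta' :: "real \<Rightarrow> real" where
  "eta' x = - (tanh4 x * eta x) / 4"

lemma eta_sech4: "eta x = 1 / (2 * sqrt 2) * sech4 x"
  by (simp add: eta_def sech4_def)

lemma eta_sq: "(eta x)\<^sup>2 = (sech4 x)\<^sup>2 / 8"
  by (simp add: eta_sech4 power_mult_distrib power_divide)

lemma eta_pos: "eta x > 0" by (simp add: eta_sech4 sech4_pos)

lemma eta_le_half: "2 * eta x \<le> 1"
proof -
  have "(2 * eta x)\<^sup>2 \<le> 1\<^sup>2"
    using power_le_one[of "sech4 x" 2] sech4_pos[of x] sech4_le1[of x]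
    by (simp add: power_mult_distrib eta_sq)
  thus ?thesis by (rule power2_le_imp_le) simp
qed

lemma eta_profile: "H1_profile eta eta'"
proof -
  have "H1_profile (\<lambda>x. 1 / (2 * sqrt 2) * sech4 x) (\<lambda>x. 1 / (2 * sqrt 2) * (- (tanh4 x * sech4 x) / 4))"
    by (rule H1_profile_cmult[OF sech4_profile])
  thus ?thesis by (simp add: eta_sech4[abs_def] eta'_def[abs_def])
qed

lemma eta_deriv: "(eta has_real_derivative eta' x) (at x)"
proof -
  have "((\<lambda>x. 1 / (2 * sqrt 2) * sech4 x) has_real_derivative
      1 / (2 * sqrt 2) * (- (sech4 x * tanh4 x / 4) * 1)) (at x)"
    by (intro DERIV_cmult sech4_deriv DERIV_ident)
  thus ?thesis unfolding eta_sech4[abs_def] eta'_def by (simp add: eta_sech4 mult_ac)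
qed

lemma eta'_deriv: "(eta' has_real_derivative eta x / 16 - eta x * (eta x)\<^sup>2) (at x)"
proof -
  have "(eta' has_real_derivative - ((sech4 x)\<^sup>2 / 4 * eta x + tanh4 x * eta' x) / 4) (at x)"
  proof -
    have "((\<lambda>x. - (tanh4 x * eta x) / 4) has_real_derivative - ((sech4 x)\<^sup>2 / 4 * eta x + tanh4 x * eta' x) / 4) (at x)"
      by (auto intro!: derivative_eq_intros eta_deriv simp: algebra_simps)
    thus ?thesis by (simp only: eta'_def[abs_def])
  qed
  moreover have t: "tanh4 x * eta' x = - (1 - (sech4 x)\<^sup>2) * eta x / 4"
    unfolding eta'_def tanh4_sq[symmetric] by (simp add: power2_eq_square)
  hence "- ((sech4 x)\<^sup>2 / 4 * eta x + tanh4 x * eta' x) / 4 = eta x / 16 - eta x * (eta x)\<^sup>2"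
    unfolding eta_sq by (simp only:) (simp add: field_simps)
  ultimately show ?thesis by (simp only:)
qed

text \<open>The first variation of the action at the soliton vanishes, by integrating the derivative of \<open>\<eta>' a\<close>.\<close>
lemma eta_Euler_Lagrange:
  assumes a: "H1_profile a a'"
  shows "2 * (LINT x|lborel. eta' x * a' x) + (LINT x|lborel. eta x * a x) / 8
      - 2 * (LINT x|lborel. eta x * (eta x)\<^sup>2 * a x) = 0"
proof -
  note d = H1_profileD(2,3)[OF a] H1_profileD(2,3)[OF eta_profile]
  note i = exp_decaying_add exp_decaying_diff exp_decaying_mult exp_decaying_power2 exp_decaying_divide exp_decaying_cmult d
  obtain S where S: "finite S" "\<And>x. x \<notin> S \<Longrightarrow> (a has_real_derivative a' x) (at x)"
    using H1_profile_diff_real[OF a] by blast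
  have "(LINT x|lborel. eta' x * a' x + eta x * a x / 16 - eta x * (eta x)\<^sup>2 * a x) = 0"
  proof (rule FTC_line[where S=S and F = "\<lambda>x. eta' x * a x"])
    have "continuous_on UNIV eta'"
      by (rule DERIV_continuous_on[OF DERIV_subset[OF eta'_deriv]]) auto
    thus "continuous_on UNIV (\<lambda>x. eta' x * a x)"
      using H1_profileD(1)[OF a] by (intro continuous_intros)
    fix x assume "x \<notin> S"
    thus "((\<lambda>x. eta' x * a x) has_real_derivative eta' x * a' x + eta x * a x / 16 - eta x * (eta x)\<^sup>2 * a x) (at x)"
      by (auto intro!: derivative_eq_intros eta'_deriv S simp: algebra_simps)
  qed (use S(1) in \<open>auto intro!: i\<close>)
  thus ?thesis by (simp add: lint_add lint_diff i)
qed

definition H1_sq :: "(real \<Rightarrow> complex) \<Rightarrow> (real \<Rightarrow> complex) \<Rightarrow> real" where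
  "H1_sq f f' = (LINT x|lborel. (cmod (f x))\<^sup>2 + (cmod (f' x))\<^sup>2)"

definition mass :: "(real \<Rightarrow> complex) \<Rightarrow> real" where
  "mass f = (LINT x|lborel. (cmod (f x))\<^sup>2)"

text \<open>The action \<open>H + N/16\<close>; the multiplier is the one for which the soliton is critical.\<close>
definition energy :: "(real \<Rightarrow> complex) \<Rightarrow> (real \<Rightarrow> complex) \<Rightarrow> real" where
  "energy f f' = (LINT x|lborel. (cmod (f' x))\<^sup>2 + (cmod (f x))\<^sup>2 / 16 - ((cmod (f x))\<^sup>2)\<^sup>2 / 2)"

lemma complex_profile_parts:
  assumes "H1_profile v v'"
  shows "H1_profile (\<lambda>x. Re (v x)) (\<lambda>x. Re (v' x))" "H1_profile (\<lambda>x. Im (v x)) (\<lambda>x. Im (v' x))"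
  by (rule H1_profile_linear[OF bounded_linear_Re assms] H1_profile_linear[OF bounded_linear_Im assms])+

lemma H1_sq_parts:
  assumes v: "H1_profile v v'"
  shows "H1_sq v v' = (LINT x|lborel. (Re (v x))\<^sup>2) + (LINT x|lborel. (Re (v' x))\<^sup>2)
     + ((LINT x|lborel. (Im (v x))\<^sup>2) + (LINT x|lborel. (Im (v' x))\<^sup>2))"
proof -
  note d = H1_profileD(2,3)[OF complex_profile_parts(1)[OF v]] H1_profileD(2,3)[OF complex_profile_parts(2)[OF v]]
  show ?thesis unfolding H1_sq_def cmod_power2
    by (simp add: lint_add exp_decaying_add exp_decaying_power2 d)
qed

lemma H1_sq_sup_bound:
  assumes v: "H1_profile v v'"
  shows "(cmod (v x))\<^sup>2 \<le> H1_sq v v'"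
proof -
  note d = H1_profileD(2,3)[OF complex_profile_parts(1)[OF v]] H1_profileD(2,3)[OF complex_profile_parts(2)[OF v]]
  show ?thesis
    using H1_profile_sup_bound[OF complex_profile_parts(1)[OF v], of x]
      H1_profile_sup_bound[OF complex_profile_parts(2)[OF v], of x]
    unfolding H1_sq_parts[OF v] cmod_power2
    by (simp add: lint_add exp_decaying_power2 d)
qed

text \<open>Exact expansions around the soliton: the linear term of the action vanishes by \<open>eta_Euler_Lagrange\<close>, the
quadratic terms are the two forms studied above (as \<open>sech\<^sup>2(x/4) = 8 \<eta>\<^sup>2\<close>), and what remains is cubic.\<close>
lemma second_variation:
  fixes v v' :: "real \<Rightarrow> complex"
  assumes v: "H1_profile v v'"
  defines "a \<equiv> \<lambda>x. Re (v x)" and "a' \<equiv> \<lambda>x. Re (v' x)" and "b \<equiv> \<lambda>x. Im (v x)" and "b' \<equiv> \<lambda>x. Im (v' x)"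
  shows "energy (\<lambda>x. eta x + v x) (\<lambda>x. eta' x + v' x) - energy eta eta' =
     ((LINT x|lborel. (a' x)\<^sup>2) + (LINT x|lborel. (a x)\<^sup>2) / 16 - 3 / 8 * (LINT x|lborel. (sech4 x)\<^sup>2 * (a x)\<^sup>2))
   + ((LINT x|lborel. (b' x)\<^sup>2) + (LINT x|lborel. (b x)\<^sup>2) / 16 - (LINT x|lborel. (sech4 x)\<^sup>2 * (b x)\<^sup>2) / 8)
   - (LINT x|lborel. 2 * eta x * a x * (cmod (v x))\<^sup>2 + (cmod (v x))\<^sup>2 * (cmod (v x))\<^sup>2 / 2)" (is ?E)
  and "mass (\<lambda>x. eta x + v x) - mass eta = (LINT x|lborel. a x * sech4 x) / sqrt 2 + (LINT x|lborel. (cmod (v x))\<^sup>2)" (is ?N)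
proof -
  have pa: "H1_profile a a'" and pb: "H1_profile b b'"
    unfolding a_def a'_def b_def b'_def by (rule complex_profile_parts[OF v])+
  have dv: "exp_decaying (\<lambda>x. cmod (v x))" by (rule exp_decaying_norm[OF H1_profileD(2)[OF v]])
  note i = exp_decaying_add exp_decaying_diff exp_decaying_mult exp_decaying_power2 exp_decaying_divide exp_decaying_cmult
    H1_profileD(2,3)[OF pa] H1_profileD(2,3)[OF pb] H1_profileD(2,3)[OF eta_profile] dv exp_decaying_sech4
  have n1: "(cmod (complex_of_real (eta' x) + v' x))\<^sup>2 = (eta' x)\<^sup>2 + 2 * (eta' x * a' x) + (a' x)\<^sup>2 + (b' x)\<^sup>2"
    and n2: "(cmod (complex_of_real (eta x) + v x))\<^sup>2 = (eta x)\<^sup>2 + 2 * (eta x * a x) + (cmod (v x))\<^sup>2"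
    and n3: "(cmod (v x))\<^sup>2 = (a x)\<^sup>2 + (b x)\<^sup>2" for x
    by (simp_all add: cmod_power2 a'_def b'_def a_def b_def power2_sum)
  let ?E1 = "\<lambda>x. (eta' x)\<^sup>2 + (eta x)\<^sup>2 / 16 - (eta x)\<^sup>2 * (eta x)\<^sup>2 / 2"
  let ?E2 = "\<lambda>x. 2 * (eta' x * a' x) + (eta x * a x) / 8 - 2 * (eta x * (eta x)\<^sup>2 * a x)"
  let ?E3 = "\<lambda>x. (a' x)\<^sup>2 + (a x)\<^sup>2 / 16 - 3 / 8 * ((sech4 x)\<^sup>2 * (a x)\<^sup>2)"
  let ?E4 = "\<lambda>x. (b' x)\<^sup>2 + (b x)\<^sup>2 / 16 - (sech4 x)\<^sup>2 * (b x)\<^sup>2 / 8"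
  let ?E5 = "\<lambda>x. 2 * eta x * a x * (cmod (v x))\<^sup>2 + (cmod (v x))\<^sup>2 * (cmod (v x))\<^sup>2 / 2"
  have s: "(sech4 x)\<^sup>2 = 8 * (eta x)\<^sup>2" for x by (simp add: eta_sq)
  have pw: "(cmod (complex_of_real (eta' x) + v' x))\<^sup>2 + (cmod (complex_of_real (eta x) + v x))\<^sup>2 / 16
      - ((cmod (complex_of_real (eta x) + v x))\<^sup>2)\<^sup>2 / 2 = ?E1 x + ?E2 x + ?E3 x + ?E4 x - ?E5 x" for x
  proof -
    have "((eta x)\<^sup>2 + 2 * (eta x * a x) + (cmod (v x))\<^sup>2)\<^sup>2 =
       (eta x)\<^sup>2 * (eta x)\<^sup>2 + 4 * (eta x * (eta x)\<^sup>2 * a x) + 4 * ((eta x)\<^sup>2 * (a x)\<^sup>2) + 2 * (eta x)\<^sup>2 * (cmod (v x))\<^sup>2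
       + 4 * eta x * a x * (cmod (v x))\<^sup>2 + (cmod (v x))\<^sup>2 * (cmod (v x))\<^sup>2"
      by (simp add: power2_eq_square algebra_simps)
    moreover have "(eta x)\<^sup>2 * (cmod (v x))\<^sup>2 = (eta x)\<^sup>2 * (a x)\<^sup>2 + (eta x)\<^sup>2 * (b x)\<^sup>2"
      unfolding n3 by (simp add: algebra_simps)
    ultimately show ?thesis unfolding n1 n2 s using n3[of x] by argo
  qed
  have "energy (\<lambda>x. eta x + v x) (\<lambda>x. eta' x + v' x) = (LINT x|lborel. ?E1 x + ?E2 x + ?E3 x + ?E4 x - ?E5 x)"
    unfolding energy_def pw ..
  also have "\<dots> = (LINT x|lborel. ?E1 x) + (LINT x|lborel. ?E2 x) + (LINT x|lborel. ?E3 x) + (LINT x|lborel. ?E4 x)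
     - (LINT x|lborel. ?E5 x)"
    by (subst lint_diff lint_add; (intro i)?)+ (rule refl)
  also have "(LINT x|lborel. ?E1 x) = energy eta eta'"
    unfolding energy_def by (simp add: power2_eq_square)
  also have "(LINT x|lborel. ?E2 x) = 0"
    using eta_Euler_Lagrange[OF pa] by (simp add: lint_add lint_diff i)
  also have "(LINT x|lborel. ?E3 x) = (LINT x|lborel. (a' x)\<^sup>2) + (LINT x|lborel. (a x)\<^sup>2) / 16
      - 3 / 8 * (LINT x|lborel. (sech4 x)\<^sup>2 * (a x)\<^sup>2)"
    by (simp add: lint_add lint_diff i)
  also have "(LINT x|lborel. ?E4 x) = (LINT x|lborel. (b' x)\<^sup>2) + (LINT x|lborel. (b x)\<^sup>2) / 16
      - (LINT x|lborel. (sech4 x)\<^sup>2 * (b x)\<^sup>2) / 8"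
    by (simp add: lint_add lint_diff i)
  finally show ?E by simp
  have e: "2 * (eta x * a x) = (a x * sech4 x) / sqrt 2" for x by (simp add: eta_sech4)
  have "mass (\<lambda>x. eta x + v x) = (LINT x|lborel. (eta x)\<^sup>2 + (a x * sech4 x) / sqrt 2 + (cmod (v x))\<^sup>2)"
    unfolding mass_def n2 e ..
  also have "\<dots> = (LINT x|lborel. (eta x)\<^sup>2) + (LINT x|lborel. a x * sech4 x) / sqrt 2 + (LINT x|lborel. (cmod (v x))\<^sup>2)"
    by (simp add: lint_add i)
  finally show ?N by (simp add: mass_def)
qed

text \<open>Pointwise from \<open>2 \<eta> \<le> 1\<close> and the sup bound \<open>|v|\<^sup>2 \<le> n\<close>, where \<open>n \<le> 1\<close> is the squared norm.\<close>
lemma cubic_remainder: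
  fixes v v' :: "real \<Rightarrow> complex"
  assumes v: "H1_profile v v'" and n1: "H1_sq v v' \<le> 1"
  shows "\<bar>LINT x|lborel. 2 * eta x * Re (v x) * (cmod (v x))\<^sup>2 + (cmod (v x))\<^sup>2 * (cmod (v x))\<^sup>2 / 2\<bar>
    \<le> 3 / 2 * sqrt (H1_sq v v') * H1_sq v v'"
proof -
  define n where "n = H1_sq v v'"
  have n0: "n \<ge> 0" by (simp add: n_def H1_sq_def)
  have dv: "exp_decaying (\<lambda>x. cmod (v x))" by (rule exp_decaying_norm[OF H1_profileD(2)[OF v]])
  have dv': "exp_decaying (\<lambda>x. cmod (v' x))" by (rule exp_decaying_norm[OF H1_profileD(3)[OF v]])
  note i = exp_decaying_add exp_decaying_diff exp_decaying_mult exp_decaying_power2 exp_decaying_divide exp_decaying_cmult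
    H1_profileD(2,3)[OF complex_profile_parts(1)[OF v]] H1_profileD(2,3)[OF eta_profile] dv dv'
  have m: "cmod (v x) \<le> sqrt n" for x
    using H1_sq_sup_bound[OF v, of x] by (simp add: n_def real_le_rsqrt)
  have sn: "n \<le> sqrt n"
  proof -
    have "sqrt n \<le> 1" using n1 by (simp add: n_def)
    hence "sqrt n * sqrt n \<le> 1 * sqrt n" using n0 by (intro mult_right_mono) auto
    thus ?thesis using n0 by simp
  qed
  let ?R = "\<lambda>x. 2 * eta x * Re (v x) * (cmod (v x))\<^sup>2 + (cmod (v x))\<^sup>2 * (cmod (v x))\<^sup>2 / 2"
  have iR: "exp_decaying ?R" by (intro i)
  have pw: "\<bar>?R x\<bar> \<le> 3 / 2 * sqrt n * (cmod (v x))\<^sup>2" for x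
  proof -
    have "\<bar>2 * eta x * Re (v x)\<bar> = (2 * eta x) * \<bar>Re (v x)\<bar>" using eta_pos[of x] by (simp add: abs_mult)
    also have "\<dots> \<le> 1 * sqrt n"
      using eta_le_half[of x] eta_pos[of x] order_trans[OF abs_Re_le_cmod m, of x]
      by (intro mult_mono) auto
    finally have "\<bar>2 * eta x * Re (v x)\<bar> * (cmod (v x))\<^sup>2 \<le> sqrt n * (cmod (v x))\<^sup>2"
      by (intro mult_right_mono) auto
    moreover have "(cmod (v x))\<^sup>2 \<le> n"
      using H1_sq_sup_bound[OF v, of x] by (simp add: n_def)
    hence "(cmod (v x))\<^sup>2 * (cmod (v x))\<^sup>2 \<le> sqrt n * (cmod (v x))\<^sup>2"
      using sn by (intro mult_right_mono) auto
    moreover have "\<bar>?R x\<bar> \<le> \<bar>2 * eta x * Re (v x)\<bar> * (cmod (v x))\<^sup>2 + (cmod (v x))\<^sup>2 * (cmod (v x))\<^sup>2 / 2"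
      by (rule order_trans[OF abs_triangle_ineq]) (simp add: abs_mult)
    ultimately show ?thesis by argo
  qed
  have "\<bar>LINT x|lborel. ?R x\<bar> \<le> (LINT x|lborel. \<bar>?R x\<bar>)" by (rule integral_abs_bound)
  also have "\<dots> \<le> (LINT x|lborel. 3 / 2 * sqrt n * (cmod (v x))\<^sup>2)"
  proof (rule lint_mono)
    show "exp_decaying (\<lambda>x. \<bar>?R x\<bar>)" using exp_decaying_norm[OF iR] by simp
    show "exp_decaying (\<lambda>x. 3 / 2 * sqrt n * (cmod (v x))\<^sup>2)" by (intro i)
  qed (rule pw)
  also have "\<dots> = 3 / 2 * sqrt n * (LINT x|lborel. (cmod (v x))\<^sup>2)" by simp
  also have "\<dots> \<le> 3 / 2 * sqrt n * n"
  proof -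
    have "(LINT x|lborel. (cmod (v x))\<^sup>2) \<le> n"
      unfolding n_def H1_sq_def by (rule lint_mono) (auto intro!: i)
    thus ?thesis using n0 by (intro mult_left_mono) auto
  qed
  finally show ?thesis by (simp add: n_def)
qed

lemma mass_le_H1_sq:
  fixes v v' :: "real \<Rightarrow> complex"
  assumes v: "H1_profile v v'"
  shows "mass v \<le> H1_sq v v'"
  unfolding mass_def H1_sq_def
  by (rule lint_mono)
     (auto intro!: exp_decaying_add exp_decaying_power2 exp_decaying_norm H1_profileD[OF v])

text \<open>By \<open>Lminus_nonneg\<close> the form dominates \<open>\<integral>b\<^sup>2 / 16\<close>, so \<open>\<integral>b\<^sup>2\<close> is at most \<open>16\<close> times the form. As
\<open>sech \<le> 1\<close>, \<open>\<integral>b'\<^sup>2\<close> is at most the form plus \<open>\<integral>b\<^sup>2 / 16\<close>, hence at most twice the form.\<close>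
lemma Lminus_coercive:
  assumes b: "H1_profile b b'" and b0: "b 0 = 0"
  shows "(LINT x|lborel. (b x)\<^sup>2) + (LINT x|lborel. (b' x)\<^sup>2) \<le> 18 *
     ((LINT x|lborel. (b' x)\<^sup>2) + (LINT x|lborel. (b x)\<^sup>2) / 16 - (LINT x|lborel. (sech4 x)\<^sup>2 * (b x)\<^sup>2) / 8)"
proof -
  note d = H1_profileD(2,3)[OF b] exp_decaying_sech4
  have 2: "(LINT x|lborel. (sech4 x)\<^sup>2 * (b x)\<^sup>2) \<le> (LINT x|lborel. (b x)\<^sup>2)"
  proof (rule lint_mono)
    show "(sech4 x)\<^sup>2 * (b x)\<^sup>2 \<le> (b x)\<^sup>2" for x
      using sech4_le1[of x] sech4_pos[of x] mult_right_mono[OF power_le_one[of "sech4 x" 2], of "(b x)\<^sup>2"] by simp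
  qed (intro exp_decaying_mult exp_decaying_power2 d)+
  show ?thesis using Lminus_nonneg[OF b b0] 2 by argo
qed

text \<open>The mass defect is \<open>M / sqrt 2\<close> plus the mass of \<open>v\<close>, with \<open>M\<close> the pairing in \<open>Lplus_coercive\<close>. So \<open>M\<^sup>2\<close> is at
most \<open>4\<close> times the squared defect up to a term of fourth order, which is absorbed together with the cubic
remainder.\<close>
lemma energy_coercive:
  "\<exists>K>0. \<exists>\<rho>>0. \<forall>(v :: real \<Rightarrow> complex) (v' :: real \<Rightarrow> complex). H1_profile v v' \<longrightarrow> (\<forall>x. v (- x) = v x) \<longrightarrow> Im (v 0) = 0 \<longrightarrow>
     H1_sq v v' \<le> \<rho> \<longrightarrow>
     H1_sq v v' \<le> K * (energy (\<lambda>x. eta x + v x) (\<lambda>x. eta' x + v' x) - energy eta eta'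
        + 4 * (mass (\<lambda>x. eta x + v x) - mass eta)\<^sup>2)"
proof -
  obtain C where C: "C > 0" and Lp: "\<forall>a a' :: real \<Rightarrow> real. H1_profile a a' \<longrightarrow> (\<forall>x. a (- x) = a x) \<longrightarrow>
     (LINT x|lborel. (a x)\<^sup>2) + (LINT x|lborel. (a' x)\<^sup>2) \<le>
       C * ((LINT x|lborel. (a' x)\<^sup>2) + (LINT x|lborel. (a x)\<^sup>2) / 16
        - 3 / 8 * (LINT x|lborel. (sech4 x)\<^sup>2 * (a x)\<^sup>2) + (LINT x|lborel. a x * sech4 x)\<^sup>2)"
    using Lplus_coercive by (elim exE conjE)
  define K where "K = max C 18"
  have K: "K \<ge> 18" "K \<ge> C" by (auto simp: K_def)
  \<comment> \<open>With this radius the cubic remainder costs at most \<open>n/8\<close> and the quartic term at most \<open>n/3\<close>, together less than \<open>n/2\<close>.\<close>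
  define \<rho> where "\<rho> = (1 / (12 * K))\<^sup>2"
  have rho: "\<rho> > 0" "\<rho> \<le> 1" "sqrt \<rho> = 1 / (12 * K)"
    using K by (auto simp: \<rho>_def power_le_one)
  show ?thesis
  proof (rule exI[of _ "2 * K"], rule conjI, use K in simp, rule exI[of _ \<rho>], rule conjI[OF rho(1)], intro allI impI)
    fix v v' :: "real \<Rightarrow> complex"
    assume v: "H1_profile v v'" and ev: "\<forall>x. v (- x) = v x" and Im0: "Im (v 0) = 0" and small: "H1_sq v v' \<le> \<rho>"
    define n where "n = H1_sq v v'"
    define R where "R = (LINT x|lborel. 2 * eta x * Re (v x) * (cmod (v x))\<^sup>2 + (cmod (v x))\<^sup>2 * (cmod (v x))\<^sup>2 / 2)"
    define dE where "dE = energy (\<lambda>x. eta x + v x) (\<lambda>x. eta' x + v' x) - energy eta eta'"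
    define dM where "dM = mass (\<lambda>x. eta x + v x) - mass eta"
    define M where "M = (LINT x|lborel. Re (v x) * sech4 x)"
    define Qp where "Qp = (LINT x|lborel. (Re (v' x))\<^sup>2) + (LINT x|lborel. (Re (v x))\<^sup>2) / 16
        - 3 / 8 * (LINT x|lborel. (sech4 x)\<^sup>2 * (Re (v x))\<^sup>2)"
    define Qm where "Qm = (LINT x|lborel. (Im (v' x))\<^sup>2) + (LINT x|lborel. (Im (v x))\<^sup>2) / 16
        - (LINT x|lborel. (sech4 x)\<^sup>2 * (Im (v x))\<^sup>2) / 8"
    note parts = complex_profile_parts[OF v]
    define A where "A = (LINT x|lborel. (Re (v x))\<^sup>2) + (LINT x|lborel. (Re (v' x))\<^sup>2)"
    define B where "B = (LINT x|lborel. (Im (v x))\<^sup>2) + (LINT x|lborel. (Im (v' x))\<^sup>2)"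
    have AB0: "A \<ge> 0" "B \<ge> 0" by (auto simp: A_def B_def)
    have nAB: "n = A + B" unfolding n_def A_def B_def by (rule H1_sq_parts[OF v])
    have n0: "n \<ge> 0" and n1: "n \<le> 1" using nAB AB0 small rho by (auto simp: n_def)
    have a1: "A \<le> C * (Qp + M\<^sup>2)"
      using Lp[rule_format, OF parts(1)] ev unfolding A_def Qp_def M_def by simp
    have b1: "B \<le> 18 * Qm"
      unfolding B_def Qm_def by (rule Lminus_coercive[OF parts(2) Im0])
    have "0 \<le> C * (Qp + M\<^sup>2)" using a1 AB0 by linarith
    hence p0: "0 \<le> Qp + M\<^sup>2" using C by (simp add: zero_le_mult_iff)
    have m0: "0 \<le> Qm" using b1 AB0 by linarith
    have "n \<le> K * (Qp + M\<^sup>2) + K * Qm"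
      using a1 b1 mult_right_mono[OF K(2) p0] mult_right_mono[OF K(1) m0] nAB by linarith
    moreover have E: "Qp + Qm = dE + R"
      using second_variation(1)[OF v] by (simp add: Qp_def Qm_def dE_def R_def)
    moreover have "K * (Qp + M\<^sup>2) + K * Qm = K * ((Qp + Qm) + M\<^sup>2)" by (simp add: algebra_simps)
    ultimately have 1: "n \<le> K * (dE + R + M\<^sup>2)" by simp
    have R: "R \<le> 3 / 2 * sqrt n * n"
      using cubic_remainder[OF v] n1 unfolding R_def n_def by linarith
    have sn: "sqrt n \<le> 1 / (12 * K)" using small rho(3) by (metis n_def real_sqrt_le_iff)
    have "R \<le> 3 / 2 * (1 / (12 * K)) * n"
      using R mult_right_mono[OF sn n0] by linarith
    hence KR: "K * R \<le> n / 8" using K by (simp add: field_simps)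
    define m where "m = mass v"
    have m: "0 \<le> m" "m \<le> n" unfolding m_def n_def using mass_le_H1_sq[OF v] by (auto simp: mass_def)
    have "M = sqrt 2 * (dM - m)"
      using second_variation(2)[OF v] by (simp add: M_def dM_def m_def mass_def)
    hence "M\<^sup>2 = 2 * (dM + (- m))\<^sup>2" by (simp add: power_mult_distrib)
    also have "\<dots> \<le> 4 * dM\<^sup>2 + 4 * m\<^sup>2" using square_add_le[of dM "- m"] by simp
    also have "m\<^sup>2 \<le> n * n" using m by (simp add: power2_eq_square mult_mono)
    finally have M2: "M\<^sup>2 \<le> 4 * dM\<^sup>2 + 4 * (n * n)" by simp
    have "n \<le> sqrt n" using n0 n1 real_le_rsqrt[of n n] mult_right_mono[OF n1 n0] by (simp add: power2_eq_square)
    hence "n \<le> 1 / (12 * K)" using sn by linarith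
    hence "n * n \<le> 1 / (12 * K) * n" using n0 by (rule mult_right_mono)
    hence "K * (4 * (n * n)) \<le> n / 3" using K by (simp add: field_simps)
    moreover have "K * M\<^sup>2 \<le> K * (4 * dM\<^sup>2) + K * (4 * (n * n))"
      using mult_left_mono[OF M2, of K] K by (simp add: algebra_simps)
    ultimately have "n \<le> K * (dE + 4 * dM\<^sup>2) + n / 8 + n / 3"
      using 1 KR by (simp add: algebra_simps)
    hence "n / 2 \<le> K * (dE + 4 * dM\<^sup>2)" using n0 by linarith
    thus "H1_sq v v' \<le> 2 * K * (energy (\<lambda>x. eta x + v x) (\<lambda>x. eta' x + v' x) - energy eta eta'
        + 4 * (mass (\<lambda>x. eta x + v x) - mass eta)\<^sup>2)"
      unfolding n_def dE_def dM_def by simp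
  qed
qed

lemma energy_upper:
  "\<exists>K>0. \<forall>(v :: real \<Rightarrow> complex) (v' :: real \<Rightarrow> complex). H1_profile v v' \<longrightarrow> H1_sq v v' \<le> 1 \<longrightarrow>
     energy (\<lambda>x. eta x + v x) (\<lambda>x. eta' x + v' x) - energy eta eta' \<le> K * H1_sq v v' \<and>
     (mass (\<lambda>x. eta x + v x) - mass eta)\<^sup>2 \<le> K * H1_sq v v'"
proof -
  define s where "s = (LINT x|lborel. (sech4 x)\<^sup>2)"
  have s0: "s \<ge> 0" by (simp add: s_def)
  show ?thesis
  proof (intro exI[of _ "3 + s"] conjI allI impI)
    show "3 + s > 0" using s0 by simp
    fix v v' :: "real \<Rightarrow> complex" assume v: "H1_profile v v'" and n1': "H1_sq v v' \<le> 1"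
    define n where "n = H1_sq v v'"
    have n0: "n \<ge> 0" and n1: "n \<le> 1" using n1' by (auto simp: n_def H1_sq_def)
    note parts = complex_profile_parts[OF v]
    note d = H1_profileD(2,3)[OF parts(1)] H1_profileD(2,3)[OF parts(2)] exp_decaying_sech4
    have pos: "0 \<le> (LINT x|lborel. (sech4 x)\<^sup>2 * (Re (v x))\<^sup>2)" "0 \<le> (LINT x|lborel. (sech4 x)\<^sup>2 * (Im (v x))\<^sup>2)"
      "0 \<le> (LINT x|lborel. (Re (v x))\<^sup>2)" "0 \<le> (LINT x|lborel. (Im (v x))\<^sup>2)"
      "0 \<le> (LINT x|lborel. (Re (v' x))\<^sup>2)" "0 \<le> (LINT x|lborel. (Im (v' x))\<^sup>2)"
      by simp_all
    have nn: "n = (LINT x|lborel. (Re (v x))\<^sup>2) + (LINT x|lborel. (Re (v' x))\<^sup>2)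
     + ((LINT x|lborel. (Im (v x))\<^sup>2) + (LINT x|lborel. (Im (v' x))\<^sup>2))" unfolding n_def by (rule H1_sq_parts[OF v])
    have sn: "sqrt n \<le> 1" using n1 by simp
    have "3 / 2 * sqrt n * n \<le> 3 / 2 * 1 * n" using sn n0 by (intro mult_mono) auto
    with cubic_remainder[OF v n1'] have R: "\<bar>LINT x|lborel. 2 * eta x * Re (v x) * (cmod (v x))\<^sup>2 + (cmod (v x))\<^sup>2 * (cmod (v x))\<^sup>2 / 2\<bar>
      \<le> 3 / 2 * n" unfolding n_def by linarith
    have "energy (\<lambda>x. eta x + v x) (\<lambda>x. eta' x + v' x) - energy eta eta' \<le> 3 * n"
      unfolding second_variation(1)[OF v] using R pos nn by linarith
    also have "\<dots> \<le> (3 + s) * n" using s0 n0 by (intro mult_right_mono) auto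
    finally show "energy (\<lambda>x. eta x + v x) (\<lambda>x. eta' x + v' x) - energy eta eta' \<le> (3 + s) * H1_sq v v'"
      by (simp add: n_def)
    define M where "M = (LINT x|lborel. Re (v x) * sech4 x)"
    define m where "m = mass v"
    have m: "0 \<le> m" "m \<le> n" unfolding m_def n_def using mass_le_H1_sq[OF v] by (auto simp: mass_def)
    have "(mass (\<lambda>x. eta x + v x) - mass eta)\<^sup>2 = (M / sqrt 2 + m)\<^sup>2"
      using second_variation(2)[OF v] by (simp add: M_def m_def mass_def)
    also have "\<dots> \<le> M\<^sup>2 + 2 * m\<^sup>2" using square_add_le[of "M / sqrt 2" m] by (simp add: power_divide)
    also have "M\<^sup>2 \<le> n * s"
    proof -
      have "M\<^sup>2 \<le> (LINT x|lborel. (Re (v x))\<^sup>2) * s"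
        unfolding M_def s_def by (rule lint_Cauchy_Schwarz) (rule d)+
      also have "\<dots> \<le> n * s" using nn pos s0 by (intro mult_right_mono) auto
      finally show ?thesis .
    qed
    also have "m\<^sup>2 \<le> 1 * n" using m n1 unfolding power2_eq_square by (intro mult_mono) auto
    finally have "(mass (\<lambda>x. eta x + v x) - mass eta)\<^sup>2 \<le> n * s + 2 * (1 * n)" by simp
    also have "\<dots> \<le> (3 + s) * n" using n0 by (simp add: algebra_simps)
    finally show "(mass (\<lambda>x. eta x + v x) - mass eta)\<^sup>2 \<le> (3 + s) * H1_sq v v'" by (simp add: n_def)
  qed
qed

section \<open>Weak derivatives and the distance to the orbit\<close>

lemma test_function_bounds:
  assumes "test_function \<phi>"
  shows "\<And>x. (\<phi> has_real_derivative deriv \<phi> x) (at x)" "continuous_on UNIV \<phi>"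
    "continuous_on UNIV (deriv \<phi>)" "\<exists>B. \<forall>x. \<bar>\<phi> x\<bar> \<le> B" "\<exists>B. \<forall>x. \<bar>deriv \<phi> x\<bar> \<le> B"
    "\<exists>R. \<forall>x. \<bar>x\<bar> > R \<longrightarrow> \<phi> x = 0"
proof -
  define K where "K = closure {x. \<phi> x \<noteq> 0}"
  have K: "compact K" using assms by (simp add: test_function_def K_def)
  obtain D where D: "\<And>x. (\<phi> has_vector_derivative D x) (at x)" "continuous_on UNIV D"
    using assms unfolding test_function_def C1_differentiable_on_def by auto
  have DD: "(\<phi> has_real_derivative D x) (at x)" for x
    using D(1) by (simp add: has_real_derivative_iff_has_vector_derivative)
  have eq: "deriv \<phi> = D" using DD by (auto intro!: DERIV_imp_deriv)
  show d: "\<And>x. (\<phi> has_real_derivative deriv \<phi> x) (at x)" using DD eq by simp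
  show c: "continuous_on UNIV \<phi>" using d by (auto intro!: DERIV_continuous_on[where D="deriv \<phi>"] DERIV_subset[OF d])
  show c': "continuous_on UNIV (deriv \<phi>)" using D(2) eq by simp
  have z: "\<phi> x = 0" if "x \<notin> K" for x using that closure_subset[of "{x. \<phi> x \<noteq> 0}"] by (auto simp: K_def)
  have z': "deriv \<phi> x = 0" if "x \<notin> K" for x
  proof -
    have "open (- K)" using K by (auto intro: compact_imp_closed)
    hence "\<forall>\<^sub>F y in nhds x. y \<in> - K" using that by (intro eventually_nhds_in_open) auto
    hence "\<forall>\<^sub>F y in nhds x. \<phi> y = 0" by eventually_elim (use z in auto)
    hence "(\<phi> has_real_derivative 0) (at x) = ((\<lambda>_. 0) has_real_derivative 0) (at x)"
      by (intro DERIV_cong_ev) auto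
    hence "(\<phi> has_real_derivative 0) (at x)" by simp
    thus ?thesis by (rule DERIV_imp_deriv)
  qed
  have bd: "\<exists>B. \<forall>x. \<bar>f x\<bar> \<le> B" if f: "continuous_on UNIV f" and f0: "\<And>x. x \<notin> K \<Longrightarrow> f x = 0" for f :: "real \<Rightarrow> real"
  proof -
    have "bounded (f ` K)" using compact_continuous_image[OF continuous_on_subset[OF f] K] by (simp add: compact_imp_bounded)
    then obtain B where B: "\<And>y. y \<in> f ` K \<Longrightarrow> norm y \<le> B" unfolding bounded_iff by blast
    have "\<bar>f x\<bar> \<le> \<bar>B\<bar>" for x
      using B[of "f x"] f0[of x] by (cases "x \<in> K") auto
    thus ?thesis by blast
  qed
  show "\<exists>B. \<forall>x. \<bar>\<phi> x\<bar> \<le> B" by (rule bd[OF c z])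
  show "\<exists>B. \<forall>x. \<bar>deriv \<phi> x\<bar> \<le> B" by (rule bd[OF c' z'])
  obtain R where R: "\<And>x. x \<in> K \<Longrightarrow> norm x \<le> R" using compact_imp_bounded[OF K] unfolding bounded_iff by blast
  show "\<exists>R. \<forall>x. \<bar>x\<bar> > R \<longrightarrow> \<phi> x = 0" using R z by (intro exI[of _ R]) force
qed

lemma exp_decaying_scaleR_bounded:
  fixes f :: "real \<Rightarrow> 'a::euclidean_space" and g :: "real \<Rightarrow> real"
  assumes f: "exp_decaying f" and g: "g \<in> borel_measurable borel" and b: "\<And>x. \<bar>g x\<bar> \<le> B"
  shows "exp_decaying (\<lambda>x. g x *\<^sub>R f x)"
  by (rule exp_decaying_scaled[OF f, where B=B])
     (use f g b in \<open>auto simp: exp_decaying_def intro!: mult_right_mono\<close>)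

lemma profile_integration_by_parts:
  fixes f f' :: "real \<Rightarrow> real"
  assumes f: "H1_profile f f'" and t: "test_function \<phi>"
  shows "(LINT x|lborel. deriv \<phi> x * f x) = - (LINT x|lborel. \<phi> x * f' x)"
proof -
  note tb = test_function_bounds[OF t]
  obtain B where B: "\<And>x. \<bar>\<phi> x\<bar> \<le> B" using tb(4) by blast
  obtain B' where B': "\<And>x. \<bar>deriv \<phi> x\<bar> \<le> B'" using tb(5) by blast
  have m: "\<phi> \<in> borel_measurable borel" "deriv \<phi> \<in> borel_measurable borel"
    using tb(2,3) by (auto intro: borel_measurable_continuous_onI)
  note i = exp_decaying_bounded_mult[OF _ m(1) B] exp_decaying_bounded_mult[OF _ m(2) B'] exp_decaying_add H1_profileD(2,3)[OF f]
  obtain S where S: "finite S" "\<And>x. x \<notin> S \<Longrightarrow> (f has_real_derivative f' x) (at x)"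
    using H1_profile_diff_real[OF f] by blast
  have "(LINT x|lborel. deriv \<phi> x * f x + \<phi> x * f' x) = 0"
  proof (rule FTC_line[where S=S and F="\<lambda>x. \<phi> x * f x"])
    show "continuous_on UNIV (\<lambda>x. \<phi> x * f x)" using tb(2) H1_profileD(1)[OF f] by (intro continuous_intros)
    fix x assume "x \<notin> S"
    thus "((\<lambda>x. \<phi> x * f x) has_real_derivative deriv \<phi> x * f x + \<phi> x * f' x) (at x)"
      using DERIV_mult[OF tb(1)[of x] S(2)[of x]] by (simp add: mult.commute)
  qed (use S(1) in \<open>auto intro!: i\<close>)
  thus ?thesis by (simp add: lint_add i)
qed

lemma exp_decaying_square_integrable:
  assumes "exp_decaying f" shows "square_integrable f"
  using assms exp_decaying_integrable[OF exp_decaying_power2[OF exp_decaying_norm[OF assms]]]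
  by (auto simp: square_integrable_def exp_decaying_def)

lemma H1_profile_H1_derivative:
  assumes f: "H1_profile f f'" shows "H1_derivative f f'"
  unfolding H1_derivative_def
proof (intro conjI allI impI)
  show "square_integrable f" "square_integrable f'"
    using H1_profileD[OF f] by (auto intro: exp_decaying_square_integrable)
  fix \<phi> assume t: "test_function \<phi>"
  note tb = test_function_bounds[OF t]
  obtain B where B: "\<And>x. \<bar>\<phi> x\<bar> \<le> B" using tb(4) by blast
  obtain B' where B': "\<And>x. \<bar>deriv \<phi> x\<bar> \<le> B'" using tb(5) by blast
  have m: "\<phi> \<in> borel_measurable borel" "deriv \<phi> \<in> borel_measurable borel"
    using tb(2,3) by (auto intro: borel_measurable_continuous_onI)
  have i: "integrable lborel (\<lambda>x. deriv \<phi> x *\<^sub>R f x)" "integrable lborel (\<lambda>x. \<phi> x *\<^sub>R f' x)"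
    by (intro exp_decaying_integrable exp_decaying_scaleR_bounded[OF _ m(2) B']
        exp_decaying_scaleR_bounded[OF _ m(1) B] H1_profileD[OF f])+
  show "(LINT x|lborel. deriv \<phi> x *\<^sub>R f x) = - (LINT x|lborel. \<phi> x *\<^sub>R f' x)"
  proof (rule complex_eqI)
    show "Re (LINT x|lborel. deriv \<phi> x *\<^sub>R f x) = Re (- (LINT x|lborel. \<phi> x *\<^sub>R f' x))"
      using profile_integration_by_parts[OF complex_profile_parts(1)[OF f] t]
        integral_Re[OF i(1)] integral_Re[OF i(2)] by simp
    show "Im (LINT x|lborel. deriv \<phi> x *\<^sub>R f x) = Im (- (LINT x|lborel. \<phi> x *\<^sub>R f' x))"
      using profile_integration_by_parts[OF complex_profile_parts(2)[OF f] t]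
        integral_Im[OF i(1)] integral_Im[OF i(2)] by simp
  qed
qed

lemma pos_part_sq_deriv: "((\<lambda>y::real. (max 0 y)\<^sup>2) has_real_derivative 2 * max 0 y) (at y)"
proof -
  consider "y > 0" | "y < 0" | "y = 0" by linarith
  thus ?thesis
  proof cases
    case 1
    have "((\<lambda>y::real. y\<^sup>2) has_real_derivative 2 * y) (at y)" by (auto intro!: derivative_eq_intros)
    moreover have "\<forall>\<^sub>F z in nhds y. z\<^sup>2 = (max 0 z)\<^sup>2"
      by (rule eventually_mono[OF eventually_nhds_in_open[of "{0<..}"]]) (use 1 in auto)
    ultimately have "((\<lambda>y::real. (max 0 y)\<^sup>2) has_real_derivative 2 * y) (at y)"
      by (rule DERIV_cong_ev[THEN iffD1, rotated -1, OF _ refl _ refl])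
    thus ?thesis using 1 by simp
  next
    case 2
    have "((\<lambda>y::real. 0) has_real_derivative 0) (at y)" by simp
    moreover have "\<forall>\<^sub>F z in nhds y. 0 = (max 0 z)\<^sup>2"
      by (rule eventually_mono[OF eventually_nhds_in_open[of "{..<0}"]]) (use 2 in auto)
    ultimately have "((\<lambda>y::real. (max 0 y)\<^sup>2) has_real_derivative 0) (at y)"
      by (rule DERIV_cong_ev[THEN iffD1, rotated -1, OF _ refl _ refl])
    thus ?thesis using 2 by simp
  next
    case 3
    have "((\<lambda>h::real. ((max 0 (0 + h))\<^sup>2 - (max 0 0)\<^sup>2) / h) \<longlongrightarrow> 0) (at 0)"
    proof (rule Lim_null_comparison)
      show "((\<lambda>h::real. \<bar>h\<bar>) \<longlongrightarrow> 0) (at 0)" by (intro tendsto_rabs_zero tendsto_ident_at)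
      show "\<forall>\<^sub>F h in at (0::real). norm (((max 0 (0 + h))\<^sup>2 - (max 0 0)\<^sup>2) / h) \<le> \<bar>h\<bar>"
        by (rule always_eventually) (auto simp: max_def power2_eq_square)
    qed
    thus ?thesis using 3 by (simp add: DERIV_def)
  qed
qed

text \<open>Continuously differentiable functions that increase with \<open>n\<close> to the indicator of an open interval. The
square of the positive part already gives the required smoothness.\<close>
definition bump :: "real \<Rightarrow> real \<Rightarrow> nat \<Rightarrow> real \<Rightarrow> real" where
  "bump a b n x = 1 - exp (- (real n * (max 0 ((x - a) * (b - x)))\<^sup>2))"

lemma bump_range: "0 \<le> bump a b n x" "bump a b n x \<le> 1"
  by (auto simp: bump_def)

lemma bump_zero: "x \<notin> {a<..<b} \<Longrightarrow> a < b \<Longrightarrow> bump a b n x = 0"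
proof -
  assume "x \<notin> {a<..<b}" "a < b"
  hence "(x - a) * (b - x) \<le> 0" by (auto simp: mult_le_0_iff not_less)
  thus ?thesis by (simp add: bump_def max_def)
qed

lemma bump_test_function:
  assumes "a < b" shows "test_function (bump a b n)"
proof -
  let ?D = "\<lambda>x. exp (- (real n * (max 0 ((x - a) * (b - x)))\<^sup>2)) * (real n * (2 * max 0 ((x - a) * (b - x)) * ((b - x) - (x - a))))"
  have "(bump a b n has_real_derivative ?D x) (at x)" for x
  proof -
    have "((\<lambda>x. (x - a) * (b - x)) has_real_derivative ((b - x) - (x - a))) (at x)"
      by (auto intro!: derivative_eq_intros)
    note q = DERIV_chain2[OF pos_part_sq_deriv this]
    show ?thesis
      unfolding bump_def[abs_def] by (rule derivative_eq_intros q refl)+ simp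
  qed
  hence "bump a b n C1_differentiable_on UNIV"
    unfolding C1_differentiable_on_def
    by (intro exI[of _ ?D]) (auto simp: has_real_derivative_iff_has_vector_derivative intro!: continuous_intros)
  moreover have "compact (closure {x. bump a b n x \<noteq> 0})"
  proof -
    have "x \<in> {a..b}" if "bump a b n x \<noteq> 0" for x
      using bump_zero[of x a b n] that assms by (cases "x \<in> {a<..<b}") auto
    hence "bounded {x. bump a b n x \<noteq> 0}"
      by (intro bounded_subset[OF bounded_closed_interval[of a b]]) auto
    thus ?thesis by simp
  qed
  ultimately show ?thesis by (simp add: test_function_def)
qed

lemma bump_tendsto:
  assumes "a < b" shows "(\<lambda>n. bump a b n x) \<longlonglongrightarrow> indicator {a<..<b} x"
proof (cases "x \<in> {a<..<b}")
  case False
  thus ?thesis using bump_zero[OF False assms] by simp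
next
  case True
  define c where "c = (max 0 ((x - a) * (b - x)))\<^sup>2"
  have "c > 0" using True by (auto simp: c_def max_def)
  hence "(\<lambda>n. 1 - exp (- (real n * c))) \<longlonglongrightarrow> 1 - 0" by real_asymp
  thus ?thesis using True by (simp add: bump_def c_def)
qed

lemma square_integrable_local:
  assumes "square_integrable g" and A: "A \<in> sets borel" "emeasure lborel A < \<infinity>"
  shows "integrable lborel (\<lambda>x. indicator A x *\<^sub>R g x)"
proof (rule Bochner_Integration.integrable_bound)
  show "integrable lborel (\<lambda>x. indicator A x + (cmod (g x))\<^sup>2)"
    using assms by (auto simp: square_integrable_def intro!: Bochner_Integration.integrable_add)
  show "(\<lambda>x. indicator A x *\<^sub>R g x) \<in> borel_measurable lborel"
    using assms by (auto simp: square_integrable_def)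
  show "AE x in lborel. norm (indicator A x *\<^sub>R g x) \<le> norm (indicator A x + (cmod (g x))\<^sup>2)"
  proof (rule AE_I2)
    fix x
    have "0 \<le> (cmod (g x) - 1)\<^sup>2" by simp
    hence "2 * cmod (g x) \<le> 1 + (cmod (g x))\<^sup>2" unfolding power2_diff by simp
    hence "cmod (g x) \<le> 1 + (cmod (g x))\<^sup>2" using norm_ge_zero[of "g x"] by linarith
    thus "norm (indicator A x *\<^sub>R g x) \<le> norm (indicator A x + (cmod (g x))\<^sup>2)"
      by (auto simp: indicator_def)
  qed
qed

lemma du_Bois_Reymond_interval:
  assumes g: "square_integrable g" and z: "\<And>\<phi>. test_function \<phi> \<Longrightarrow> (LINT x|lborel. \<phi> x *\<^sub>R g x) = 0" and "a < b"
  shows "(LINT x|lborel. indicator {a<..<b} x *\<^sub>R g x) = 0"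
proof -
  have gm: "g \<in> borel_measurable borel" using g by (simp add: square_integrable_def)
  have bm: "bump a b n \<in> borel_measurable borel" for n
    using test_function_bounds(2)[OF bump_test_function[OF \<open>a < b\<close>]] by (rule borel_measurable_continuous_onI)
  have "(\<lambda>n. LINT x|lborel. bump a b n x *\<^sub>R g x) \<longlonglongrightarrow> (LINT x|lborel. indicator {a<..<b} x *\<^sub>R g x)"
  proof (rule integral_dominated_convergence[where w="\<lambda>x. norm (indicator {a..b} x *\<^sub>R g x)"])
    show "integrable lborel (\<lambda>x. norm (indicator {a..b} x *\<^sub>R g x))"
      by (intro integrable_norm square_integrable_local g) (auto simp: emeasure_lborel_Icc_eq)
    show "AE x in lborel. (\<lambda>n. bump a b n x *\<^sub>R g x) \<longlonglongrightarrow> indicator {a<..<b} x *\<^sub>R g x"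
      by (intro AE_I2 tendsto_scaleR bump_tendsto \<open>a < b\<close> tendsto_const)
    show "AE x in lborel. norm (bump a b n x *\<^sub>R g x) \<le> norm (indicator {a..b} x *\<^sub>R g x)" for n
      using bump_range[of a b n] bump_zero[OF _ \<open>a < b\<close>, of _ n]
      by (intro AE_I2) (auto simp: indicator_def mult_left_le_one_le)
    show "(\<lambda>x. indicator {a<..<b} x *\<^sub>R g x) \<in> borel_measurable lborel"
      using gm by (auto intro!: borel_measurable_scaleR)
    show "(\<lambda>x. bump a b n x *\<^sub>R g x) \<in> borel_measurable lborel" for n
      using gm bm by (auto intro!: borel_measurable_scaleR)
  qed
  thus ?thesis using z[OF bump_test_function[OF \<open>a < b\<close>]] by (simp add: LIMSEQ_const_iff)
qed

text \<open>The integrals over intervals vanish by approximation with \<open>bump\<close>, hence those over all bounded Borel sets.\<close>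
lemma du_Bois_Reymond:
  assumes g: "square_integrable g" and z: "\<And>\<phi>. test_function \<phi> \<Longrightarrow> (LINT x|lborel. \<phi> x *\<^sub>R g x) = 0"
  shows "AE x in lborel. g x = 0"
proof -
  have gm [measurable]: "g \<in> borel_measurable borel" using g by (simp add: square_integrable_def)
  have I: "(LINT x|lborel. indicator {a<..<b} x *\<^sub>R g x) = 0" for a b
    by (cases "a < b") (simp_all add: du_Bois_Reymond_interval[OF g z])
  have "AE x in lborel. indicator {- real N<..<real N} x *\<^sub>R g x = 0" for N :: nat
  proof (rule sigma_finite_measure.density_zero[OF sigma_finite_lborel])
    define f where "f x = indicator {- real N<..<real N} x *\<^sub>R g x" for x
    show i: "integrable lborel (\<lambda>x. indicator {- real N<..<real N} x *\<^sub>R g x)"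
      by (rule square_integrable_local[OF g]) auto
    have fi: "integrable lborel f" unfolding f_def[abs_def] by (rule i)
    have si: "set_integrable lborel A f" if "A \<in> sets borel" for A
      by (rule integrable_imp_set_integrable[OF fi that])
    have f0: "(LINT x|lborel. f x) = 0" unfolding f_def by (rule I)
    have fm [measurable]: "f \<in> borel_measurable borel" unfolding f_def[abs_def] by measurable
    fix A :: "real set" assume "A \<in> sets lborel"
    hence "A \<in> sets borel" by simp
    hence "A \<in> sets borel \<and> (LINT x:A|lborel. f x) = 0"
    proof (induction rule: borel_set_induct)
      case empty show ?case by (simp add: set_lebesgue_integral_def)
    next
      case (interval a b)
      have "(LINT x:{a..b}|lborel. f x) = (LINT x|lborel. indicator {max a (- real N)<..<min b (real N)} x *\<^sub>R g x)"
        unfolding set_lebesgue_integral_def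
      proof (rule integral_cong_AE)
        show "AE x in lborel. indicator {a..b} x *\<^sub>R f x = indicator {max a (- real N)<..<min b (real N)} x *\<^sub>R g x"
          using AE_lborel_singleton[of a] AE_lborel_singleton[of b]
          by eventually_elim (auto simp: indicator_def f_def)
      qed simp_all
      thus ?case using I by simp
    next
      case (compl A)
      have "(LINT x:A \<union> - A|lborel. f x) = (LINT x:A|lborel. f x) + (LINT x:- A|lborel. f x)"
        by (rule set_integral_Un) (use compl si in auto)
      moreover have "(LINT x:A \<union> - A|lborel. f x) = 0"
        using f0 by (simp add: set_lebesgue_integral_def)
      ultimately show ?case using compl by auto
    next
      case (union A)
      hence m: "\<And>i. A i \<in> sets borel" and z: "\<And>i. (LINT x:A i|lborel. f x) = 0" by auto
      have u: "(\<Union>i. A i) \<in> sets borel" using m by auto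
      have "(LINT x:(\<Union>i. A i)|lborel. f x) = (\<Sum>i. (LINT x:A i|lborel. f x))"
        by (rule lebesgue_integral_countable_add)
           (use m union.hyps(1) in \<open>auto simp: disjoint_family_on_def intro: si u\<close>)
      thus ?case using u z by simp
    qed
    thus "(LINT x:A|lborel. indicator {- real N<..<real N} x *\<^sub>R g x) = 0" by (simp add: f_def)
  qed
  hence "AE x in lborel. \<forall>N::nat. indicator {- real N<..<real N} x *\<^sub>R g x = 0"
    unfolding AE_all_countable by blast
  thus ?thesis
  proof (rule AE_mp[OF _ AE_I2], intro impI)
    fix x assume a: "\<forall>N::nat. indicator {- real N<..<real N} x *\<^sub>R g x = 0"
    obtain N :: nat where "\<bar>x\<bar> < real N" using reals_Archimedean2 by blast
    hence "x \<in> {- real N<..<real N}" by auto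
    with a[rule_format, of N] show "g x = 0" by simp
  qed
qed

lemma H1_derivative_unique:
  assumes "H1_derivative f g" "H1_derivative f h" shows "AE x in lborel. g x = h x"
proof -
  have g: "square_integrable g" and h: "square_integrable h"
    using assms by (auto simp: H1_derivative_def)
  have gm: "g \<in> borel_measurable borel" "h \<in> borel_measurable borel"
    using g h by (auto simp: square_integrable_def)
  have "AE x in lborel. g x - h x = 0"
  proof (rule du_Bois_Reymond)
    show "square_integrable (\<lambda>x. g x - h x)"
      unfolding square_integrable_def
    proof
      show "(\<lambda>x. g x - h x) \<in> borel_measurable lborel" using gm by simp
      show "integrable lborel (\<lambda>x. (cmod (g x - h x))\<^sup>2)"
      proof (rule Bochner_Integration.integrable_bound)
        show "integrable lborel (\<lambda>x. 2 * (cmod (g x))\<^sup>2 + 2 * (cmod (h x))\<^sup>2)"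
          using g h by (auto simp: square_integrable_def)
        show "AE x in lborel. norm ((cmod (g x - h x))\<^sup>2) \<le> norm (2 * (cmod (g x))\<^sup>2 + 2 * (cmod (h x))\<^sup>2)"
        proof (rule AE_I2)
          fix x
          have "(cmod (g x - h x))\<^sup>2 \<le> (cmod (g x) + cmod (h x))\<^sup>2"
            by (intro power_mono norm_triangle_ineq4) auto
          also have "\<dots> \<le> 2 * (cmod (g x))\<^sup>2 + 2 * (cmod (h x))\<^sup>2" by (rule square_add_le)
          finally show "norm ((cmod (g x - h x))\<^sup>2) \<le> norm (2 * (cmod (g x))\<^sup>2 + 2 * (cmod (h x))\<^sup>2)" by simp
        qed
        show "(\<lambda>x. (cmod (g x - h x))\<^sup>2) \<in> borel_measurable lborel"
          using gm by (auto intro!: borel_measurable_power borel_measurable_norm borel_measurable_diff)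
      qed
    qed
    fix \<phi> assume t: "test_function \<phi>"
    note tb = test_function_bounds[OF t]
    obtain B where B: "\<And>x. \<bar>\<phi> x\<bar> \<le> B" using tb(4) by blast
    obtain R where R: "\<And>x. \<bar>x\<bar> > R \<Longrightarrow> \<phi> x = 0" using tb(6) by blast
    have pm: "\<phi> \<in> borel_measurable borel" using tb(2) by (rule borel_measurable_continuous_onI)
    have i: "integrable lborel (\<lambda>x. \<phi> x *\<^sub>R k x)" if k: "square_integrable k" for k
    proof (rule Bochner_Integration.integrable_bound)
      show "integrable lborel (\<lambda>x. B *\<^sub>R (indicator {- R..R} x *\<^sub>R k x))"
        by (intro integrable_scaleR_right square_integrable_local[OF k]) (auto simp: emeasure_lborel_Icc_eq)
      show "(\<lambda>x. \<phi> x *\<^sub>R k x) \<in> borel_measurable lborel" using pm k by (auto simp: square_integrable_def intro!: borel_measurable_scaleR)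
      show "AE x in lborel. norm (\<phi> x *\<^sub>R k x) \<le> norm (B *\<^sub>R (indicator {- R..R} x *\<^sub>R k x))"
      proof (rule AE_I2)
        fix x
        have "\<bar>\<phi> x\<bar> * cmod (k x) \<le> \<bar>B\<bar> * cmod (k x)" using B[of x] by (intro mult_right_mono) auto
        thus "norm (\<phi> x *\<^sub>R k x) \<le> norm (B *\<^sub>R (indicator {- R..R} x *\<^sub>R k x))"
          using R[of x] by (cases "\<bar>x\<bar> > R") (auto simp: indicator_def)
      qed
    qed
    have "(LINT x|lborel. \<phi> x *\<^sub>R g x) = (LINT x|lborel. \<phi> x *\<^sub>R h x)"
      using assms t by (simp add: H1_derivative_def)
    thus "(LINT x|lborel. \<phi> x *\<^sub>R (g x - h x)) = 0"
      by (simp add: scaleR_diff_right Bochner_Integration.integral_diff i g h)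
  qed
  thus ?thesis by simp
qed

text \<open>The weak derivative selected in the norm agrees almost everywhere with the pointwise one by uniqueness.\<close>
lemma H1_norm_profile:
  assumes f: "H1_profile f f'" shows "H1_norm f = sqrt (H1_sq f f')"
proof -
  have d: "H1_derivative f f'" by (rule H1_profile_H1_derivative[OF f])
  hence w: "H1_derivative f (weak_deriv f)" unfolding weak_deriv_def by (rule someI[of "H1_derivative f"])
  have m: "f \<in> borel_measurable borel" "f' \<in> borel_measurable borel" "weak_deriv f \<in> borel_measurable borel"
    using d w by (auto simp: H1_derivative_def square_integrable_def)
  have "(LINT x|lborel. (cmod (f x))\<^sup>2 + (cmod (weak_deriv f x))\<^sup>2) = H1_sq f f'"
    unfolding H1_sq_def
    by (rule integral_cong_AE) (use m H1_derivative_unique[OF w d] in \<open>auto elim: eventually_mono\<close>)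
  thus ?thesis by (simp add: H1_norm_def)
qed

lemma unit_circle_exp: "cmod z = 1 \<longleftrightarrow> (\<exists>\<alpha>::real. z = exp (\<i> * of_real \<alpha>))"
proof
  assume "cmod z = 1"
  hence "z = exp (\<i> * of_real (Arg z))" using Arg_eq[of z] by (cases "z = 0") auto
  thus "\<exists>\<alpha>::real. z = exp (\<i> * of_real \<alpha>)" by blast
qed (auto simp: norm_exp_i_times)

abbreviation orbit_sq :: "(real \<Rightarrow> complex) \<Rightarrow> (real \<Rightarrow> complex) \<Rightarrow> complex \<Rightarrow> real" where
  "orbit_sq u u' z \<equiv> H1_sq (\<lambda>x. u x - z * eta x) (\<lambda>x. u' x - z * eta' x)"

lemma complex_eta_profile: "H1_profile (\<lambda>x. z * complex_of_real (eta x)) (\<lambda>x. z * complex_of_real (eta' x))"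
  by (rule H1_profile_cmult[OF H1_profile_linear[OF bounded_linear_of_real eta_profile]])

lemma orbit_profile:
  fixes u u' :: "real \<Rightarrow> complex"
  shows "H1_profile u u' \<Longrightarrow> H1_profile (\<lambda>x. u x - (z :: complex) * eta x) (\<lambda>x. u' x - z * eta' x)"
  by (rule H1_profile_diff[OF _ complex_eta_profile])

text \<open>The infimum over the orbit is not known to be attained at this point, so its lower bound is used through
near-minimizers.\<close>
lemma H1_dist_Gamma_orbit:
  fixes u u' :: "real \<Rightarrow> complex"
  assumes u: "H1_profile u u'"
  shows "cmod z = 1 \<Longrightarrow> H1_dist u Gamma_orbit \<le> sqrt (orbit_sq u u' z)"
    "H1_dist u Gamma_orbit < d \<Longrightarrow> \<exists>z. cmod z = 1 \<and> sqrt (orbit_sq u u' z) < d"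
proof -
  have bdd: "bdd_below ((\<lambda>\<nu>. H1_norm (\<lambda>x. u x - \<nu> x)) ` Gamma_orbit)"
    by (rule bdd_belowI2[of _ 0]) (simp add: H1_norm_def)
  show "H1_dist u Gamma_orbit \<le> sqrt (orbit_sq u u' z)" if "cmod z = 1"
  proof -
    obtain \<alpha> :: real where z: "z = exp (\<i> * of_real \<alpha>)" using unit_circle_exp[of z] \<open>cmod z = 1\<close> by blast
    hence "(\<lambda>x. z * of_real (eta x)) \<in> Gamma_orbit" by (auto simp: Gamma_orbit_def)
    from cINF_lower[OF bdd this] show ?thesis
      by (simp add: H1_dist_def H1_norm_profile[OF orbit_profile[OF u]])
  qed
  show "\<exists>z. cmod z = 1 \<and> sqrt (orbit_sq u u' z) < d" if d: "H1_dist u Gamma_orbit < d"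
  proof -
    have "Gamma_orbit \<noteq> {}" by (auto simp: Gamma_orbit_def)
    then obtain \<nu> where "\<nu> \<in> Gamma_orbit" "H1_norm (\<lambda>x. u x - \<nu> x) < d"
      using d cINF_less_iff[OF _ bdd] unfolding H1_dist_def by blast
    then obtain \<alpha> :: real where "H1_norm (\<lambda>x. u x - exp (\<i> * of_real \<alpha>) * of_real (eta x)) < d"
      by (auto simp: Gamma_orbit_def)
    thus ?thesis unfolding H1_norm_profile[OF orbit_profile[OF u]]
      by (intro exI[of _ "exp (\<i> * of_real \<alpha>)"]) (simp add: norm_exp_i_times)
  qed
qed

section \<open>Piecewise linear interpolation\<close>

definition lattice_support :: "nat \<Rightarrow> (int \<Rightarrow> complex) \<Rightarrow> bool" where
  "lattice_support K \<psi> \<longleftrightarrow> (\<forall>j. \<bar>j\<bar> \<ge> int K + 1 \<longrightarrow> \<psi> j = 0)"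

definition interp_slope :: "real \<Rightarrow> (int \<Rightarrow> complex) \<Rightarrow> real \<Rightarrow> complex" where
  "interp_slope h \<psi> x = (\<psi> (\<lfloor>x / h\<rfloor> + 1) - \<psi> \<lfloor>x / h\<rfloor>) / h"

lemma interp_cell:
  assumes "of_int j \<le> x / h" "x / h \<le> of_int j + 1"
  shows "interp h \<psi> x = \<psi> j + of_real (x / h - of_int j) * (\<psi> (j + 1) - \<psi> j)"
proof -
  have "interp h \<psi> x = (\<Sum>\<^sub>\<infinity>k\<in>{j, j + 1}. \<psi> k * of_real (hat (x / h - of_int k)))"
    unfolding interp_def
  proof (rule infsum_cong_neutral)
    fix k assume k: "k \<in> UNIV - {j, j + 1}"
    hence "k < j \<or> k > j + 1" by auto
    hence "of_int k \<le> (of_int j - 1 :: real) \<or> of_int k \<ge> (of_int j + 2 :: real)" by linarith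
    hence "hat (x / h - of_int k) = 0" using assms by (auto simp: hat_def)
    thus "\<psi> k * of_real (hat (x / h - of_int k)) = 0" by simp
  qed auto
  also have "\<dots> = \<psi> j * of_real (hat (x / h - of_int j)) + \<psi> (j + 1) * of_real (hat (x / h - of_int (j + 1)))"
    by (simp add: infsum_finite)
  also have "hat (x / h - of_int j) = 1 - (x / h - of_int j)" using assms by (simp add: hat_def)
  also have "hat (x / h - of_int (j + 1)) = x / h - of_int j" using assms by (simp add: hat_def)
  finally show ?thesis by (simp add: algebra_simps)
qed

lemma interp_node: "h > 0 \<Longrightarrow> interp h \<psi> (of_int j * h) = \<psi> j"
  using interp_cell[of j "of_int j * h" h \<psi>] by simp

lemma interp_outside:
  assumes "lattice_support K \<psi>" "h > 0" "\<bar>x\<bar> \<ge> (real K + 1) * h"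
  shows "interp h \<psi> x = 0" "\<bar>x\<bar> > (real K + 1) * h \<Longrightarrow> interp_slope h \<psi> x = 0"
proof -
  define j where "j = \<lfloor>x / h\<rfloor>"
  have j: "of_int j \<le> x / h" "x / h < of_int j + 1" by (auto simp: j_def)
  have x: "\<bar>x / h\<bar> \<ge> real K + 1" using assms by (simp add: field_simps)
  show "interp h \<psi> x = 0"
  proof -
    consider "x / h \<ge> real K + 1" | "x / h \<le> - (real K + 1)" using x by linarith
    thus ?thesis
    proof cases
      case 1
      hence "j \<ge> int K + 1" unfolding j_def by linarith
      hence "\<psi> j = 0" "\<psi> (j + 1) = 0" using assms(1) by (auto simp: lattice_support_def)
      thus ?thesis using interp_cell[of j x h \<psi>] j by simp
    next
      case 2
      hence "j \<le> - (int K + 1)" using j(1) by linarith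
      hence z: "\<psi> j = 0" using assms(1) by (auto simp: lattice_support_def)
      show ?thesis
      proof (cases "j = - (int K + 1)")
        case True
        hence "x / h = of_int j" using 2 j(1) by simp
        thus ?thesis using interp_cell[of j x h \<psi>] z by simp
      next
        case False
        hence "\<psi> (j + 1) = 0" using assms(1) \<open>j \<le> - (int K + 1)\<close> by (auto simp: lattice_support_def)
        thus ?thesis using interp_cell[of j x h \<psi>] j z by simp
      qed
    qed
  qed
  show "interp_slope h \<psi> x = 0" if "\<bar>x\<bar> > (real K + 1) * h"
  proof -
    have x: "\<bar>x / h\<bar> > real K + 1" using assms that by (simp add: field_simps)
    consider "x / h > real K + 1" | "x / h < - (real K + 1)" using x by linarith
    hence "\<psi> j = 0 \<and> \<psi> (j + 1) = 0"
    proof cases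
      case 1
      hence "j \<ge> int K + 1" unfolding j_def by linarith
      thus ?thesis using assms(1) by (auto simp: lattice_support_def)
    next
      case 2
      hence "j + 1 \<le> - (int K + 1)" using j(1) by linarith
      thus ?thesis using assms(1) by (auto simp: lattice_support_def)
    qed
    thus ?thesis by (simp add: interp_slope_def j_def)
  qed
qed

lemma interp_finite_sum:
  assumes "lattice_support K \<psi>"
  shows "interp h \<psi> x = (\<Sum>j\<in>{- int K..int K}. \<psi> j * of_real (hat (x / h - of_int j)))"
proof -
  have "interp h \<psi> x = (\<Sum>\<^sub>\<infinity>j\<in>{- int K..int K}. \<psi> j * of_real (hat (x / h - of_int j)))"
    unfolding interp_def
    by (rule infsum_cong_neutral) (use assms in \<open>auto simp: lattice_support_def\<close>)
  thus ?thesis by (simp add: infsum_finite)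
qed

lemma exp_decaying_compact_support:
  fixes f :: "real \<Rightarrow> 'a::euclidean_space"
  assumes "f \<in> borel_measurable borel" "\<And>x. norm (f x) \<le> B" "\<And>x. \<bar>x\<bar> > R \<Longrightarrow> f x = 0"
  shows "exp_decaying f"
proof (rule exp_decayingI[OF assms(1), where C="B * exp (R / 8)"])
  fix x
  have B: "B \<ge> 0" using order_trans[OF norm_ge_zero assms(2)[of 0]] .
  show "norm (f x) \<le> B * exp (R / 8) * exp (- (\<bar>x\<bar> / 8))"
  proof (cases "\<bar>x\<bar> > R")
    case True thus ?thesis using assms(3) B by simp
  next
    case False
    hence "1 \<le> exp (R / 8 - \<bar>x\<bar> / 8)" by simp
    also have "\<dots> = exp (R / 8) * exp (- (\<bar>x\<bar> / 8))" by (simp add: exp_add[symmetric])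
    finally have "B * 1 \<le> B * (exp (R / 8) * exp (- (\<bar>x\<bar> / 8)))" using B by (rule mult_left_mono)
    thus ?thesis using assms(2)[of x] by simp
  qed
qed

lemma interp_profile:
  assumes s: "lattice_support K \<psi>" and h: "h > 0"
  shows "H1_profile (interp h \<psi>) (interp_slope h \<psi>)"
  unfolding H1_profile_def
proof (intro conjI)
  have "continuous_on UNIV (\<lambda>x. \<Sum>j\<in>{- int K..int K}. \<psi> j * of_real (hat (x / h - of_int j)))"
    unfolding hat_def using h by (intro continuous_intros) auto
  thus c: "continuous_on UNIV (interp h \<psi>)"
    by (simp add: interp_finite_sum[OF s, abs_def])
  define B where "B = (\<Sum>j\<in>{- int K..int K}. cmod (\<psi> j))"
  have B: "cmod (\<psi> j) \<le> B" for j
  proof (cases "j \<in> {- int K..int K}")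
    case True thus ?thesis unfolding B_def by (intro member_le_sum) auto
  next
    case False
    hence "\<psi> j = 0" using s by (auto simp: lattice_support_def)
    thus ?thesis by (simp add: B_def sum_nonneg)
  qed
  show "exp_decaying (interp h \<psi>)"
  proof (rule exp_decaying_compact_support[where B=B and R="(real K + 1) * h"])
    show "interp h \<psi> \<in> borel_measurable borel" by (rule borel_measurable_continuous_onI[OF c])
    show "norm (interp h \<psi> x) \<le> B" for x
    proof -
      have "norm (interp h \<psi> x) \<le> (\<Sum>j\<in>{- int K..int K}. norm (\<psi> j * of_real (hat (x / h - of_int j))))"
        unfolding interp_finite_sum[OF s] by (rule norm_sum)
      also have "\<dots> \<le> B"
        unfolding B_def by (intro sum_mono) (auto simp: norm_mult hat_def intro!: mult_left_le)
      finally show ?thesis .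
    qed
  qed (use interp_outside[OF s h] in auto)
  show "exp_decaying (interp_slope h \<psi>)"
  proof (rule exp_decaying_compact_support[where B="2 * B / h" and R="(real K + 1) * h"])
    have "(\<lambda>x::real. (\<lambda>j::int. (\<psi> (j + 1) - \<psi> j) / h) \<lfloor>x / h\<rfloor>) \<in> borel_measurable borel"
      by (rule measurable_compose[where N="count_space UNIV"]) measurable
    thus "interp_slope h \<psi> \<in> borel_measurable borel" by (simp add: interp_slope_def[abs_def])
    show "norm (interp_slope h \<psi> x) \<le> 2 * B / h" for x
    proof -
      have "norm (\<psi> (\<lfloor>x / h\<rfloor> + 1) - \<psi> \<lfloor>x / h\<rfloor>) \<le> B + B"
        by (rule order_trans[OF norm_triangle_ineq4]) (intro add_mono B)
      thus ?thesis using h by (simp add: interp_slope_def norm_divide divide_right_mono)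
    qed
  qed (use interp_outside[OF s h] in auto)
  define S where "S = (\<lambda>j. of_int j * h) ` {- (int K + 1)..int K + 1}"
  show "\<exists>S. finite S \<and> (\<forall>x\<in>- S. (interp h \<psi> has_vector_derivative interp_slope h \<psi> x) (at x))"
  proof (intro exI[of _ S] conjI ballI)
    show "finite S" by (simp add: S_def)
    fix x assume x: "x \<in> - S"
    show "(interp h \<psi> has_vector_derivative interp_slope h \<psi> x) (at x)"
    proof (cases "\<bar>x\<bar> > (real K + 1) * h")
      case True
      have "((\<lambda>x. 0 :: complex) has_vector_derivative 0) (at x)" by simp
      moreover have "open {y. \<bar>y\<bar> > (real K + 1) * h}"
        by (intro open_Collect_less continuous_intros)
      ultimately have "(interp h \<psi> has_vector_derivative 0) (at x)"
        by (rule has_vector_derivative_transform_within_open) (use True interp_outside(1)[OF s h] in auto)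
      thus ?thesis using interp_outside(2)[OF s h _ True] True by simp
    next
      case False
      define j where "j = \<lfloor>x / h\<rfloor>"
      have j: "of_int j \<le> x / h" "x / h < of_int j + 1" by (auto simp: j_def)
      have "of_int j * h \<noteq> x"
      proof
        assume e: "of_int j * h = x"
        hence "\<bar>of_int j\<bar> * h \<le> (real K + 1) * h" using False h by (simp add: abs_mult flip: e)
        hence "\<bar>of_int j\<bar> \<le> real K + 1" using h by simp
        hence "j \<in> {- (int K + 1)..int K + 1}" by auto
        hence "x \<in> S" using e by (auto simp: S_def)
        thus False using x by simp
      qed
      hence jx: "of_int j * h < x" "x < (of_int j + 1) * h"
        using j h by (auto simp: field_simps)
      have "((\<lambda>y. \<psi> j + (y / h - of_int j) *\<^sub>R (\<psi> (j + 1) - \<psi> j)) has_vector_derivative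
          interp_slope h \<psi> x) (at x)"
        unfolding interp_slope_def j_def[symmetric]
        by (auto intro!: derivative_eq_intros simp: scaleR_conv_of_real)
      thus ?thesis
      proof (rule has_vector_derivative_transform_within_open)
        show "x \<in> {of_int j * h<..<(of_int j + 1) * h}" using jx by auto
        fix y assume "y \<in> {of_int j * h<..<(of_int j + 1) * h}"
        hence "of_int j \<le> y / h" "y / h \<le> of_int j + 1" using h by (auto simp: field_simps)
        thus "\<psi> j + (y / h - of_int j) *\<^sub>R (\<psi> (j + 1) - \<psi> j) = interp h \<psi> y"
          using interp_cell by (simp add: scaleR_conv_of_real)
      qed simp
    qed
  qed
qed

text \<open>The cells that meet the support of a sequence on \<open>{-K..K}\<close> start at the nodes \<open>-(K + 1), ..., K\<close>.\<close>
lemma lint_cells: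
  fixes f :: "real \<Rightarrow> real"
  assumes h: "h > 0" and cell: "\<And>j. j \<in> {- (int K + 1)..int K} \<Longrightarrow> (f has_integral I j) {of_int j * h..(of_int j + 1) * h}"
    and out: "\<And>x. \<bar>x\<bar> > (real K + 1) * h \<Longrightarrow> f x = 0" and f: "integrable lborel f"
  shows "(LINT x|lborel. f x) = (\<Sum>j\<in>{- (int K + 1)..int K}. I j)"
proof -
  let ?a = "- (int K + 1)"
  have "(f has_integral (\<Sum>j\<in>{?a..<?a + int n}. I j)) {of_int ?a * h..of_int (?a + int n) * h}"
    if "n \<le> 2 * K + 2" for n using that
  proof (induction n)
    case 0
    show ?case using has_integral_refl(2)[of f "of_int ?a * h"] by simp
  next
    case (Suc n)
    let ?j = "?a + int n"
    have "(f has_integral (\<Sum>j\<in>{?a..<?j}. I j) + I ?j) {of_int ?a * h..(of_int ?j + 1) * h}"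
    proof (rule has_integral_combine)
      show "(f has_integral (\<Sum>j\<in>{?a..<?j}. I j)) {of_int ?a * h..of_int ?j * h}"
        using Suc by simp
      show "(f has_integral I ?j) {of_int ?j * h..(of_int ?j + 1) * h}"
        using Suc.prems by (intro cell) auto
      show "of_int ?a * h \<le> of_int ?j * h" "of_int ?j * h \<le> (of_int ?j + 1) * h"
        using h by (auto intro!: mult_right_mono)
    qed
    moreover have "{?a..<?a + int (Suc n)} = insert ?j {?a..<?j}" by auto
    hence "(\<Sum>j\<in>{?a..<?a + int (Suc n)}. I j) = (\<Sum>j\<in>{?a..<?j}. I j) + I ?j" by simp
    moreover have "of_int (?a + int (Suc n)) = (of_int ?j + 1 :: real)" by simp
    ultimately show ?case by metis
  qed
  from this[of "2 * K + 2"]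
  have "(f has_integral (\<Sum>j\<in>{?a..<?a + int (2 * K + 2)}. I j)) {of_int ?a * h..of_int (?a + int (2 * K + 2)) * h}" by simp
  moreover have "{?a..<?a + int (2 * K + 2)} = {?a..int K}" by auto
  moreover have "of_int ?a * h = - ((real K + 1) * h)" "of_int (?a + int (2 * K + 2)) * h = (real K + 1) * h"
    by (simp_all add: algebra_simps)
  ultimately have "(f has_integral (\<Sum>j\<in>{?a..int K}. I j)) {- ((real K + 1) * h)..(real K + 1) * h}" by metis
  hence "(f has_integral (\<Sum>j\<in>{?a..int K}. I j)) UNIV"
    by (rule has_integral_on_superset) (use out in \<open>auto simp: abs_if not_le split: if_splits\<close>)
  thus ?thesis using has_integral_integral_lborel[OF f] has_integral_unique by blast
qed

lemma cell_polynomial_integral: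
  fixes h :: real
  assumes h: "h > 0"
  shows "((\<lambda>x. c0 + c1 * (x / h - of_int j) + c2 * (x / h - of_int j)^2 + c3 * (x / h - of_int j)^3 + c4 * (x / h - of_int j)^4)
    has_integral h * (c0 + c1 / 2 + c2 / 3 + c3 / 4 + c4 / 5)) {of_int j * h..(of_int j + 1) * h}"
proof -
  define Q where "Q x = h * (c0 * (x / h - of_int j) + c1 / 2 * (x / h - of_int j)^2 + c2 / 3 * (x / h - of_int j)^3
     + c3 / 4 * (x / h - of_int j)^4 + c4 / 5 * (x / h - of_int j)^5)" for x
  have "((\<lambda>x. c0 + c1 * (x / h - of_int j) + c2 * (x / h - of_int j)^2 + c3 * (x / h - of_int j)^3 + c4 * (x / h - of_int j)^4)
    has_integral Q ((of_int j + 1) * h) - Q (of_int j * h)) {of_int j * h..(of_int j + 1) * h}"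
  proof (rule fundamental_theorem_of_calculus)
    show "of_int j * h \<le> (of_int j + 1) * h" using h by (intro mult_right_mono) auto
    fix x
    have "(Q has_real_derivative (c0 + c1 * (x / h - of_int j) + c2 * (x / h - of_int j)^2 + c3 * (x / h - of_int j)^3 + c4 * (x / h - of_int j)^4)) (at x)"
    proof -
      let ?y = "x / h - of_int j"
      have y: "((\<lambda>x. x / h - of_int j) has_real_derivative 1 / h) (at x)"
        using h by (auto intro!: derivative_eq_intros)
      have "((\<lambda>y. h * (c0 * y + c1 / 2 * y^2 + c2 / 3 * y^3 + c3 / 4 * y^4 + c4 / 5 * y^5)) has_real_derivative
          h * (c0 + c1 * ?y + c2 * ?y^2 + c3 * ?y^3 + c4 * ?y^4)) (at ?y)"
        by (rule derivative_eq_intros refl)+ (simp add: algebra_simps)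
      from DERIV_chain2[OF this y] show ?thesis
        unfolding Q_def[abs_def] using h by simp
    qed
    thus "(Q has_vector_derivative (c0 + c1 * (x / h - of_int j) + c2 * (x / h - of_int j)^2 + c3 * (x / h - of_int j)^3 + c4 * (x / h - of_int j)^4))
        (at x within {of_int j * h..(of_int j + 1) * h})"
      by (simp add: has_real_derivative_iff_has_vector_derivative has_vector_derivative_at_within)
  qed
  moreover have "Q ((of_int j + 1) * h) - Q (of_int j * h) = h * (c0 + c1 / 2 + c2 / 3 + c3 / 4 + c4 / 5)"
    using h by (simp add: Q_def)
  ultimately show ?thesis by simp
qed

text \<open>The sums run over the left endpoints of the cells, which makes them directly comparable with the cell
integrals of the interpolant.\<close>
definition lattice_mass :: "real \<Rightarrow> nat \<Rightarrow> (int \<Rightarrow> complex) \<Rightarrow> real" where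
  "lattice_mass h K \<psi> = h * (\<Sum>j\<in>{- (int K + 1)..int K}. (cmod (\<psi> j))\<^sup>2)"

definition lattice_gradient :: "real \<Rightarrow> nat \<Rightarrow> (int \<Rightarrow> complex) \<Rightarrow> real" where
  "lattice_gradient h K \<psi> = (\<Sum>j\<in>{- (int K + 1)..int K}. (cmod (\<psi> (j + 1) - \<psi> j))\<^sup>2) / h"

definition lattice_quartic :: "real \<Rightarrow> nat \<Rightarrow> (int \<Rightarrow> complex) \<Rightarrow> real" where
  "lattice_quartic h K \<psi> = h * (\<Sum>j\<in>{- (int K + 1)..int K}. ((cmod (\<psi> j))\<^sup>2)\<^sup>2)"

lemma sum_shift_cells:
  fixes f :: "int \<Rightarrow> 'a::comm_monoid_add"
  assumes "f (- (int K + 1)) = 0" "f (int K + 1) = 0"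
  shows "(\<Sum>j\<in>{- (int K + 1)..int K}. f (j + 1)) = (\<Sum>j\<in>{- (int K + 1)..int K}. f j)"
proof -
  have "(\<Sum>j\<in>{- (int K + 1)..int K}. f (j + 1)) = (\<Sum>j\<in>{- int K..int K + 1}. f j)"
    by (rule sum.reindex_bij_witness[of _ "\<lambda>j. j - 1" "\<lambda>j. j + 1"]) auto
  also have "\<dots> = (\<Sum>j\<in>{- int K..int K}. f j)"
    by (rule sum.mono_neutral_right) (use assms in \<open>auto simp: order_le_less\<close>)
  also have "\<dots> = (\<Sum>j\<in>{- (int K + 1)..int K}. f j)"
  proof (rule sum.mono_neutral_left)
    show "\<forall>i\<in>{- (int K + 1)..int K} - {- int K..int K}. f i = 0"
    proof
      fix i assume "i \<in> {- (int K + 1)..int K} - {- int K..int K}"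
      hence "i = - (int K + 1)" by auto
      thus "f i = 0" using assms by simp
    qed
  qed auto
  finally show ?thesis .
qed

lemma cmod_interp_cell:
  assumes "of_int j \<le> x / h" "x / h \<le> of_int j + 1"
  shows "(cmod (interp h \<psi> x))\<^sup>2 = (cmod (\<psi> j))\<^sup>2 + 2 * (\<psi> j \<bullet> (\<psi> (j + 1) - \<psi> j)) * (x / h - of_int j)
     + (cmod (\<psi> (j + 1) - \<psi> j))\<^sup>2 * (x / h - of_int j)\<^sup>2"
proof -
  have "interp h \<psi> x = \<psi> j + (x / h - of_int j) *\<^sub>R (\<psi> (j + 1) - \<psi> j)"
    using interp_cell[OF assms] by (simp add: scaleR_conv_of_real)
  moreover have "(cmod (p + y *\<^sub>R d))\<^sup>2 = (cmod p)\<^sup>2 + 2 * (p \<bullet> d) * y + (cmod d)\<^sup>2 * y\<^sup>2" for p d :: complex and y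
    unfolding power2_norm_eq_inner
    by (simp add: inner_add_left inner_add_right inner_commute power2_eq_square algebra_simps)
  ultimately show ?thesis by simp
qed

lemma cmod_node_inner: "(cmod B)\<^sup>2 = (cmod A)\<^sup>2 + 2 * (A \<bullet> (B - A)) + (cmod (B - A))\<^sup>2" for A B :: complex
  by (simp add: power2_norm_eq_inner inner_diff_left inner_diff_right inner_commute)

context
  fixes h :: real and K :: nat and \<psi> :: "int \<Rightarrow> complex"
  assumes h: "h > 0" and s: "lattice_support K \<psi>"
begin

lemma boundary_values: "\<psi> (- (int K + 1)) = 0" "\<psi> (int K + 1) = 0"
  using s by (auto simp: lattice_support_def)

lemma interp_gradient: "(LINT x|lborel. (cmod (interp_slope h \<psi> x))\<^sup>2) = lattice_gradient h K \<psi>"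
proof -
  have "(LINT x|lborel. (cmod (interp_slope h \<psi> x))\<^sup>2)
     = (\<Sum>j\<in>{- (int K + 1)..int K}. (cmod (\<psi> (j + 1) - \<psi> j))\<^sup>2 / h)"
  proof (rule lint_cells[OF h])
    fix j
    have "((\<lambda>x. (cmod ((\<psi> (j + 1) - \<psi> j) / h))\<^sup>2) has_integral
        ((of_int j + 1) * h - of_int j * h) *\<^sub>R (cmod ((\<psi> (j + 1) - \<psi> j) / h))\<^sup>2) {of_int j * h..(of_int j + 1) * h}"
      using has_integral_const_real[of "(cmod ((\<psi> (j + 1) - \<psi> j) / h))\<^sup>2" "of_int j * h" "(of_int j + 1) * h"] h
      by (simp add: content_real algebra_simps)
    moreover have "((of_int j + 1) * h - of_int j * h) *\<^sub>R (cmod ((\<psi> (j + 1) - \<psi> j) / h))\<^sup>2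
        = (cmod (\<psi> (j + 1) - \<psi> j))\<^sup>2 / h"
      using h by (simp add: norm_divide power_divide power2_eq_square algebra_simps)
    ultimately have "((\<lambda>x. (cmod ((\<psi> (j + 1) - \<psi> j) / h))\<^sup>2) has_integral
        (cmod (\<psi> (j + 1) - \<psi> j))\<^sup>2 / h) {of_int j * h..(of_int j + 1) * h}" by metis
    thus "((\<lambda>x. (cmod (interp_slope h \<psi> x))\<^sup>2) has_integral
        (cmod (\<psi> (j + 1) - \<psi> j))\<^sup>2 / h) {of_int j * h..(of_int j + 1) * h}"
    proof (rule has_integral_spike_finite[of "{(of_int j + 1) * h}", rotated 2])
      fix x assume x: "x \<in> {of_int j * h..(of_int j + 1) * h} - {(of_int j + 1) * h}"
      hence "of_int j \<le> x / h" "x / h < of_int j + 1" using h by (auto simp: field_simps)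
      hence "\<lfloor>x / h\<rfloor> = j" by linarith
      thus "(cmod (interp_slope h \<psi> x))\<^sup>2 = (cmod ((\<psi> (j + 1) - \<psi> j) / h))\<^sup>2"
        by (simp add: interp_slope_def)
    qed simp
  next
    show "\<bar>x\<bar> > (real K + 1) * h \<Longrightarrow> (cmod (interp_slope h \<psi> x))\<^sup>2 = 0" for x
      using interp_outside(2)[OF s h] by simp
    show "integrable lborel (\<lambda>x. (cmod (interp_slope h \<psi> x))\<^sup>2)"
      by (intro exp_decaying_integrable exp_decaying_power2 exp_decaying_norm H1_profileD(3)[OF interp_profile[OF s h]])
  qed
  thus ?thesis by (simp add: lattice_gradient_def sum_divide_distrib)
qed

text \<open>On a cell \<open>|u|\<^sup>2\<close> is a quadratic polynomial, and the trapezoidal rule overestimates its integral by \<open>h/6\<close> times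
the squared increment.\<close>
lemma interp_mass: "mass (interp h \<psi>) = lattice_mass h K \<psi> - h\<^sup>2 / 6 * lattice_gradient h K \<psi>"
proof -
  let ?a = "\<lambda>j. (cmod (\<psi> j))\<^sup>2" and ?b = "\<lambda>j. \<psi> j \<bullet> (\<psi> (j + 1) - \<psi> j)" and ?g = "\<lambda>j. (cmod (\<psi> (j + 1) - \<psi> j))\<^sup>2"
  have "mass (interp h \<psi>) = (\<Sum>j\<in>{- (int K + 1)..int K}. h * (?a j + 2 * ?b j / 2 + ?g j / 3 + 0 / 4 + 0 / 5))"
    unfolding mass_def
  proof (rule lint_cells[OF h])
    fix j
    show "((\<lambda>x. (cmod (interp h \<psi> x))\<^sup>2) has_integral h * (?a j + 2 * ?b j / 2 + ?g j / 3 + 0 / 4 + 0 / 5))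
      {of_int j * h..(of_int j + 1) * h}"
    proof (rule has_integral_eq[OF _ cell_polynomial_integral[OF h]])
      fix x assume "x \<in> {of_int j * h..(of_int j + 1) * h}"
      hence "of_int j \<le> x / h" "x / h \<le> of_int j + 1" using h by (auto simp: field_simps)
      thus "?a j + 2 * ?b j * (x / h - of_int j) + ?g j * (x / h - of_int j)\<^sup>2 + 0 * (x / h - of_int j) ^ 3
          + 0 * (x / h - of_int j) ^ 4 = (cmod (interp h \<psi> x))\<^sup>2"
        using cmod_interp_cell by simp
    qed
  next
    show "\<bar>x\<bar> > (real K + 1) * h \<Longrightarrow> (cmod (interp h \<psi> x))\<^sup>2 = 0" for x
      using interp_outside(1)[OF s h] by simp
    show "integrable lborel (\<lambda>x. (cmod (interp h \<psi> x))\<^sup>2)"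
      by (intro exp_decaying_integrable exp_decaying_power2 exp_decaying_norm H1_profileD(2)[OF interp_profile[OF s h]])
  qed
  also have "\<dots> = (\<Sum>j\<in>{- (int K + 1)..int K}. h / 2 * ?a j + h / 2 * ?a (j + 1) - h / 6 * ?g j)"
  proof (rule sum.cong[OF refl])
    fix j
    have "h * (p + 2 * q / 2 + r / 3 + 0 / 4 + 0 / 5) = h / 2 * p + h / 2 * (p + 2 * q + r) - h / 6 * r" for p q r :: real
      by (simp add: algebra_simps)
    thus "h * (?a j + 2 * ?b j / 2 + ?g j / 3 + 0 / 4 + 0 / 5) = h / 2 * ?a j + h / 2 * ?a (j + 1) - h / 6 * ?g j"
      unfolding cmod_node_inner[of "\<psi> (j + 1)" "\<psi> j"] .
  qed
  also have "\<dots> = h / 2 * (\<Sum>j\<in>{- (int K + 1)..int K}. ?a j) + h / 2 * (\<Sum>j\<in>{- (int K + 1)..int K}. ?a (j + 1))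
      - h / 6 * (\<Sum>j\<in>{- (int K + 1)..int K}. ?g j)"
    by (simp add: sum.distrib sum_subtractf sum_distrib_left)
  also have "(\<Sum>j\<in>{- (int K + 1)..int K}. ?a (j + 1)) = (\<Sum>j\<in>{- (int K + 1)..int K}. ?a j)"
    by (rule sum_shift_cells) (use boundary_values in auto)
  finally show ?thesis using h by (simp add: lattice_mass_def lattice_gradient_def power2_eq_square)
qed

text \<open>Again the trapezoidal rule on each cell. Its error consists of terms of order at least two in
the increment, each at most a multiple of \<open>m\<close> times the squared increment.\<close>
lemma interp_quartic:
  assumes m: "\<And>j. (cmod (\<psi> j))\<^sup>2 \<le> m"
  shows "\<bar>(LINT x|lborel. ((cmod (interp h \<psi> x))\<^sup>2)\<^sup>2) - lattice_quartic h K \<psi>\<bar> \<le> 5 * h\<^sup>2 * m * lattice_gradient h K \<psi>"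
proof -
  let ?a = "\<lambda>j. (cmod (\<psi> j))\<^sup>2" and ?b = "\<lambda>j. \<psi> j \<bullet> (\<psi> (j + 1) - \<psi> j)" and ?g = "\<lambda>j. (cmod (\<psi> (j + 1) - \<psi> j))\<^sup>2"
  let ?J = "{- (int K + 1)..int K}"
  let ?I = "\<lambda>j. h * ((?a j)\<^sup>2 + 4 * ?a j * ?b j / 2 + (4 * (?b j)\<^sup>2 + 2 * ?a j * ?g j) / 3 + 4 * ?b j * ?g j / 4 + (?g j)\<^sup>2 / 5)"
  define e where "e = (\<lambda>j. 2/3 * (?b j)\<^sup>2 + 3/10 * (?g j)\<^sup>2 + ?a j * ?g j / 3 + ?b j * ?g j)"
  have "(LINT x|lborel. ((cmod (interp h \<psi> x))\<^sup>2)\<^sup>2) = (\<Sum>j\<in>?J. ?I j)"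
  proof (rule lint_cells[OF h])
    fix j
    show "((\<lambda>x. ((cmod (interp h \<psi> x))\<^sup>2)\<^sup>2) has_integral ?I j) {of_int j * h..(of_int j + 1) * h}"
    proof (rule has_integral_eq[OF _ cell_polynomial_integral[OF h]])
      fix x assume "x \<in> {of_int j * h..(of_int j + 1) * h}"
      hence "of_int j \<le> x / h" "x / h \<le> of_int j + 1" using h by (auto simp: field_simps)
      note c = cmod_interp_cell[OF this, of \<psi>]
      have "(p + 2 * q * y + r * y\<^sup>2)\<^sup>2 = p\<^sup>2 + 4 * p * q * y + (4 * q\<^sup>2 + 2 * p * r) * y\<^sup>2 + 4 * q * r * y ^ 3 + r\<^sup>2 * y ^ 4"
        for p q r y :: real by (simp add: power2_eq_square power3_eq_cube power4_eq_xxxx algebra_simps)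
      thus "(?a j)\<^sup>2 + 4 * ?a j * ?b j * (x / h - of_int j) + (4 * (?b j)\<^sup>2 + 2 * ?a j * ?g j) * (x / h - of_int j)\<^sup>2
          + 4 * ?b j * ?g j * (x / h - of_int j) ^ 3 + (?g j)\<^sup>2 * (x / h - of_int j) ^ 4 = ((cmod (interp h \<psi> x))\<^sup>2)\<^sup>2"
        unfolding c by metis
    qed
  next
    show "\<bar>x\<bar> > (real K + 1) * h \<Longrightarrow> ((cmod (interp h \<psi> x))\<^sup>2)\<^sup>2 = 0" for x
      using interp_outside(1)[OF s h] by simp
    show "integrable lborel (\<lambda>x. ((cmod (interp h \<psi> x))\<^sup>2)\<^sup>2)"
      by (intro exp_decaying_integrable exp_decaying_power2 exp_decaying_norm H1_profileD(2)[OF interp_profile[OF s h]])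
  qed
  also have "\<dots> = (\<Sum>j\<in>?J. h / 2 * (?a j)\<^sup>2 + h / 2 * (?a (j + 1))\<^sup>2 - h * e j)"
  proof (rule sum.cong[OF refl])
    fix j
    have "h * (p\<^sup>2 + 4 * p * q / 2 + (4 * q\<^sup>2 + 2 * p * r) / 3 + 4 * q * r / 4 + r\<^sup>2 / 5) =
       h / 2 * p\<^sup>2 + h / 2 * (p + 2 * q + r)\<^sup>2 - h * (2/3 * q\<^sup>2 + 3/10 * r\<^sup>2 + p * r / 3 + q * r)" for p q r :: real
      by (simp add: power2_eq_square algebra_simps add_divide_distrib diff_divide_distrib)
    thus "?I j = h / 2 * (?a j)\<^sup>2 + h / 2 * (?a (j + 1))\<^sup>2 - h * e j"
      unfolding e_def cmod_node_inner[of "\<psi> (j + 1)" "\<psi> j"] .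
  qed
  also have "\<dots> = h / 2 * (\<Sum>j\<in>?J. (?a j)\<^sup>2) + h / 2 * (\<Sum>j\<in>?J. (?a (j + 1))\<^sup>2) - h * (\<Sum>j\<in>?J. e j)"
    by (simp only: sum.distrib sum_subtractf sum_distrib_left)
  also have "(\<Sum>j\<in>?J. (?a (j + 1))\<^sup>2) = (\<Sum>j\<in>?J. (?a j)\<^sup>2)"
    by (rule sum_shift_cells) (use boundary_values in auto)
  finally have eq: "(LINT x|lborel. ((cmod (interp h \<psi> x))\<^sup>2)\<^sup>2) - lattice_quartic h K \<psi> = - (h * (\<Sum>j\<in>?J. e j))"
    by (simp add: lattice_quartic_def)
  have ebound: "\<bar>e j\<bar> \<le> 5 * m * ?g j" for j
  proof -
    have m0: "0 \<le> m" using order_trans[OF _ m[of 0]] by simp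
    define A where "A = cmod (\<psi> j)"
    define G where "G = cmod (\<psi> (j + 1) - \<psi> j)"
    have A: "A \<ge> 0" "A\<^sup>2 \<le> m" and G0: "G \<ge> 0" using m by (auto simp: A_def G_def)
    have "G \<le> A + cmod (\<psi> (j + 1))" unfolding A_def G_def by (simp add: norm_triangle_ineq4 add.commute[of "cmod (\<psi> j)"])
    hence "G\<^sup>2 \<le> (A + cmod (\<psi> (j + 1)))\<^sup>2" using G0 by (intro power_mono) auto
    also have "\<dots> \<le> 2 * A\<^sup>2 + 2 * (cmod (\<psi> (j + 1)))\<^sup>2" by (rule square_add_le)
    also have "\<dots> \<le> 4 * m" using A m[of "j + 1"] by linarith
    finally have G: "G\<^sup>2 \<le> 4 * m" .
    have b: "\<bar>?b j\<bar> \<le> A * G" unfolding A_def G_def by (rule Cauchy_Schwarz_ineq2)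
    have b2: "(?b j)\<^sup>2 \<le> m * G\<^sup>2"
    proof -
      have "(?b j)\<^sup>2 \<le> (A * G)\<^sup>2" using b A G0 by (intro abs_le_square_iff[THEN iffD1]) auto
      also have "\<dots> \<le> m * G\<^sup>2" unfolding power_mult_distrib using A by (intro mult_right_mono) auto
      finally show ?thesis .
    qed
    have AG: "A * G \<le> 2 * m"
    proof (rule power2_le_imp_le)
      have "(A * G)\<^sup>2 \<le> m * (4 * m)" unfolding power_mult_distrib using A G m0 by (intro mult_mono) auto
      thus "(A * G)\<^sup>2 \<le> (2 * m)\<^sup>2" by (simp add: power2_eq_square)
    qed (use m0 in simp)
    have "\<bar>?b j * G\<^sup>2\<bar> \<le> 2 * m * G\<^sup>2"
      unfolding abs_mult using order_trans[OF b AG] by (simp add: mult_right_mono)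
    moreover have "(G\<^sup>2)\<^sup>2 \<le> 4 * m * G\<^sup>2" unfolding power2_eq_square[of "G\<^sup>2"] using G by (intro mult_right_mono) auto
    moreover have "A\<^sup>2 * G\<^sup>2 \<le> m * G\<^sup>2" using A by (intro mult_right_mono) auto
    moreover have "0 \<le> (?b j)\<^sup>2" "0 \<le> (G\<^sup>2)\<^sup>2" "0 \<le> A\<^sup>2 * G\<^sup>2" "0 \<le> m * G\<^sup>2" using m0 by auto
    moreover have "\<bar>2/3 * u + 3/10 * v + w / 3 + z\<bar> \<le> 5 * M"
      if "\<bar>z\<bar> \<le> 2 * M" "v \<le> 4 * M" "w \<le> M" "0 \<le> u" "0 \<le> v" "0 \<le> w" "u \<le> M" for u v w z M :: real
      using that by argo
    ultimately have "\<bar>2/3 * (?b j)\<^sup>2 + 3/10 * (G\<^sup>2)\<^sup>2 + A\<^sup>2 * G\<^sup>2 / 3 + ?b j * G\<^sup>2\<bar> \<le> 5 * (m * G\<^sup>2)"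
      using b2 by (simp only: mult.assoc)
    thus ?thesis by (simp add: A_def G_def e_def)
  qed
  have "\<bar>h * (\<Sum>j\<in>?J. e j)\<bar> \<le> h * (\<Sum>j\<in>?J. 5 * m * ?g j)"
    using h order_trans[OF sum_abs[of e ?J] sum_mono[of ?J "\<lambda>j. \<bar>e j\<bar>" "\<lambda>j. 5 * m * ?g j"]] ebound
    by (simp add: abs_mult)
  also have "\<dots> = 5 * h\<^sup>2 * m * lattice_gradient h K \<psi>"
    using h by (simp add: lattice_gradient_def sum_distrib_left power2_eq_square sum_divide_distrib mult_ac)
  finally show ?thesis unfolding eq by simp
qed

end

definition lattice_energy :: "real \<Rightarrow> nat \<Rightarrow> (int \<Rightarrow> complex) \<Rightarrow> real" where
  "lattice_energy h K \<psi> = lattice_gradient h K \<psi> - lattice_quartic h K \<psi> / 2"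

text \<open>Both errors carry a factor \<open>h\<^sup>2\<close> times the gradient, which the \<open>H\<^sup>1\<close> norm controls; the node values in the
quartic error are controlled by the sup bound.\<close>
lemma interp_consistency:
  assumes h: "h > 0" and s: "lattice_support K \<psi>"
  defines "n \<equiv> H1_sq (interp h \<psi>) (interp_slope h \<psi>)"
  shows "\<bar>mass (interp h \<psi>) - lattice_mass h K \<psi>\<bar> \<le> h\<^sup>2 * n"
    "\<bar>energy (interp h \<psi>) (interp_slope h \<psi>) - (lattice_energy h K \<psi> + lattice_mass h K \<psi> / 16)\<bar> \<le> 3 * h\<^sup>2 * (n + n\<^sup>2)"
proof -
  note p = interp_profile[OF s h]
  define g where "g = lattice_gradient h K \<psi>"
  define q where "q = (LINT x|lborel. ((cmod (interp h \<psi> x))\<^sup>2)\<^sup>2)"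
  note i = exp_decaying_add exp_decaying_diff exp_decaying_power2 exp_decaying_divide exp_decaying_norm H1_profileD(2,3)[OF p]
  have g0: "0 \<le> g" unfolding g_def lattice_gradient_def using h by (intro divide_nonneg_pos sum_nonneg) auto
  have gn: "g \<le> n"
    unfolding g_def n_def interp_gradient[OF h s, symmetric] H1_sq_def by (rule lint_mono) (auto intro!: i)
  have n0: "0 \<le> n" using g0 gn by linarith
  have nm: "(cmod (\<psi> j))\<^sup>2 \<le> n" for j
    using H1_sq_sup_bound[OF p, of "of_int j * h"] interp_node[OF h] by (simp add: n_def)
  have hg: "0 \<le> h\<^sup>2 * g" "h\<^sup>2 * g \<le> h\<^sup>2 * n" using g0 gn by (auto intro: mult_left_mono)
  have m: "mass (interp h \<psi>) = lattice_mass h K \<psi> - h\<^sup>2 / 6 * g"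
    unfolding g_def by (rule interp_mass[OF h s])
  show "\<bar>mass (interp h \<psi>) - lattice_mass h K \<psi>\<bar> \<le> h\<^sup>2 * n"
    unfolding m using hg by simp
  have "\<bar>q - lattice_quartic h K \<psi>\<bar> \<le> 5 * h\<^sup>2 * n * g"
    unfolding q_def g_def by (rule interp_quartic[OF h s nm])
  also have "\<dots> \<le> 5 * (h\<^sup>2 * n\<^sup>2)"
  proof -
    have "5 * h\<^sup>2 * n * g \<le> 5 * h\<^sup>2 * n * n" using n0 by (intro mult_left_mono[OF gn]) simp
    thus ?thesis by (simp only: power2_eq_square mult.assoc)
  qed
  finally have Q: "\<bar>q - lattice_quartic h K \<psi>\<bar> \<le> 5 * (h\<^sup>2 * n\<^sup>2)" .
  have "energy (interp h \<psi>) (interp_slope h \<psi>) = g + mass (interp h \<psi>) / 16 - q / 2"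
    unfolding energy_def g_def interp_gradient[OF h s, symmetric] mass_def q_def
  proof -
    have "(LINT x|lborel. f x + m x / 16 - k x / 2) = (LINT x|lborel. f x) + (LINT x|lborel. m x) / 16 - (LINT x|lborel. k x) / 2"
      if "exp_decaying f" "exp_decaying m" "exp_decaying k" for f m k :: "real \<Rightarrow> real"
      using that by (simp add: lint_add lint_diff exp_decaying_add exp_decaying_divide)
    note comb = this
    show "(LINT x|lborel. (cmod (interp_slope h \<psi> x))\<^sup>2 + (cmod (interp h \<psi> x))\<^sup>2 / 16 - ((cmod (interp h \<psi> x))\<^sup>2)\<^sup>2 / 2) =
       (LINT x|lborel. (cmod (interp_slope h \<psi> x))\<^sup>2) + (LINT x|lborel. (cmod (interp h \<psi> x))\<^sup>2) / 16
       - (LINT x|lborel. ((cmod (interp h \<psi> x))\<^sup>2)\<^sup>2) / 2"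
      by (rule comb) (intro i)+
  qed
  hence e: "energy (interp h \<psi>) (interp_slope h \<psi>) - (lattice_energy h K \<psi> + lattice_mass h K \<psi> / 16)
     = - (h\<^sup>2 * g) / 96 - (q - lattice_quartic h K \<psi>) / 2"
    unfolding m lattice_energy_def g_def[symmetric] by argo
  have "\<bar>- a / 96 - b / 2\<bar> \<le> 3 * (c + d)" if "0 \<le> a" "a \<le> c" "\<bar>b\<bar> \<le> 5 * d" "0 \<le> d" for a b c d :: real
    using that by argo
  from this[OF hg Q] show "\<bar>energy (interp h \<psi>) (interp_slope h \<psi>) - (lattice_energy h K \<psi> + lattice_mass h K \<psi> / 16)\<bar> \<le> 3 * h\<^sup>2 * (n + n\<^sup>2)"
    unfolding e by (simp add: algebra_simps)
qed

section \<open>The lattice flow\<close>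

abbreviation second_difference :: "(int \<Rightarrow> complex) \<Rightarrow> int \<Rightarrow> complex" where
  "second_difference w l \<equiv> w (l + 1) + w (l - 1) - 2 * w l"

lemma inner_i_swap: "a \<bullet> (\<i> * b) = - (b \<bullet> (\<i> * a))" for a b :: complex
  by (simp add: inner_complex_def)

lemma inner_i_self: "a \<bullet> (\<i> * (of_real r * a)) = 0" for a :: complex
  by (simp add: inner_complex_def)

text \<open>Summation by parts turns the two neighbour terms into negatives of each other.\<close>
lemma second_difference_skew:
  assumes "lattice_support K w"
  shows "(\<Sum>l\<in>{- (int K + 1)..int K}. w l \<bullet> (\<i> * second_difference w l)) = 0"
proof -
  let ?J = "{- (int K + 1)..int K}"
  have e: "w (- (int K + 1)) = 0" "w (int K + 1) = 0" using assms by (auto simp: lattice_support_def)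
  have "(\<Sum>l\<in>?J. w l \<bullet> (\<i> * second_difference w l)) = (\<Sum>l\<in>?J. w l \<bullet> (\<i> * w (l + 1)) + w l \<bullet> (\<i> * w (l - 1)))"
  proof (rule sum.cong[OF refl])
    fix l
    have "w l \<bullet> (\<i> * second_difference w l) = w l \<bullet> (\<i> * w (l + 1)) + w l \<bullet> (\<i> * w (l - 1)) - 2 * (w l \<bullet> (\<i> * w l))"
      by (simp add: inner_complex_def algebra_simps)
    thus "w l \<bullet> (\<i> * second_difference w l) = w l \<bullet> (\<i> * w (l + 1)) + w l \<bullet> (\<i> * w (l - 1))"
      using inner_i_self[of "w l" 1] by simp
  qed
  also have "\<dots> = (\<Sum>l\<in>?J. w l \<bullet> (\<i> * w (l + 1))) + (\<Sum>l\<in>?J. w l \<bullet> (\<i> * w (l - 1)))"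
    by (rule sum.distrib)
  also have "(\<Sum>l\<in>?J. w l \<bullet> (\<i> * w (l - 1))) = (\<Sum>l\<in>?J. w (l + 1) \<bullet> (\<i> * w (l + 1 - 1)))"
    by (rule sum_shift_cells[symmetric]) (use e in auto)
  also have "\<dots> = - (\<Sum>l\<in>?J. w l \<bullet> (\<i> * w (l + 1)))"
    unfolding sum_negf[symmetric] add_diff_cancel_right' by (rule sum.cong[OF refl inner_i_swap])
  finally show ?thesis by simp
qed

lemma norm_sq_deriv:
  fixes f :: "real \<Rightarrow> complex"
  assumes "(f has_vector_derivative d) (at t within T)"
  shows "((\<lambda>t. (cmod (f t))\<^sup>2) has_real_derivative 2 * (f t \<bullet> d)) (at t within T)"
proof -
  have "((\<lambda>t. f t \<bullet> f t) has_derivative (\<lambda>x. f t \<bullet> (x *\<^sub>R d) + (x *\<^sub>R d) \<bullet> f t)) (at t within T)"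
    by (rule has_derivative_inner) (use assms in \<open>simp_all add: has_vector_derivative_def\<close>)
  moreover have "(\<lambda>x. f t \<bullet> (x *\<^sub>R d) + (x *\<^sub>R d) \<bullet> f t) = (*) (2 * (f t \<bullet> d))"
    by (auto simp: fun_eq_iff inner_commute)
  ultimately show ?thesis by (simp add: has_field_derivative_def power2_norm_eq_inner)
qed

lemma constant_if_derivative_zero:
  fixes f :: "real \<Rightarrow> real"
  assumes "\<And>t. t \<ge> 0 \<Longrightarrow> (f has_real_derivative 0) (at t within {0..})" "t \<ge> 0"
  shows "f t = f 0"
proof -
  have "\<exists>c. \<forall>t\<in>{0..}. f t = c"
    by (rule has_field_derivative_zero_constant) (use assms in auto)
  thus ?thesis using assms(2) by auto
qed

text \<open>The real coefficient \<open>c\<close> stands for \<open>|\<psi>|\<^sup>2\<close> or for a truncation of it: mass conservation only uses that it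
is real, so it is available for the truncated equation from which solutions are constructed. The derivative
\<open>d\<close> is carried along, extended by zero outside the lattice, so that summation by parts applies to it.\<close>
definition lattice_flow :: "real \<Rightarrow> nat \<Rightarrow> (real \<Rightarrow> int \<Rightarrow> real) \<Rightarrow> (real \<Rightarrow> int \<Rightarrow> complex) \<Rightarrow> (real \<Rightarrow> int \<Rightarrow> complex) \<Rightarrow> bool" where
  "lattice_flow h K c \<psi> d \<longleftrightarrow> (\<forall>t\<ge>0. lattice_support K (\<psi> t) \<and> lattice_support K (d t) \<and>
     (\<forall>l. ((\<lambda>s. \<psi> s l) has_vector_derivative d t l) (at t within {0..})) \<and>
     (\<forall>l\<in>{- int K..int K}. \<i> * d t l = - (1 / of_real (h\<^sup>2)) * second_difference (\<psi> t) l - of_real (c t l) * \<psi> t l))"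

lemma lattice_flow_velocity:
  assumes "lattice_flow h K c \<psi> d" "t \<ge> 0" "l \<in> {- int K..int K}"
  shows "d t l = (1 / h\<^sup>2) *\<^sub>R (\<i> * second_difference (\<psi> t) l) + \<i> * (of_real (c t l) * \<psi> t l)"
proof -
  have "\<i> * d t l = - (1 / of_real (h\<^sup>2)) * second_difference (\<psi> t) l - of_real (c t l) * \<psi> t l"
    using assms unfolding lattice_flow_def by blast
  moreover have "d t l = - \<i> * (\<i> * d t l)" by (simp add: mult.assoc[symmetric])
  ultimately have "d t l = - \<i> * (- (1 / of_real (h\<^sup>2)) * second_difference (\<psi> t) l - of_real (c t l) * \<psi> t l)" by argo
  thus ?thesis by (simp add: scaleR_conv_of_real algebra_simps)
qed

lemma lattice_flow_mass:
  assumes f: "lattice_flow h K c \<psi> d" and t: "t \<ge> 0"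
  shows "lattice_mass h K (\<psi> t) = lattice_mass h K (\<psi> 0)"
proof (rule constant_if_derivative_zero[OF _ t])
  fix t :: real assume t: "t \<ge> 0"
  let ?J = "{- (int K + 1)..int K}"
  have s: "lattice_support K (\<psi> t)" and D: "\<And>l. ((\<lambda>s. \<psi> s l) has_vector_derivative d t l) (at t within {0..})"
    using f t unfolding lattice_flow_def by auto
  have "\<psi> t l \<bullet> d t l = (1 / h\<^sup>2) * (\<psi> t l \<bullet> (\<i> * second_difference (\<psi> t) l))" if "l \<in> ?J" for l
  proof (cases "l \<in> {- int K..int K}")
    case True
    show ?thesis unfolding lattice_flow_velocity[OF f t True]
      by (simp only: inner_add_right inner_scaleR_right inner_i_self add_0_right)
  next
    case False
    hence "\<psi> t l = 0" using that s by (auto simp: lattice_support_def)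
    thus ?thesis by simp
  qed
  hence "(\<Sum>l\<in>?J. 2 * (\<psi> t l \<bullet> d t l)) = (\<Sum>l\<in>?J. 2 / h\<^sup>2 * (\<psi> t l \<bullet> (\<i> * second_difference (\<psi> t) l)))"
    by (intro sum.cong refl) simp
  also have "\<dots> = 0" unfolding sum_distrib_left[symmetric] second_difference_skew[OF s] by simp
  finally have z: "h * (\<Sum>l\<in>?J. 2 * (\<psi> t l \<bullet> d t l)) = 0" by simp
  have "((\<lambda>t. lattice_mass h K (\<psi> t)) has_real_derivative h * (\<Sum>l\<in>?J. 2 * (\<psi> t l \<bullet> d t l))) (at t within {0..})"
    unfolding lattice_mass_def by (intro DERIV_cmult DERIV_sum norm_sq_deriv D)
  thus "((\<lambda>t. lattice_mass h K (\<psi> t)) has_real_derivative 0) (at t within {0..})" unfolding z .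
qed

text \<open>The derivative of the energy is the pairing of \<open>d\<close> with the variational derivative, which by the equation is a
multiple of \<open>\<i> d\<close>.\<close>
lemma lattice_flow_energy:
  assumes f: "lattice_flow h K (\<lambda>t l. (cmod (\<psi> t l))\<^sup>2) \<psi> d" and h: "h > 0" and t: "t \<ge> 0"
  shows "lattice_energy h K (\<psi> t) = lattice_energy h K (\<psi> 0)"
proof (rule constant_if_derivative_zero[OF _ t])
  fix t :: real assume t: "t \<ge> 0"
  let ?J = "{- (int K + 1)..int K}"
  have s: "lattice_support K (\<psi> t)" and s': "lattice_support K (d t)"
    and D: "\<And>l. ((\<lambda>s. \<psi> s l) has_vector_derivative d t l) (at t within {0..})"
    using f t unfolding lattice_flow_def by auto
  have e: "d t (- (int K + 1)) = 0" "d t (int K + 1) = 0" using s' by (auto simp: lattice_support_def)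
  let ?G = "\<Sum>l\<in>?J. 2 * ((\<psi> t (l + 1) - \<psi> t l) \<bullet> (d t (l + 1) - d t l))"
  let ?Q = "\<Sum>l\<in>?J. 2 * (cmod (\<psi> t l))\<^sup>2 * (2 * (\<psi> t l \<bullet> d t l))"
  have "((\<lambda>t. lattice_gradient h K (\<psi> t)) has_real_derivative ?G / h) (at t within {0..})"
    unfolding lattice_gradient_def
    by (intro DERIV_cdivide DERIV_sum norm_sq_deriv has_vector_derivative_diff D)
  moreover have "((\<lambda>t. ((cmod (\<psi> t l))\<^sup>2)\<^sup>2) has_real_derivative 2 * (cmod (\<psi> t l))\<^sup>2 * (2 * (\<psi> t l \<bullet> d t l))) (at t within {0..})" for l
    using DERIV_power[OF norm_sq_deriv[OF D[of l]], of 2] by (simp add: mult_ac)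
  hence "((\<lambda>t. lattice_quartic h K (\<psi> t)) has_real_derivative h * ?Q) (at t within {0..})"
    unfolding lattice_quartic_def by (intro DERIV_cmult DERIV_sum)
  ultimately have der: "((\<lambda>t. lattice_energy h K (\<psi> t)) has_real_derivative ?G / h - h * ?Q / 2) (at t within {0..})"
    unfolding lattice_energy_def by (intro DERIV_diff DERIV_cdivide)
  have "?G = 2 * (\<Sum>l\<in>?J. (\<psi> t (l + 1) - \<psi> t (l + 1 - 1)) \<bullet> d t (l + 1)) - 2 * (\<Sum>l\<in>?J. (\<psi> t (l + 1) - \<psi> t l) \<bullet> d t l)"
    by (simp only: inner_diff_right right_diff_distrib sum_subtractf sum_distrib_left add_diff_cancel_right')
  also have "(\<Sum>l\<in>?J. (\<psi> t (l + 1) - \<psi> t (l + 1 - 1)) \<bullet> d t (l + 1)) = (\<Sum>l\<in>?J. (\<psi> t l - \<psi> t (l - 1)) \<bullet> d t l)"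
    by (rule sum_shift_cells) (use e in auto)
  also have "2 * (\<Sum>l\<in>?J. (\<psi> t l - \<psi> t (l - 1)) \<bullet> d t l) - 2 * (\<Sum>l\<in>?J. (\<psi> t (l + 1) - \<psi> t l) \<bullet> d t l)
     = - (\<Sum>l\<in>?J. 2 * (second_difference (\<psi> t) l \<bullet> d t l))"
  proof -
    have lap: "second_difference w l = (w (l + 1) - w l) - (w l - w (l - 1))" for w l by simp
    show ?thesis
      unfolding lap inner_diff_left[of "\<psi> t (_ + 1) - \<psi> t _"] right_diff_distrib sum_subtractf sum_distrib_left by simp
  qed
  finally have G: "?G = - (\<Sum>l\<in>?J. 2 * (second_difference (\<psi> t) l \<bullet> d t l))" .
  have "second_difference (\<psi> t) l \<bullet> d t l = - h\<^sup>2 * ((cmod (\<psi> t l))\<^sup>2 * (\<psi> t l \<bullet> d t l))" if "l \<in> ?J" for l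
  proof (cases "l \<in> {- int K..int K}")
    case True
    have "\<i> * d t l = - (1 / of_real (h\<^sup>2)) * second_difference (\<psi> t) l - of_real ((cmod (\<psi> t l))\<^sup>2) * \<psi> t l"
      using f t True unfolding lattice_flow_def by blast
    hence "\<i> * d t l = - (1 / h\<^sup>2) *\<^sub>R second_difference (\<psi> t) l - ((cmod (\<psi> t l))\<^sup>2) *\<^sub>R \<psi> t l"
      by (simp add: scaleR_conv_of_real)
    hence "(\<i> * d t l) \<bullet> d t l = - (1 / h\<^sup>2) * (second_difference (\<psi> t) l \<bullet> d t l) - (cmod (\<psi> t l))\<^sup>2 * (\<psi> t l \<bullet> d t l)"
      by (simp only: inner_diff_left inner_scaleR_left)
    moreover have "(\<i> * d t l) \<bullet> d t l = 0" using inner_i_self[of "d t l" 1] by (simp add: inner_commute)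
    ultimately show ?thesis using h by (simp add: field_simps)
  next
    case False
    hence "d t l = 0" using that s' by (auto simp: lattice_support_def)
    thus ?thesis by simp
  qed
  hence "(\<Sum>l\<in>?J. 2 * (second_difference (\<psi> t) l \<bullet> d t l)) = (\<Sum>l\<in>?J. - (h\<^sup>2 / 2) * (2 * (cmod (\<psi> t l))\<^sup>2 * (2 * (\<psi> t l \<bullet> d t l))))"
    by (intro sum.cong refl) simp
  also have "\<dots> = - (h\<^sup>2 / 2) * ?Q" by (rule sum_distrib_left[symmetric])
  finally have GQ: "?G = (h\<^sup>2 / 2) * ?Q" unfolding G by simp
  have zq: "h\<^sup>2 / 2 * q / h - h * q / 2 = 0" for q using h by (simp add: power2_eq_square)
  have z: "?G / h - h * ?Q / 2 = 0" unfolding GQ by (rule zq)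
  show "((\<lambda>t. lattice_energy h K (\<psi> t)) has_real_derivative 0) (at t within {0..})" using der unfolding z .
qed

lemma DNLS_solutionD:
  assumes "DNLS_solution h K \<psi>0 \<psi>"
  shows "\<psi> 0 = \<psi>0" "t \<ge> 0 \<Longrightarrow> \<bar>l\<bar> \<ge> int K + 1 \<Longrightarrow> \<psi> t l = 0"
    "t \<ge> 0 \<Longrightarrow> l \<in> {- int K..int K} \<Longrightarrow> \<exists>d.
        ((\<lambda>s. \<psi> s l) has_vector_derivative d) (at t within {0..}) \<and>
        \<i> * d = - (1 / of_real (h\<^sup>2)) * second_difference (\<psi> t) l - of_real ((cmod (\<psi> t l))\<^sup>2) * \<psi> t l"
proof -
  note D = assms[unfolded DNLS_solution_def]
  show "\<psi> 0 = \<psi>0" by (rule conjunct1[OF D])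
  show "t \<ge> 0 \<Longrightarrow> \<bar>l\<bar> \<ge> int K + 1 \<Longrightarrow> \<psi> t l = 0"
    by (rule mp[OF spec[OF mp[OF spec[OF conjunct1[OF conjunct2[OF D]]]]]])
  show "t \<ge> 0 \<Longrightarrow> l \<in> {- int K..int K} \<Longrightarrow> \<exists>d.
        ((\<lambda>s. \<psi> s l) has_vector_derivative d) (at t within {0..}) \<and>
        \<i> * d = - (1 / of_real (h\<^sup>2)) * second_difference (\<psi> t) l - of_real ((cmod (\<psi> t l))\<^sup>2) * \<psi> t l"
    by (rule bspec[OF mp[OF spec[OF conjunct2[OF conjunct2[OF D]]]]])
qed

lemma DNLS_solution_flow:
  assumes "DNLS_solution h K \<psi>0 \<psi>"
  shows "\<exists>d. lattice_flow h K (\<lambda>t l. (cmod (\<psi> t l))\<^sup>2) \<psi> d"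
proof -
  have sup: "\<psi> t l = 0" if "t \<ge> 0" "\<bar>l\<bar> \<ge> int K + 1" for t l
    by (rule DNLS_solutionD(2)[OF assms that])
  let ?P = "\<lambda>t l d. ((\<lambda>s. \<psi> s l) has_vector_derivative d) (at t within {0..}) \<and>
         \<i> * d = - (1 / of_real (h\<^sup>2)) * (\<psi> t (l + 1) + \<psi> t (l - 1) - 2 * \<psi> t l)
                - of_real ((cmod (\<psi> t l))\<^sup>2) * \<psi> t l"
  define e where "e t l = (SOME d. ?P t l d)" for t l
  have e: "?P t l (e t l)" if "t \<ge> 0" "l \<in> {- int K..int K}" for t l
  proof -
    have "\<exists>d. ?P t l d" by (rule DNLS_solutionD(3)[OF assms that])
    thus ?thesis unfolding e_def by (rule someI_ex)
  qed
  define d where "d t l = (if l \<in> {- int K..int K} then e t l else 0)" for t l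
  have "((\<lambda>s. \<psi> s l) has_vector_derivative d t l) (at t within {0..})" if t: "t \<ge> 0" for t l
  proof (cases "l \<in> {- int K..int K}")
    case True thus ?thesis using e[OF t True] by (simp add: d_def)
  next
    case False
    hence z: "\<psi> s l = 0" if "s \<ge> 0" for s using sup[OF that, of l] by auto
    have "((\<lambda>s. 0 :: complex) has_vector_derivative 0) (at t within {0..})" by simp
    hence "((\<lambda>s. \<psi> s l) has_vector_derivative 0) (at t within {0..})"
      by (rule has_vector_derivative_transform[rotated 2]) (use t z in auto)
    thus ?thesis unfolding d_def if_not_P[OF False] .
  qed
  moreover have "\<i> * d t l = - (1 / of_real (h\<^sup>2)) * second_difference (\<psi> t) l - of_real ((cmod (\<psi> t l))\<^sup>2) * \<psi> t l"
    if "t \<ge> 0" "l \<in> {- int K..int K}" for t l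
    using e[OF that] that(2) by (simp add: d_def)
  moreover have "lattice_support K (d t)" for t by (auto simp: lattice_support_def d_def)
  moreover have "lattice_support K (\<psi> t)" if "t \<ge> 0" for t using sup[OF that] by (auto simp: lattice_support_def)
  ultimately have "lattice_flow h K (\<lambda>t l. (cmod (\<psi> t l))\<^sup>2) \<psi> d" unfolding lattice_flow_def by blast
  thus ?thesis by blast
qed

lemma cubic_Lipschitz:
  fixes z w :: complex
  assumes "cmod z \<le> B" "cmod w \<le> B"
  shows "cmod (of_real ((cmod z)\<^sup>2) * z - of_real ((cmod w)\<^sup>2) * w) \<le> 3 * B\<^sup>2 * cmod (z - w)"
proof -
  have B0: "B \<ge> 0" using order_trans[OF norm_ge_zero assms(1)] .
  have eq: "of_real ((cmod z)\<^sup>2) * z - of_real ((cmod w)\<^sup>2) * w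
     = of_real ((cmod z)\<^sup>2) * (z - w) + of_real ((cmod z)\<^sup>2 - (cmod w)\<^sup>2) * w" by (simp add: algebra_simps)
  have 1: "(cmod z)\<^sup>2 * cmod (z - w) \<le> B\<^sup>2 * cmod (z - w)"
    using assms by (intro mult_right_mono power_mono) auto
  have "\<bar>(cmod z)\<^sup>2 - (cmod w)\<^sup>2\<bar> = (cmod z + cmod w) * \<bar>cmod z - cmod w\<bar>"
    by (simp add: power2_eq_square square_diff_square_factored abs_mult)
  also have "\<dots> \<le> (B + B) * cmod (z - w)"
    using assms norm_triangle_ineq3[of z w] B0 by (intro mult_mono add_mono) auto
  finally have "\<bar>(cmod z)\<^sup>2 - (cmod w)\<^sup>2\<bar> * cmod w \<le> ((B + B) * cmod (z - w)) * B"
    using assms B0 by (intro mult_mono) auto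
  hence 2: "\<bar>(cmod z)\<^sup>2 - (cmod w)\<^sup>2\<bar> * cmod w \<le> 2 * B\<^sup>2 * cmod (z - w)" by (simp add: power2_eq_square algebra_simps)
  have "cmod (of_real ((cmod z)\<^sup>2) * z - of_real ((cmod w)\<^sup>2) * w)
     \<le> (cmod z)\<^sup>2 * cmod (z - w) + \<bar>(cmod z)\<^sup>2 - (cmod w)\<^sup>2\<bar> * cmod w"
    unfolding eq by (rule order_trans[OF norm_triangle_ineq])
      (simp only: norm_mult norm_of_real abs_power2 power2_abs abs_norm_cancel order_refl)
  thus ?thesis using 1 2 by (simp add: algebra_simps)
qed

lemma lattice_mass_bound:
  assumes "h > 0" "lattice_support K \<psi>"
  shows "(cmod (\<psi> l))\<^sup>2 \<le> lattice_mass h K \<psi> / h"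
proof (cases "l \<in> {- (int K + 1)..int K}")
  case True
  hence "(cmod (\<psi> l))\<^sup>2 \<le> (\<Sum>j\<in>{- (int K + 1)..int K}. (cmod (\<psi> j))\<^sup>2)" by (intro member_le_sum) auto
  thus ?thesis using assms(1) by (simp add: lattice_mass_def)
next
  case False
  hence "\<psi> l = 0" using assms(2) by (auto simp: lattice_support_def)
  thus ?thesis using assms(1) by (simp add: lattice_mass_def sum_nonneg)
qed

text \<open>Mass conservation bounds both solutions, on bounded sets the cubic term is Lipschitz, and the linear part drops
out of the derivative of the squared difference. Gronwall's inequality gives the claim.\<close>
lemma DNLS_unique:
  assumes h: "h > 0" and \<psi>: "DNLS_solution h K \<psi>0 \<psi>" and \<xi>: "DNLS_solution h K \<psi>0 \<xi>" and t: "t \<ge> 0"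
  shows "\<psi> t = \<xi> t"
proof -
  let ?J = "{- (int K + 1)..int K}"
  obtain d where d: "lattice_flow h K (\<lambda>t l. (cmod (\<psi> t l))\<^sup>2) \<psi> d" using DNLS_solution_flow[OF \<psi>] by blast
  obtain e where e: "lattice_flow h K (\<lambda>t l. (cmod (\<xi> t l))\<^sup>2) \<xi> e" using DNLS_solution_flow[OF \<xi>] by blast
  have init: "\<psi> 0 = \<psi>0" "\<xi> 0 = \<psi>0" by (rule DNLS_solutionD(1)[OF \<psi>], rule DNLS_solutionD(1)[OF \<xi>])
  define B where "B = sqrt (lattice_mass h K \<psi>0 / h)"
  have bd: "cmod (\<psi> t l) \<le> B" "cmod (\<xi> t l) \<le> B" if "t \<ge> 0" for t l
  proof -
    have "lattice_support K (\<psi> t)" "lattice_support K (\<xi> t)" using d e that unfolding lattice_flow_def by auto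
    from lattice_mass_bound[OF h this(1), of l] lattice_mass_bound[OF h this(2), of l]
    show "cmod (\<psi> t l) \<le> B" "cmod (\<xi> t l) \<le> B"
      unfolding B_def using lattice_flow_mass[OF d that] lattice_flow_mass[OF e that] init
      by (auto intro: real_le_rsqrt)
  qed
  define w where "w t l = \<psi> t l - \<xi> t l" for t l
  define W where "W t = (\<Sum>l\<in>?J. (cmod (w t l))\<^sup>2)" for t
  define M where "M = 6 * B\<^sup>2"
  have arith: "2 * X \<le> 2 / h\<^sup>2 * Y + M * n\<^sup>2"
    if "X = 1 / h\<^sup>2 * Y + Z" "Z \<le> R" "R \<le> n * (3 * B\<^sup>2 * n)" for X Y Z R n :: real
  proof -
    have "n * (3 * B\<^sup>2 * n) = 3 * (B\<^sup>2 * n\<^sup>2)" by (simp add: power2_eq_square)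
    hence "Z \<le> 3 * (B\<^sup>2 * n\<^sup>2)" using that(2,3) by linarith
    thus ?thesis using that(1) by (simp add: M_def)
  qed
  have key: "\<exists>D. (W has_real_derivative D) (at t within {0..}) \<and> D \<le> M * W t" if t: "t \<ge> 0" for t
  proof (intro exI conjI)
    have s: "lattice_support K (w t)"
      and D: "\<And>l. ((\<lambda>s. w s l) has_vector_derivative d t l - e t l) (at t within {0..})"
      using d e t unfolding lattice_flow_def w_def by (auto simp: lattice_support_def intro!: has_vector_derivative_diff)
    show "(W has_real_derivative (\<Sum>l\<in>?J. 2 * (w t l \<bullet> (d t l - e t l)))) (at t within {0..})"
      unfolding W_def by (intro DERIV_sum norm_sq_deriv D)
    have "2 * (w t l \<bullet> (d t l - e t l)) \<le> 2 / h\<^sup>2 * (w t l \<bullet> (\<i> * second_difference (w t) l)) + M * (cmod (w t l))\<^sup>2" if "l \<in> ?J" for l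
    proof (cases "l \<in> {- int K..int K}")
      case True
      let ?c = "of_real ((cmod (\<psi> t l))\<^sup>2) * \<psi> t l - of_real ((cmod (\<xi> t l))\<^sup>2) * \<xi> t l"
      have "d t l - e t l = (1 / h\<^sup>2) *\<^sub>R (\<i> * second_difference (w t) l) + \<i> * ?c"
        unfolding lattice_flow_velocity[OF d t True] lattice_flow_velocity[OF e t True] w_def
        by (simp add: algebra_simps scaleR_conv_of_real)
      hence "w t l \<bullet> (d t l - e t l) = (1 / h\<^sup>2) * (w t l \<bullet> (\<i> * second_difference (w t) l)) + w t l \<bullet> (\<i> * ?c)"
        by (simp only: inner_add_right inner_scaleR_right)
      moreover have "w t l \<bullet> (\<i> * ?c) \<le> cmod (w t l) * cmod (\<i> * ?c)" by (rule norm_cauchy_schwarz)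
      moreover have "cmod (w t l) * cmod (\<i> * ?c) \<le> cmod (w t l) * (3 * B\<^sup>2 * cmod (w t l))"
        unfolding w_def norm_mult using cubic_Lipschitz[OF bd[OF t, of l]] by (intro mult_left_mono) auto
      ultimately show ?thesis by (rule arith)
    next
      case False
      hence "w t l = 0" using that s by (auto simp: lattice_support_def)
      thus ?thesis by simp
    qed
    hence "(\<Sum>l\<in>?J. 2 * (w t l \<bullet> (d t l - e t l))) \<le> (\<Sum>l\<in>?J. 2 / h\<^sup>2 * (w t l \<bullet> (\<i> * second_difference (w t) l)) + M * (cmod (w t l))\<^sup>2)"
      by (intro sum_mono) auto
    also have "\<dots> = 2 / h\<^sup>2 * (\<Sum>l\<in>?J. w t l \<bullet> (\<i> * second_difference (w t) l)) + M * W t"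
      unfolding W_def sum.distrib sum_distrib_left ..
    also have "\<dots> = M * W t" unfolding second_difference_skew[OF s] by simp
    finally show "(\<Sum>l\<in>?J. 2 * (w t l \<bullet> (d t l - e t l))) \<le> M * W t" .
  qed
  have "W t \<le> 0"
  proof (cases "t = 0")
    case True
    thus ?thesis by (simp add: W_def w_def init)
  next
    case False
    with t have t0: "0 < t" by simp
    define D where "D s = (SOME D. (W has_real_derivative D) (at s within {0..}) \<and> D \<le> M * W s)" for s
    have D: "(W has_real_derivative D s) (at s within {0..}) \<and> D s \<le> M * W s" if "s \<ge> 0" for s
      unfolding D_def by (rule someI_ex[OF key[OF that]])
    \<comment> \<open>Gronwall: this function is nonincreasing.\<close>
    let ?F = "\<lambda>s. exp (- (M * s)) * W s"
    have F: "(?F has_derivative (*) (exp (- (M * s)) * (D s - M * W s))) (at s within {0..t})" if "0 \<le> s" "s \<le> t" for s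
    proof -
      have "(W has_real_derivative D s) (at s within {0..t})"
        using D[OF that(1)] by (auto intro: DERIV_subset)
      hence "(?F has_real_derivative exp (- (M * s)) * (D s - M * W s)) (at s within {0..t})"
        by (auto intro!: derivative_eq_intros simp: algebra_simps)
      thus ?thesis by (simp add: has_field_derivative_def)
    qed
    from mvt_simple[OF t0 F] obtain s where s: "s \<in> {0<..<t}" "?F t - ?F 0 = exp (- (M * s)) * (D s - M * W s) * (t - 0)"
      by blast
    have "exp (- (M * s)) * (D s - M * W s) * t \<le> 0"
      using D[of s] s(1) by (intro mult_nonpos_nonneg mult_nonneg_nonpos) auto
    hence "?F t \<le> ?F 0" using s(2) by simp
    moreover have "W 0 = 0" by (simp add: W_def w_def init)
    ultimately have "exp (- (M * t)) * W t \<le> 0" by simp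
    thus ?thesis by (simp add: mult_le_0_iff)
  qed
  hence W0: "(\<Sum>l\<in>?J. (cmod (w t l))\<^sup>2) = 0" unfolding W_def by (intro antisym sum_nonneg) auto
  have "w t l = 0" for l
  proof (cases "l \<in> ?J")
    case True
    with W0 show ?thesis by (subst (asm) sum_nonneg_eq_0_iff) auto
  next
    case False
    hence "\<psi> t l = 0" "\<xi> t l = 0" using d e t unfolding lattice_flow_def lattice_support_def by auto
    thus ?thesis by (simp add: w_def)
  qed
  thus ?thesis by (simp add: w_def fun_eq_iff)
qed

text \<open>The reflected sequence solves the same initial value problem.\<close>
lemma DNLS_even:
  assumes h: "h > 0" and \<psi>: "DNLS_solution h K \<psi>0 \<psi>" and ev: "\<And>j. \<psi>0 (- j) = \<psi>0 j" and t: "t \<ge> 0"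
  shows "\<psi> t (- j) = \<psi> t j"
proof -
  define \<xi> where "\<xi> t j = \<psi> t (- j)" for t j
  have "DNLS_solution h K \<psi>0 \<xi>"
    unfolding DNLS_solution_def
  proof (intro conjI allI impI ballI)
    note DNLS_solutionD(1)[OF \<psi>]
    thus "\<xi> 0 = \<psi>0" by (simp add: \<xi>_def fun_eq_iff ev)
  next
    fix t :: real and l :: int assume "0 \<le> t" "int K + 1 \<le> \<bar>l\<bar>"
    thus "\<xi> t l = 0" unfolding \<xi>_def by (intro DNLS_solutionD(2)[OF \<psi>]) auto
  next
    fix t :: real and l :: int assume t: "0 \<le> t" and l: "l \<in> {- int K..int K}"
    hence ml: "- l \<in> {- int K..int K}" by auto
    let ?P = "\<lambda>d. ((\<lambda>s. \<psi> s (- l)) has_vector_derivative d) (at t within {0..}) \<and>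
      \<i> * d = - (1 / of_real (h\<^sup>2)) * (\<psi> t (- l + 1) + \<psi> t (- l - 1) - 2 * \<psi> t (- l))
                - of_real ((cmod (\<psi> t (- l)))\<^sup>2) * \<psi> t (- l)"
    have ex: "\<exists>d. ?P d" by (rule DNLS_solutionD(3)[OF \<psi> t ml])
    obtain d where d: "?P d" using ex by (rule exE)
    have x: "\<xi> t (l + 1) + \<xi> t (l - 1) - 2 * \<xi> t l = \<psi> t (- l + 1) + \<psi> t (- l - 1) - 2 * \<psi> t (- l)"
    proof -
      have "- (l + 1) = - l - 1" "- (l - 1) = - l + 1" by auto
      thus ?thesis unfolding \<xi>_def by (simp only: add.commute[of "\<psi> t (- l - 1)"])
    qed
    show "\<exists>d. ((\<lambda>s. \<xi> s l) has_vector_derivative d) (at t within {0..}) \<and>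
         \<i> * d = - (1 / of_real (h\<^sup>2)) * (\<xi> t (l + 1) + \<xi> t (l - 1) - 2 * \<xi> t l)
                - of_real ((cmod (\<xi> t l))\<^sup>2) * \<xi> t l"
      unfolding x unfolding \<xi>_def by (rule exI[of _ d]) (rule d)
  qed
  from DNLS_unique[OF h \<psi> this t] show ?thesis by (simp add: \<xi>_def fun_eq_iff)
qed

section \<open>Existence of solutions\<close>

lemma integral_from_0_derivative:
  fixes g :: "real \<Rightarrow> 'a::banach"
  assumes g: "continuous_on {0..} g" and t: "t \<ge> 0"
  shows "((\<lambda>u. integral {0..u} g) has_vector_derivative g t) (at t within {0..})"
proof -
  have "((\<lambda>u. integral {0..u} g) has_vector_derivative g t) (at t within {0..t + 1})"
    by (rule integral_has_vector_derivative) (use t in \<open>auto intro: continuous_on_subset[OF g]\<close>)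
  moreover have "at t within {0..t + 1} = at t within {0..}"
    by (rule at_within_nhd[where S = "{t - 1<..<t + 1}"]) auto
  ultimately show ?thesis by simp
qed

lemma integral_affine_exp_bound:
  fixes g :: "real \<Rightarrow> 'a::banach"
  assumes g: "continuous_on {0..t} g" and t: "t \<ge> 0" and l: "l > 0"
    and b: "\<And>s. 0 \<le> s \<Longrightarrow> s \<le> t \<Longrightarrow> norm (g s) \<le> A + B * exp (l * s)"
  shows "norm (integral {0..t} g) \<le> A * t + B / l * (exp (l * t) - 1)"
proof -
  have i: "((\<lambda>s. A + B * exp (l * s)) has_integral (A * t + B / l * exp (l * t)) - (A * 0 + B / l * exp (l * 0))) {0..t}"
    by (rule fundamental_theorem_of_calculus[OF t])
       (use l in \<open>auto intro!: derivative_eq_intros simp flip: has_real_derivative_iff_has_vector_derivative\<close>)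
  have "norm (integral {0..t} g) \<le> integral {0..t} (\<lambda>s. A + B * exp (l * s))"
    by (rule integral_norm_bound_integral[OF integrable_continuous_real[OF g] has_integral_integrable[OF i]])
       (use b in auto)
  also have "\<dots> = A * t + B / l * (exp (l * t) - 1)"
    using integral_unique[OF i] by (simp add: algebra_simps)
  finally show ?thesis .
qed

text \<open>The unknown of the fixed point equation is \<open>y(t) = exp(-2 L t) x(t)\<close>. In the sup norm of \<open>y\<close> the integral
operator contracts by \<open>1/2\<close> on the whole half-line, so that no continuation argument is required.\<close>
lemma global_Picard_Lindelof:
  fixes f :: "'a::banach \<Rightarrow> 'a"
  assumes L: "L > 0" and f: "\<And>x y. norm (f x - f y) \<le> L * norm (x - y)"
  shows "\<exists>x. x 0 = x0 \<and> (\<forall>t\<ge>0. (x has_vector_derivative f (x t)) (at t within {0..}))"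
proof -
  define l where "l = 2 * L"
  have l: "l > 0" using L by (simp add: l_def)
  have fc: "continuous_on UNIV f"
  proof (rule continuous_onI)
    fix x :: 'a and e :: real assume e: "e > 0"
    have "dist (f y) (f x) \<le> e" if "dist y x < e / L" for y
      using f[of y x] that L by (simp add: dist_norm field_simps)
    thus "\<exists>d>0. \<forall>x'\<in>UNIV. dist x' x < d \<longrightarrow> dist (f x') (f x) \<le> e"
      using e L by (intro exI[of _ "e / L"]) auto
  qed
  define g :: "(real \<Rightarrow>\<^sub>C 'a) \<Rightarrow> real \<Rightarrow> 'a" where "g y s = f (exp (l * s) *\<^sub>R y s)" for y s
  have gc: "continuous_on S (g y)" for y S
    unfolding g_def[abs_def]
    by (rule continuous_on_compose2[OF fc]) (auto intro!: continuous_intros)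
  \<comment> \<open>The maximum extends functions on the half-line by constants to the real line.\<close>
  define P :: "(real \<Rightarrow>\<^sub>C 'a) \<Rightarrow> real \<Rightarrow> 'a" where
    "P y t = exp (- (l * max 0 t)) *\<^sub>R (x0 + integral {0..max 0 t} (g y))" for y t
  have Pc: "continuous_on UNIV (P y)" for y
  proof -
    have "continuous_on {0..} (\<lambda>u. integral {0..u} (g y))"
      unfolding continuous_on_eq_continuous_within
    proof
      fix t :: real assume "t \<in> {0..}"
      thus "continuous (at t within {0..}) (\<lambda>u. integral {0..u} (g y))"
        by (intro has_vector_derivative_continuous[OF integral_from_0_derivative[OF gc]]) simp
    qed
    hence "continuous_on UNIV (\<lambda>t. integral {0..max 0 t} (g y))"
      by (rule continuous_on_compose2) (auto intro!: continuous_intros)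
    thus ?thesis unfolding P_def[abs_def] by (intro continuous_intros)
  qed
  have gn: "norm (g y s) \<le> norm (f 0) + (L * norm y) * exp (l * s)" for y s
  proof -
    have "norm (g y s) \<le> norm (f 0) + norm (g y s - f 0)" by (rule norm_triangle_sub)
    also have "norm (g y s - f 0) \<le> L * norm (exp (l * s) *\<^sub>R y s - 0)" unfolding g_def by (rule f)
    also have "\<dots> \<le> L * (exp (l * s) * norm y)" using L norm_bounded[of y s] by simp
    finally show ?thesis by (simp add: mult_ac)
  qed
  have gd: "norm (g y s - g z s) \<le> 0 + (L * norm (y - z)) * exp (l * s)" for y z s
  proof -
    have "norm (g y s - g z s) \<le> L * norm (exp (l * s) *\<^sub>R y s - exp (l * s) *\<^sub>R z s)" unfolding g_def by (rule f)
    also have "\<dots> = L * (exp (l * s) * norm ((y - z) s))" by (simp flip: scaleR_diff_right)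
    also have "\<dots> \<le> L * (exp (l * s) * norm (y - z))" using L norm_bounded[of "y - z" s] by simp
    finally show ?thesis by (simp add: mult_ac)
  qed
  have Pb: "P y \<in> bcontfun" for y
  proof (rule bcontfun_normI[OF Pc])
    fix t :: real
    define u where "u = max 0 t"
    have u: "u \<ge> 0" by (simp add: u_def)
    have e1: "exp (- (l * u)) \<le> 1" using u l by simp
    have e2: "u * exp (- (l * u)) \<le> 1 / l"
    proof -
      have "l * u \<le> exp (l * u)" using exp_ge_add_one_self[of "l * u"] by linarith
      thus ?thesis using l by (simp add: exp_minus field_simps)
    qed
    have "norm (integral {0..u} (g y)) \<le> norm (f 0) * u + L * norm y / l * (exp (l * u) - 1)"
      by (rule integral_affine_exp_bound[OF gc u l gn])
    hence "norm (P y t) \<le> exp (- (l * u)) * (norm x0 + (norm (f 0) * u + L * norm y / l * (exp (l * u) - 1)))"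
      unfolding P_def u_def[symmetric] norm_scaleR
      by (simp add: norm_triangle_le)
    also have "\<dots> = norm x0 * exp (- (l * u)) + norm (f 0) * (u * exp (- (l * u))) + norm y / 2 * (1 - exp (- (l * u)))"
      using L by (simp add: l_def algebra_simps exp_minus)
    also have "\<dots> \<le> norm x0 * 1 + norm (f 0) * (1 / l) + norm y / 2 * 1"
      using e1 e2 by (intro add_mono mult_left_mono) auto
    finally show "norm (P y t) \<le> norm x0 * 1 + norm (f 0) * (1 / l) + norm y / 2 * 1" .
  qed
  define \<Phi> where "\<Phi> y = Bcontfun (P y)" for y
  have \<Phi>: "\<Phi> y t = P y t" for y t by (simp add: \<Phi>_def Bcontfun_inverse[OF Pb])
  have "\<exists>!y. \<Phi> y = y"
  proof (rule banach_fix_type)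
    show "(0::real) \<le> 1/2" "(1/2::real) < 1" by auto
    show "\<forall>y z. dist (\<Phi> y) (\<Phi> z) \<le> 1/2 * dist y z"
    proof (intro allI)
      fix y z
      show "dist (\<Phi> y) (\<Phi> z) \<le> 1/2 * dist y z"
      proof (rule dist_bound)
        fix t :: real
        define u where "u = max 0 t"
        have u: "u \<ge> 0" by (simp add: u_def)
        have "\<Phi> y t - \<Phi> z t = exp (- (l * u)) *\<^sub>R (integral {0..u} (g y) - integral {0..u} (g z))"
          unfolding \<Phi> P_def u_def[symmetric] by (simp add: algebra_simps)
        also have "integral {0..u} (g y) - integral {0..u} (g z) = integral {0..u} (\<lambda>s. g y s - g z s)"
          by (rule integral_diff[symmetric]) (intro integrable_continuous_real gc)+
        finally have "dist (\<Phi> y t) (\<Phi> z t) = exp (- (l * u)) * norm (integral {0..u} (\<lambda>s. g y s - g z s))"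
          by (simp add: dist_norm)
        also have "\<dots> \<le> exp (- (l * u)) * (0 * u + L * norm (y - z) / l * (exp (l * u) - 1))"
          by (intro mult_left_mono integral_affine_exp_bound[OF _ u l gd] continuous_on_diff gc) auto
        also have "\<dots> = norm (y - z) / 2 * (1 - exp (- (l * u)))"
          using L by (simp add: l_def algebra_simps exp_minus)
        also have "\<dots> \<le> norm (y - z) / 2 * 1" by (intro mult_left_mono) auto
        finally show "dist (\<Phi> y t) (\<Phi> z t) \<le> 1/2 * dist y z" by (simp add: dist_norm)
      qed
    qed
  qed
  then obtain y where y: "\<Phi> y = y" by blast
  define x where "x t = exp (l * t) *\<^sub>R y t" for t
  have xi: "x t = x0 + integral {0..t} (\<lambda>s. f (x s))" if "t \<ge> 0" for t
  proof -
    have "y t = P y t" using \<Phi>[of y t] y by simp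
    hence "x t = (exp (l * t) * exp (- (l * t))) *\<^sub>R (x0 + integral {0..t} (g y))"
      using that by (simp add: x_def P_def)
    also have "exp (l * t) * exp (- (l * t)) = 1" by (simp flip: exp_add)
    finally show ?thesis by (simp add: g_def[abs_def] x_def)
  qed
  have xc: "continuous_on {0..} (\<lambda>s. f (x s))"
    using gc[of "{0..}" y] by (simp add: g_def[abs_def] x_def)
  show ?thesis
  proof (intro exI[of _ x] conjI allI impI)
    show "x 0 = x0" using xi[of 0] by simp
    fix t :: real assume t: "t \<ge> 0"
    have "((\<lambda>u. x0 + integral {0..u} (\<lambda>s. f (x s))) has_vector_derivative 0 + f (x t)) (at t within {0..})"
      by (intro has_vector_derivative_add has_vector_derivative_const integral_from_0_derivative xc t)
    thus "(x has_vector_derivative f (x t)) (at t within {0..})"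
      using has_vector_derivative_transform[of t "{0..}" x] xi t by simp
  qed
qed

text \<open>The state space of the construction below.\<close>
instance bcontfun :: (metric_space, banach) banach ..

text \<open>The modulus is truncated but not the phase, so the truncated equation still conserves mass.\<close>
definition cut_cubic :: "real \<Rightarrow> complex \<Rightarrow> complex" where
  "cut_cubic R z = of_real ((min (cmod z) R)\<^sup>2) * z"

lemma cut_cubic_Lipschitz:
  assumes R: "R \<ge> 0"
  shows "cmod (cut_cubic R z - cut_cubic R w) \<le> 3 * R\<^sup>2 * cmod (z - w)"
proof -
  have main: "cmod (cut_cubic R z - cut_cubic R w) \<le> 3 * R\<^sup>2 * cmod (z - w)" if le: "cmod w \<le> cmod z" for z w
  proof -
    define m where "m = min (cmod z) R"
    define n where "n = min (cmod w) R"
    have mn: "0 \<le> m" "m \<le> R" "0 \<le> n" "n \<le> R" "n \<le> m" using R le by (auto simp: m_def n_def)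
    have eq: "cut_cubic R z - cut_cubic R w = of_real (m\<^sup>2) * (z - w) + of_real (m\<^sup>2 - n\<^sup>2) * w"
      by (simp add: cut_cubic_def m_def n_def algebra_simps)
    have 1: "m\<^sup>2 * cmod (z - w) \<le> R\<^sup>2 * cmod (z - w)" using mn by (intro mult_right_mono power_mono) auto
    have mm: "m - n \<le> cmod (z - w)" using norm_triangle_ineq2[of z w] le by (auto simp: m_def n_def)
    have 2: "(m\<^sup>2 - n\<^sup>2) * cmod w \<le> 2 * R\<^sup>2 * cmod (z - w)"
    proof (cases "cmod w \<ge> R")
      case True
      hence "m = n" using le by (simp add: m_def n_def)
      thus ?thesis by simp
    next
      case False
      have "m\<^sup>2 - n\<^sup>2 = (m + n) * (m - n)" by (simp add: power2_eq_square algebra_simps)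
      also have "\<dots> \<le> (R + R) * cmod (z - w)" using mn mm R by (intro mult_mono add_mono) auto
      finally have "(m\<^sup>2 - n\<^sup>2) * cmod w \<le> ((R + R) * cmod (z - w)) * R"
        using False R by (intro mult_mono) auto
      thus ?thesis by (simp add: power2_eq_square algebra_simps)
    qed
    have "0 \<le> m\<^sup>2 - n\<^sup>2" using mn by (simp add: power_mono)
    hence "cmod (cut_cubic R z - cut_cubic R w) \<le> m\<^sup>2 * cmod (z - w) + (m\<^sup>2 - n\<^sup>2) * cmod w"
      unfolding eq by (rule_tac order_trans[OF norm_triangle_ineq]) (simp only: norm_mult norm_of_real abs_of_nonneg abs_power2 order_refl)
    thus ?thesis using 1 2 by linarith
  qed
  show ?thesis using main[of w z] main[of z w] by (cases "cmod w \<le> cmod z") (auto simp: norm_minus_commute)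
qed

text \<open>The equation with the cubic term truncated at \<open>R\<close> is globally Lipschitz, and mass conservation shows that its
solution never exceeds \<open>R\<close>. As a fixed Banach space for every \<open>K\<close> serve the bounded continuous functions of
a real variable: there the neighbours are the translates by \<open>1\<close> and \<open>-1\<close>, a continuous cutoff equal to \<open>1\<close> at the
integers in \<open>{-K..K}\<close> and \<open>0\<close> at the others switches the vector field off, and the lattice solution is read
off at the integers.\<close>
lemma DNLS_exists:
  assumes h: "h > 0" and s0: "lattice_support K \<psi>0"
  shows "\<exists>\<psi>. DNLS_solution h K \<psi>0 \<psi>"
proof -
  define R where "R = sqrt (lattice_mass h K \<psi>0 / h)"
  have m0: "lattice_mass h K \<psi>0 \<ge> 0" using h by (simp add: lattice_mass_def sum_nonneg)
  have R: "R \<ge> 0" using m0 h by (simp add: R_def)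
  define c where "c x = max 0 (min 1 (real K + 1 - \<bar>x\<bar>))" for x :: real
  have c01: "0 \<le> c x" "c x \<le> 1" for x by (auto simp: c_def)
  have c_in: "c (of_int l) = 1" if "l \<in> {- int K..int K}" for l
  proof -
    have "\<bar>l\<bar> \<le> int K" using that by auto
    hence "\<bar>of_int l\<bar> \<le> real K" by linarith
    thus ?thesis by (simp add: c_def)
  qed
  have c_out: "c (of_int l) = 0" if "\<bar>l\<bar> \<ge> int K + 1" for l
  proof -
    have "\<bar>of_int l\<bar> \<ge> real K + 1" using that by linarith
    thus ?thesis by (simp add: c_def)
  qed
  let ?lap = "\<lambda>(u :: real \<Rightarrow> complex) x. u (x + 1) + u (x - 1) - 2 * u x"
  define G :: "(real \<Rightarrow> complex) \<Rightarrow> real \<Rightarrow> complex" where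
    "G u x = c x *\<^sub>R (\<i> * ((1 / h\<^sup>2) *\<^sub>R ?lap u x + cut_cubic R (u x)))" for u x
  define L where "L = 4 / h\<^sup>2 + 3 * R\<^sup>2"
  have L: "L > 0" using h by (simp add: L_def add_pos_nonneg)
  have Gd: "cmod (G u x - G v x) \<le> L * n" if n: "\<And>x. cmod (u x - v x) \<le> n" for u v x n
  proof -
    have "?lap u x - ?lap v x = (u (x + 1) - v (x + 1)) + (u (x - 1) - v (x - 1)) - 2 * (u x - v x)"
      by (simp add: algebra_simps)
    hence "cmod (?lap u x - ?lap v x) \<le> cmod (u (x + 1) - v (x + 1)) + cmod (u (x - 1) - v (x - 1)) + cmod (2 * (u x - v x))"
      by (simp only:) (rule order_trans[OF norm_triangle_ineq4 add_right_mono[OF norm_triangle_ineq]])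
    also have "\<dots> \<le> n + n + 2 * n"
    proof (intro add_mono n)
      show "cmod (2 * (u x - v x)) \<le> 2 * n" unfolding norm_mult using n[of x] by simp
    qed
    finally have 1: "cmod (?lap u x - ?lap v x) \<le> 4 * n" by simp
    have 2: "cmod (cut_cubic R (u x) - cut_cubic R (v x)) \<le> 3 * R\<^sup>2 * n"
      by (rule order_trans[OF cut_cubic_Lipschitz[OF R]]) (intro mult_left_mono n, simp)
    let ?A = "(1 / h\<^sup>2) *\<^sub>R (?lap u x - ?lap v x)" and ?B = "cut_cubic R (u x) - cut_cubic R (v x)"
    have "G u x - G v x = c x *\<^sub>R (\<i> * (?A + ?B))" by (simp add: G_def algebra_simps)
    hence "cmod (G u x - G v x) = c x * cmod (?A + ?B)" using c01 by (simp add: norm_mult)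
    also have "\<dots> \<le> 1 * (cmod ?A + cmod ?B)"
      using c01 by (intro mult_mono norm_triangle_ineq) auto
    also have "cmod ?A \<le> (1 / h\<^sup>2) * (4 * n)"
      using 1 by (simp add: divide_right_mono)
    finally show ?thesis using 2 by (simp add: L_def algebra_simps)
  qed
  have G0: "G (\<lambda>_. 0) = (\<lambda>_. 0)" by (auto simp: G_def cut_cubic_def)
  have Gb: "G (apply_bcontfun u) \<in> bcontfun" for u
  proof (rule bcontfun_normI)
    show "cmod (G (apply_bcontfun u) x) \<le> L * norm u" for x
      using Gd[of "apply_bcontfun u" "\<lambda>_. 0" "norm u" x] norm_bounded[of u] by (simp add: G0)
    have uc: "continuous_on UNIV (\<lambda>x. apply_bcontfun u (f x))" if "continuous_on UNIV f" for f :: "real \<Rightarrow> real"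
      by (rule continuous_on_compose2[OF continuous_on_apply_bcontfun[of UNIV] that]) auto
    show "continuous_on UNIV (G (apply_bcontfun u))"
      unfolding G_def[abs_def] c_def cut_cubic_def by (intro continuous_intros uc)
  qed
  define F :: "(real \<Rightarrow>\<^sub>C complex) \<Rightarrow> (real \<Rightarrow>\<^sub>C complex)" where "F u = Bcontfun (G u)" for u
  have F: "F u x = G u x" for u x by (simp add: F_def Bcontfun_inverse[OF Gb])
  have FL: "norm (F u - F v) \<le> L * norm (u - v)" for u v
  proof (rule norm_bound)
    show "norm ((F u - F v) x) \<le> L * norm (u - v)" for x
      using Gd[of u v "norm (u - v)" x] norm_bounded[of "u - v"] by (simp add: F)
  qed
  have b0: "interp 1 \<psi>0 \<in> bcontfun"
  proof -
    have p: "H1_profile (interp 1 \<psi>0) (interp_slope 1 \<psi>0)" by (rule interp_profile[OF s0]) simp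
    obtain B where "\<And>x. cmod (interp 1 \<psi>0 x) \<le> B" using exp_decaying_bound[OF H1_profileD(2)[OF p]] by blast
    thus ?thesis by (intro bcontfun_normI H1_profileD(1)[OF p])
  qed
  obtain x where x0: "x 0 = Bcontfun (interp 1 \<psi>0)"
    and x: "\<And>t. t \<ge> 0 \<Longrightarrow> (x has_vector_derivative F (x t)) (at t within {0..})"
    using global_Picard_Lindelof[OF L FL, of "Bcontfun (interp 1 \<psi>0)"] by blast
  define \<psi> where "\<psi> t l = x t (of_int l)" for t and l :: int
  let ?d = "\<lambda>t (l::int). G (x t) (of_int l)"
  have comp: "bounded_linear (\<lambda>u :: real \<Rightarrow>\<^sub>C complex. u y)" for y
    by (rule bounded_linear_intro[where K=1]) (auto simp: norm_bounded)
  have D: "((\<lambda>s. \<psi> s l) has_vector_derivative ?d t l) (at t within {0..})" if "t \<ge> 0" for t l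
    using bounded_linear.has_vector_derivative[OF comp x[OF that], of "of_int l"] by (simp add: \<psi>_def[abs_def] F)
  have init: "\<psi> 0 = \<psi>0"
    using interp_node[of 1 \<psi>0] by (simp add: \<psi>_def[abs_def] x0 Bcontfun_inverse[OF b0])
  have sup: "\<psi> t l = 0" if "t \<ge> 0" "\<bar>l\<bar> \<ge> int K + 1" for t l
  proof -
    have "?d s l = 0" for s using c_out[OF that(2)] by (simp add: G_def)
    hence d0: "((\<lambda>s. \<psi> s l) has_vector_derivative 0) (at s within {0..})" if "s \<in> {0..}" for s
      using D[of s l] that by simp
    obtain k where k: "\<And>s. s \<in> {0..} \<Longrightarrow> \<psi> s l = k"
      by (rule has_vector_derivative_zero_constant[of "{0..}" "\<lambda>s. \<psi> s l"]) (use d0 in auto)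
    have "\<psi> t l = \<psi> 0 l" using k[of t] k[of 0] that(1) by simp
    thus ?thesis using s0 that(2) by (simp add: init lattice_support_def)
  qed
  have rhs: "\<i> * ?d t l = - (1 / of_real (h\<^sup>2)) * second_difference (\<psi> t) l - of_real ((min (cmod (\<psi> t l)) R)\<^sup>2) * \<psi> t l"
    if "l \<in> {- int K..int K}" for t l
    unfolding G_def c_in[OF that]
    by (simp add: \<psi>_def cut_cubic_def scaleR_conv_of_real algebra_simps)
  have flow: "lattice_flow h K (\<lambda>t l. (min (cmod (\<psi> t l)) R)\<^sup>2) \<psi> ?d"
    unfolding lattice_flow_def
  proof (intro allI impI conjI ballI)
    fix t :: real assume t: "0 \<le> t"
    show "lattice_support K (\<psi> t)" using sup[OF t] by (simp add: lattice_support_def)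
    show "lattice_support K (?d t)" using c_out by (simp add: lattice_support_def G_def)
    show "((\<lambda>s. \<psi> s l) has_vector_derivative ?d t l) (at t within {0..})" for l by (rule D[OF t])
    fix l assume "l \<in> {- int K..int K}"
    thus "\<i> * ?d t l = - (1 / of_real (h\<^sup>2)) * second_difference (\<psi> t) l - of_real ((min (cmod (\<psi> t l)) R)\<^sup>2) * \<psi> t l"
      by (rule rhs)
  qed
  have small: "cmod (\<psi> t l) \<le> R" if t: "t \<ge> 0" for t l
  proof -
    have "lattice_support K (\<psi> t)" using sup[OF t] by (simp add: lattice_support_def)
    from lattice_mass_bound[OF h this, of l] show ?thesis
      unfolding R_def lattice_flow_mass[OF flow t] init by (rule real_le_rsqrt)
  qed
  have "DNLS_solution h K \<psi>0 \<psi>"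
    unfolding DNLS_solution_def
  proof (intro conjI allI impI ballI)
    show "\<psi> 0 = \<psi>0" by (rule init)
    show "0 \<le> t \<Longrightarrow> int K + 1 \<le> \<bar>l\<bar> \<Longrightarrow> \<psi> t l = 0" for t l by (rule sup)
    fix t :: real and l :: int assume t: "0 \<le> t" and l: "l \<in> {- int K..int K}"
    have "min (cmod (\<psi> t l)) R = cmod (\<psi> t l)" using small[OF t] by simp
    hence "\<i> * ?d t l = - (1 / of_real (h\<^sup>2)) * second_difference (\<psi> t) l - of_real ((cmod (\<psi> t l))\<^sup>2) * \<psi> t l"
      using rhs[OF l, of t] by simp
    thus "\<exists>d. ((\<lambda>s. \<psi> s l) has_vector_derivative d) (at t within {0..}) \<and>
        \<i> * d = - (1 / of_real (h\<^sup>2)) * second_difference (\<psi> t) l - of_real ((cmod (\<psi> t l))\<^sup>2) * \<psi> t l"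
      using D[OF t, of l] by (intro exI[of _ "?d t l"] conjI)
  qed
  thus ?thesis by blast
qed

section \<open>Choice of the phase\<close>

text \<open>The \<open>H\<^sup>1\<close> inner product with the real function \<open>\<eta>\<close>.\<close>
definition eta_pairing :: "(real \<Rightarrow> complex) \<Rightarrow> (real \<Rightarrow> complex) \<Rightarrow> complex" where
  "eta_pairing u u' = (LINT x|lborel. eta x *\<^sub>R u x + eta' x *\<^sub>R u' x)"

text \<open>The minimum of \<open>orbit_sq\<close> over the unit circle in closed form. Unlike the minimizing phase, it depends
continuously on the function.\<close>
definition orbit_defect :: "(real \<Rightarrow> complex) \<Rightarrow> (real \<Rightarrow> complex) \<Rightarrow> real" where
  "orbit_defect u u' = H1_sq u u' + H1_sq eta eta' - 2 * cmod (eta_pairing u u')"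

lemma exp_decaying_eta_scaleR:
  assumes "exp_decaying f"
  shows "exp_decaying (\<lambda>x. eta x *\<^sub>R f x)" "exp_decaying (\<lambda>x. eta' x *\<^sub>R f x)"
proof -
  obtain B where "\<And>x. \<bar>eta x\<bar> \<le> B" using exp_decaying_bound[OF H1_profileD(2)[OF eta_profile]] by auto
  thus "exp_decaying (\<lambda>x. eta x *\<^sub>R f x)"
    using H1_profileD(2)[OF eta_profile] by (intro exp_decaying_scaleR_bounded[OF assms]) (auto simp: exp_decaying_def)
  obtain B where "\<And>x. \<bar>eta' x\<bar> \<le> B" using exp_decaying_bound[OF H1_profileD(3)[OF eta_profile]] by auto
  thus "exp_decaying (\<lambda>x. eta' x *\<^sub>R f x)"
    using H1_profileD(3)[OF eta_profile] by (intro exp_decaying_scaleR_bounded[OF assms]) (auto simp: exp_decaying_def)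
qed

lemma orbit_sq_expand:
  assumes u: "H1_profile u u'" and z: "cmod z = 1"
  shows "orbit_sq u u' z = H1_sq u u' + H1_sq eta eta' - 2 * (z \<bullet> eta_pairing u u')"
proof -
  note du = H1_profileD(2,3)[OF u] and de = H1_profileD(2,3)[OF eta_profile]
  let ?f = "\<lambda>x. (cmod (u x))\<^sup>2 + (cmod (u' x))\<^sup>2" and ?g = "\<lambda>x. (eta x)\<^sup>2 + (eta' x)\<^sup>2"
  let ?p = "\<lambda>x. eta x *\<^sub>R u x + eta' x *\<^sub>R u' x"
  have ef: "exp_decaying ?f" by (intro exp_decaying_add exp_decaying_power2 exp_decaying_norm du)
  have eg: "exp_decaying ?g" by (intro exp_decaying_add exp_decaying_power2 de)
  have ep: "exp_decaying ?p" by (intro exp_decaying_add exp_decaying_eta_scaleR du)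
  have ezp: "exp_decaying (\<lambda>x. z \<bullet> ?p x)" by (rule exp_decaying_linear[OF bounded_linear_inner_right ep])
  have sq: "(cmod (w - z * of_real r))\<^sup>2 = (cmod w)\<^sup>2 + r\<^sup>2 - 2 * (z \<bullet> (r *\<^sub>R w))" for w r
  proof -
    have zz: "z \<bullet> z = 1" using z by (simp add: power2_norm_eq_inner[symmetric])
    have "w - z * of_real r = w - r *\<^sub>R z" by (simp add: scaleR_conv_of_real mult.commute)
    moreover have "(cmod (w - r *\<^sub>R z))\<^sup>2 = (cmod w)\<^sup>2 + r\<^sup>2 - 2 * (z \<bullet> (r *\<^sub>R w))"
      unfolding power2_norm_eq_inner inner_diff_left inner_diff_right inner_scaleR_left inner_scaleR_right zz
      by (simp add: inner_commute power2_eq_square algebra_simps)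
    ultimately show ?thesis by metis
  qed
  have "orbit_sq u u' z = (LINT x|lborel. ?f x + ?g x - 2 * (z \<bullet> ?p x))"
    unfolding H1_sq_def sq
    by (intro Bochner_Integration.integral_cong refl) (simp add: inner_add_right)
  also have "\<dots> = (LINT x|lborel. ?f x) + (LINT x|lborel. ?g x) - 2 * (LINT x|lborel. z \<bullet> ?p x)"
    using ef eg ezp by (simp add: lint_add lint_diff exp_decaying_add exp_decaying_cmult)
  also have "(LINT x|lborel. z \<bullet> ?p x) = z \<bullet> eta_pairing u u'"
    unfolding eta_pairing_def by (rule integral_inner_right) (simp add: exp_decaying_integrable[OF ep])
  finally show ?thesis by (simp add: H1_sq_def)
qed

lemma orbit_defect_le:
  assumes "H1_profile u u'" "cmod z = 1"
  shows "orbit_defect u u' \<le> orbit_sq u u' z"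
  using norm_cauchy_schwarz[of z "eta_pairing u u'"] assms
  by (simp add: orbit_sq_expand orbit_defect_def)

lemma orbit_defect_attained:
  assumes u: "H1_profile u u'"
  shows "\<exists>z. cmod z = 1 \<and> orbit_sq u u' z = orbit_defect u u'"
proof -
  define c where "c = eta_pairing u u'"
  define z where "z = (if c = 0 then 1 else c / of_real (cmod c))"
  have z: "cmod z = 1" by (simp add: z_def norm_divide)
  have "z \<bullet> c = cmod c"
  proof (cases "c = 0")
    case False
    hence "z = (1 / cmod c) *\<^sub>R c" by (simp add: z_def scaleR_conv_of_real)
    thus ?thesis using False by (simp add: power2_norm_eq_inner[symmetric] power2_eq_square)
  qed simp
  thus ?thesis using z orbit_sq_expand[OF u z] by (auto simp: orbit_defect_def c_def)
qed

lemma H1_sq_eta_nonneg: "H1_sq eta eta' \<ge> 0" by (simp add: H1_sq_def)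

lemma orbit_sq_change:
  fixes w z :: complex
  assumes u: "H1_profile u u'"
  shows "orbit_sq u u' w \<le> 2 * orbit_sq u u' z + 2 * (cmod (z - w))\<^sup>2 * H1_sq eta eta'"
proof -
  have e: "exp_decaying (\<lambda>x. (cmod (u x - w * eta x))\<^sup>2 + (cmod (u' x - w * eta' x))\<^sup>2)" for w :: complex
    using H1_profileD(2,3)[OF orbit_profile[OF u, of w]] by (intro exp_decaying_add exp_decaying_power2 exp_decaying_norm)
  have eg: "exp_decaying (\<lambda>x. (eta x)\<^sup>2 + (eta' x)\<^sup>2)"
    by (intro exp_decaying_add exp_decaying_power2 H1_profileD[OF eta_profile])
  have pw: "(cmod (a - w * of_real r))\<^sup>2 \<le> 2 * (cmod (a - z * of_real r))\<^sup>2 + 2 * (cmod (z - w))\<^sup>2 * r\<^sup>2" for a r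
  proof -
    have "a - w * of_real r = (a - z * of_real r) + (z - w) * of_real r" by (simp add: algebra_simps)
    hence "(cmod (a - w * of_real r))\<^sup>2 \<le> (cmod (a - z * of_real r) + cmod ((z - w) * of_real r))\<^sup>2"
      by (simp only:) (intro power_mono norm_triangle_ineq norm_ge_zero)
    also have "\<dots> \<le> 2 * (cmod (a - z * of_real r))\<^sup>2 + 2 * (cmod ((z - w) * of_real r))\<^sup>2" by (rule square_add_le)
    finally show ?thesis by (simp add: norm_mult power_mult_distrib)
  qed
  have "orbit_sq u u' w \<le> (LINT x|lborel. 2 * ((cmod (u x - z * eta x))\<^sup>2 + (cmod (u' x - z * eta' x))\<^sup>2)
      + 2 * (cmod (z - w))\<^sup>2 * ((eta x)\<^sup>2 + (eta' x)\<^sup>2))"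
    unfolding H1_sq_def
  proof (rule lint_mono[OF e])
    show "exp_decaying (\<lambda>x. 2 * ((cmod (u x - z * eta x))\<^sup>2 + (cmod (u' x - z * eta' x))\<^sup>2)
      + 2 * (cmod (z - w))\<^sup>2 * ((eta x)\<^sup>2 + (eta' x)\<^sup>2))"
      by (intro exp_decaying_add[OF exp_decaying_cmult exp_decaying_cmult] e eg)
    show "(cmod (u x - w * eta x))\<^sup>2 + (cmod (u' x - w * eta' x))\<^sup>2 \<le>
      2 * ((cmod (u x - z * eta x))\<^sup>2 + (cmod (u' x - z * eta' x))\<^sup>2) + 2 * (cmod (z - w))\<^sup>2 * ((eta x)\<^sup>2 + (eta' x)\<^sup>2)" for x
      using pw[of "u x" "eta x"] pw[of "u' x" "eta' x"] by (simp add: algebra_simps)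
  qed
  also have "\<dots> = 2 * orbit_sq u u' z + 2 * (cmod (z - w))\<^sup>2 * H1_sq eta eta'"
  proof -
    have "(LINT x|lborel. 2 * f x + c * g x) = 2 * (LINT x|lborel. f x) + c * (LINT x|lborel. g x)"
      if "exp_decaying f" "exp_decaying g" for f g :: "real \<Rightarrow> real" and c
      using that by (simp add: lint_add exp_decaying_cmult)
    from this[OF e[of z] eg] show ?thesis by (simp add: H1_sq_def)
  qed
  finally show ?thesis .
qed

text \<open>At the origin the closeness of \<open>u(0)\<close> to \<open>z \<eta>(0)\<close> forces \<open>z\<close> to be close to the phase of \<open>u(0)\<close>; replacing
\<open>z\<close> by that phase makes the imaginary part of the perturbation vanish there.\<close>
lemma rephase:
  assumes u: "H1_profile u u'" and z: "cmod z = 1"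
  shows "\<exists>w. cmod w = 1 \<and> Im (cnj w * u 0) = 0 \<and> orbit_sq u u' w \<le> (2 + 64 * H1_sq eta eta') * orbit_sq u u' z"
proof -
  define n where "n = orbit_sq u u' z"
  define e0 where "e0 = eta 0"
  \<comment> \<open>The value \<open>\<eta>(0)\<^sup>2 = 1/8\<close> is the origin of the factor \<open>32 = 4 * 8\<close> below.\<close>
  have e0: "e0 > 0" "e0\<^sup>2 = 1/8" by (auto simp: e0_def eta_pos eta_sq)
  define w where "w = (if u 0 = 0 then z else u 0 / of_real (cmod (u 0)))"
  have w: "cmod w = 1" using z by (simp add: w_def norm_divide)
  have "cnj (u 0) * u 0 = of_real ((cmod (u 0))\<^sup>2)"
    by (subst mult.commute) (rule complex_norm_square[symmetric])
  hence Im: "Im (cnj w * u 0) = 0" by (simp add: w_def)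
  have s: "(cmod (u 0 - z * e0))\<^sup>2 \<le> n"
    unfolding n_def e0_def by (rule H1_sq_sup_bound[OF orbit_profile[OF u]])
  have "e0 * cmod (z - w) \<le> 2 * cmod (u 0 - z * e0)"
  proof (cases "u 0 = 0")
    case True thus ?thesis by (simp add: w_def)
  next
    case False
    have uw: "u 0 = of_real (cmod (u 0)) * w" using False by (simp add: w_def)
    have "e0 * cmod (z - w) = cmod (z * e0 - w * e0)"
      using e0 by (simp add: norm_mult flip: left_diff_distrib)
    also have "\<dots> \<le> cmod (z * e0 - u 0) + cmod (u 0 - w * e0)"
      using norm_triangle_ineq[of "z * e0 - u 0" "u 0 - w * e0"] by simp
    also have "u 0 - w * e0 = of_real (cmod (u 0) - e0) * w" by (subst uw) (simp add: algebra_simps)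
    also have "cmod (of_real (cmod (u 0) - e0) * w) = \<bar>cmod (u 0) - cmod (z * e0)\<bar>"
      using w z e0 by (simp only: norm_mult norm_of_real) simp
    also have "\<dots> \<le> cmod (u 0 - z * e0)" by (rule norm_triangle_ineq3)
    finally show ?thesis by (simp add: norm_minus_commute)
  qed
  hence "(e0 * cmod (z - w))\<^sup>2 \<le> (2 * cmod (u 0 - z * e0))\<^sup>2" using e0 by (intro power_mono) auto
  hence zw: "(cmod (z - w))\<^sup>2 \<le> 32 * n" using s e0 by (simp add: power_mult_distrib)
  have "orbit_sq u u' w \<le> 2 * n + 2 * (cmod (z - w))\<^sup>2 * H1_sq eta eta'"
    unfolding n_def by (rule orbit_sq_change[OF u])
  also have "\<dots> \<le> 2 * n + 2 * (32 * n) * H1_sq eta eta'"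
    using zw H1_sq_eta_nonneg by (intro add_left_mono mult_right_mono mult_left_mono) auto
  finally show ?thesis using w Im by (intro exI[of _ w]) (simp add: n_def algebra_simps)
qed

lemma rotate_to_perturbation:
  fixes u u' v v' :: "real \<Rightarrow> complex"
  assumes u: "H1_profile u u'" and w: "cmod w = 1"
  defines "v \<equiv> \<lambda>x. cnj w * u x - eta x" and "v' \<equiv> \<lambda>x. cnj w * u' x - eta' x"
  shows "H1_profile v v'" "H1_sq v v' = orbit_sq u u' w"
    "energy (\<lambda>x. eta x + v x) (\<lambda>x. eta' x + v' x) = energy u u'" "mass (\<lambda>x. eta x + v x) = mass u"
proof -
  have e: "H1_profile (\<lambda>x. complex_of_real (eta x)) (\<lambda>x. complex_of_real (eta' x))"
    using complex_eta_profile[of 1] by simp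
  show "H1_profile v v'" unfolding v_def v'_def by (rule H1_profile_diff[OF H1_profile_cmult[OF u] e])
  have "cnj w * w = of_real ((cmod w)\<^sup>2)" by (subst mult.commute) (rule complex_norm_square[symmetric])
  hence ww: "cnj w * w = 1" using w by simp
  have m: "cmod (cnj w * a - of_real r) = cmod (a - w * of_real r)" for a r
  proof -
    have "cnj w * (a - w * of_real r) = cnj w * a - (cnj w * w) * of_real r"
      by (simp only: right_diff_distrib mult.assoc)
    hence "cnj w * a - of_real r = cnj w * (a - w * of_real r)" using ww by simp
    thus ?thesis using w by (simp add: norm_mult)
  qed
  show "H1_sq v v' = orbit_sq u u' w" by (simp add: H1_sq_def v_def v'_def m)
  show "energy (\<lambda>x. eta x + v x) (\<lambda>x. eta' x + v' x) = energy u u'" "mass (\<lambda>x. eta x + v x) = mass u"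
    using w by (simp_all add: energy_def mass_def v_def v'_def norm_mult)
qed

text \<open>\<open>energy_coercive\<close> for the perturbation measured at the phase supplied by \<open>rephase\<close>.\<close>
lemma orbital_coercivity:
  "\<exists>A>0. \<exists>\<rho>>0. \<forall>(u :: real \<Rightarrow> complex) (u' :: real \<Rightarrow> complex). H1_profile u u' \<longrightarrow> (\<forall>x. u (- x) = u x) \<longrightarrow>
     orbit_defect u u' \<le> \<rho> \<longrightarrow>
     (\<exists>w. cmod w = 1 \<and> orbit_sq u u' w \<le> A * (energy u u' - energy eta eta' + 4 * (mass u - mass eta)\<^sup>2))"
proof -
  obtain A \<rho> where A: "A > 0" and r: "\<rho> > 0" and co: "\<forall>(v :: real \<Rightarrow> complex) (v' :: real \<Rightarrow> complex). H1_profile v v' \<longrightarrow>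
     (\<forall>x. v (- x) = v x) \<longrightarrow> Im (v 0) = 0 \<longrightarrow> H1_sq v v' \<le> \<rho> \<longrightarrow>
     H1_sq v v' \<le> A * (energy (\<lambda>x. eta x + v x) (\<lambda>x. eta' x + v' x) - energy eta eta'
        + 4 * (mass (\<lambda>x. eta x + v x) - mass eta)\<^sup>2)"
    using energy_coercive by (elim exE conjE)
  define C where "C = 2 + 64 * H1_sq eta eta'"
  have C: "C > 0" using H1_sq_eta_nonneg by (simp add: C_def)
  show ?thesis
  proof (rule exI[of _ A], rule conjI[OF A], rule exI[of _ "\<rho> / C"], rule conjI, use r C in simp, intro allI impI)
    fix u u' :: "real \<Rightarrow> complex"
    assume u: "H1_profile u u'" and ev: "\<forall>x. u (- x) = u x" and small: "orbit_defect u u' \<le> \<rho> / C"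
    obtain z where z: "cmod z = 1" "orbit_sq u u' z = orbit_defect u u'" using orbit_defect_attained[OF u] by blast
    obtain w where w: "cmod w = 1" "Im (cnj w * u 0) = 0" "orbit_sq u u' w \<le> C * orbit_sq u u' z"
      using rephase[OF u z(1)] unfolding C_def by blast
    have "orbit_sq u u' w \<le> \<rho>" using w(3) z(2) small C by (simp add: field_simps)
    note p = rotate_to_perturbation[OF u w(1)]
    let ?v = "\<lambda>x. cnj w * u x - complex_of_real (eta x)" and ?v' = "\<lambda>x. cnj w * u' x - complex_of_real (eta' x)"
    have ve: "\<forall>x. ?v (- x) = ?v x" using ev by (simp add: eta_sech4)
    have v0: "Im (?v 0) = 0" using w(2) by simp
    have vs: "H1_sq ?v ?v' \<le> \<rho>" unfolding p(2) by fact
    from co[rule_format, OF p(1) ve[rule_format] v0 vs]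
    have "orbit_sq u u' w \<le> A * (energy u u' - energy eta eta' + 4 * (mass u - mass eta)\<^sup>2)"
      unfolding p(2,3,4) .
    thus "\<exists>w. cmod w = 1 \<and> orbit_sq u u' w \<le> A * (energy u u' - energy eta eta' + 4 * (mass u - mass eta)\<^sup>2)"
      using w(1) by blast
  qed
qed

section \<open>Stability\<close>

text \<open>A continuous function that starts below \<open>r/2\<close> cannot cross the forbidden interval between \<open>r/2\<close> and \<open>r\<close>.\<close>
lemma bootstrap:
  fixes D :: "real \<Rightarrow> real"
  assumes D: "continuous_on {0..} D" and r: "r > 0" and D0: "D 0 \<le> r / 2"
    and step: "\<And>t. t \<ge> 0 \<Longrightarrow> D t \<le> r \<Longrightarrow> D t \<le> r / 2" and t: "t \<ge> 0"
  shows "D t \<le> r / 2"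
proof (rule ccontr)
  assume "\<not> D t \<le> r / 2"
  hence "D t > r" using step[OF t] by linarith
  hence "\<exists>s\<ge>0. s \<le> t \<and> D s = 3 / 4 * r"
    by (intro IVT') (use D0 r t in \<open>auto intro: continuous_on_subset[OF D]\<close>)
  then obtain s where s: "s \<ge> 0" "D s = 3 / 4 * r" by blast
  with step[of s] r show False by simp
qed

definition unit_sequence :: "int \<Rightarrow> int \<Rightarrow> complex" where
  "unit_sequence j i = (if i = j then 1 else 0)"

text \<open>Exhibits the pairing as a finite linear combination of the node values, hence continuous in time along a
solution.\<close>
lemma eta_pairing_interp:
  assumes h: "h > 0" and s: "lattice_support K \<psi>"
  shows "eta_pairing (interp h \<psi>) (interp_slope h \<psi>) =
    (\<Sum>j\<in>{- int K..int K}. \<psi> j * eta_pairing (interp h (unit_sequence j)) (interp_slope h (unit_sequence j)))"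
proof -
  let ?J = "{- int K..int K}"
  have su: "lattice_support K (unit_sequence j)" if "j \<in> ?J" for j
    using that by (auto simp: lattice_support_def unit_sequence_def)
  have ip: "exp_decaying (\<lambda>x. eta x *\<^sub>R interp h (unit_sequence j) x + eta' x *\<^sub>R interp_slope h (unit_sequence j) x)"
    if "j \<in> ?J" for j
    by (intro exp_decaying_add exp_decaying_eta_scaleR H1_profileD[OF interp_profile[OF su[OF that] h]])
  have sum: "(\<Sum>j\<in>?J. \<psi> j * unit_sequence j i) = \<psi> i" for i
  proof (cases "i \<in> ?J")
    case True
    have "(\<Sum>j\<in>?J. \<psi> j * unit_sequence j i) = (\<Sum>j\<in>?J. if i = j then \<psi> j else 0)"
      by (intro sum.cong) (auto simp: unit_sequence_def)
    thus ?thesis using True by simp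
  next
    case False
    hence "\<psi> i = 0" using s by (auto simp: lattice_support_def)
    moreover have "(\<Sum>j\<in>?J. \<psi> j * unit_sequence j i) = 0"
      using False by (intro sum.neutral) (auto simp: unit_sequence_def)
    ultimately show ?thesis by simp
  qed
  have slope: "interp_slope h \<psi> x = (\<Sum>j\<in>?J. \<psi> j * interp_slope h (unit_sequence j) x)" for x
    unfolding interp_slope_def
    by (simp only: right_diff_distrib times_divide_eq_right sum_divide_distrib[symmetric] sum_subtractf sum)
  have int: "interp h \<psi> x = (\<Sum>j\<in>?J. \<psi> j * interp h (unit_sequence j) x)" for x
  proof -
    let ?m = "\<lfloor>x / h\<rfloor>"
    have c: "interp h \<phi> x = \<phi> ?m + of_real (x / h - of_int ?m) * (\<phi> (?m + 1) - \<phi> ?m)" for \<phi>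
      by (rule interp_cell) linarith+
    have "\<psi> j * (a + r * (b - a)) = \<psi> j * a + r * (\<psi> j * b - \<psi> j * a)" for j a b r
      by (simp add: algebra_simps)
    thus ?thesis unfolding c by (simp only: sum.distrib sum_distrib_left[symmetric] sum_subtractf sum)
  qed
  have "eta_pairing (interp h \<psi>) (interp_slope h \<psi>) = (LINT x|lborel. (\<Sum>j\<in>?J.
      \<psi> j * (eta x *\<^sub>R interp h (unit_sequence j) x + eta' x *\<^sub>R interp_slope h (unit_sequence j) x)))"
    unfolding eta_pairing_def slope int
    by (intro Bochner_Integration.integral_cong refl)
       (simp add: scaleR_sum_right sum.distrib[symmetric] algebra_simps)
  also have "\<dots> = (\<Sum>j\<in>?J. LINT x|lborel.
      \<psi> j * (eta x *\<^sub>R interp h (unit_sequence j) x + eta' x *\<^sub>R interp_slope h (unit_sequence j) x))"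
    by (rule Bochner_Integration.integral_sum) (intro integrable_mult_right exp_decaying_integrable ip)
  finally show ?thesis by (simp add: eta_pairing_def)
qed

lemma orbit_defect_continuous:
  assumes h: "h > 0" and \<psi>: "DNLS_solution h K \<psi>0 \<psi>"
  shows "continuous_on {0..} (\<lambda>t. orbit_defect (interp h (\<psi> t)) (interp_slope h (\<psi> t)))"
proof -
  obtain d where d: "lattice_flow h K (\<lambda>t l. (cmod (\<psi> t l))\<^sup>2) \<psi> d" using DNLS_solution_flow[OF \<psi>] by blast
  have s: "lattice_support K (\<psi> t)" if "t \<ge> 0" for t using d that unfolding lattice_flow_def by blast
  have c: "continuous_on {0..} (\<lambda>t. \<psi> t l)" for l
    unfolding continuous_on_eq_continuous_within
  proof
    fix t :: real assume "t \<in> {0..}"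
    hence "((\<lambda>s. \<psi> s l) has_vector_derivative d t l) (at t within {0..})" using d unfolding lattice_flow_def by auto
    thus "continuous (at t within {0..}) (\<lambda>s. \<psi> s l)" by (rule has_vector_derivative_continuous)
  qed
  have "continuous_on {0..} (\<lambda>t. (lattice_mass h K (\<psi> t) - h\<^sup>2 / 6 * lattice_gradient h K (\<psi> t)) + lattice_gradient h K (\<psi> t)
     + H1_sq eta eta' - 2 * cmod (\<Sum>j\<in>{- int K..int K}. \<psi> t j * eta_pairing (interp h (unit_sequence j)) (interp_slope h (unit_sequence j))))"
    unfolding lattice_mass_def lattice_gradient_def using h by (intro continuous_intros c) auto
  thus ?thesis
  proof (rule continuous_on_eq)
    fix t :: real assume "t \<in> {0..}"
    hence st: "lattice_support K (\<psi> t)" using s by simp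
    note p = interp_profile[OF st h]
    have "H1_sq (interp h (\<psi> t)) (interp_slope h (\<psi> t)) = mass (interp h (\<psi> t)) + (LINT x|lborel. (cmod (interp_slope h (\<psi> t) x))\<^sup>2)"
      unfolding H1_sq_def mass_def
      by (intro lint_add exp_decaying_power2 exp_decaying_norm H1_profileD[OF p])
    thus "(lattice_mass h K (\<psi> t) - h\<^sup>2 / 6 * lattice_gradient h K (\<psi> t)) + lattice_gradient h K (\<psi> t)
     + H1_sq eta eta' - 2 * cmod (\<Sum>j\<in>{- int K..int K}. \<psi> t j * eta_pairing (interp h (unit_sequence j)) (interp_slope h (unit_sequence j)))
     = orbit_defect (interp h (\<psi> t)) (interp_slope h (\<psi> t))"
      unfolding orbit_defect_def eta_pairing_interp[OF h st] interp_mass[OF h st] interp_gradient[OF h st] by simp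
  qed
qed

lemma interp_even:
  assumes h: "h > 0" and s: "lattice_support K \<psi>" and ev: "\<And>j. \<psi> (- j) = \<psi> j"
  shows "interp h \<psi> (- x) = interp h \<psi> x"
proof -
  have "interp h \<psi> (- x) = (\<Sum>j\<in>{- int K..int K}. \<psi> (- j) * of_real (hat (- x / h - of_int (- j))))"
    unfolding interp_finite_sum[OF s]
    by (rule sum.reindex_bij_witness[of _ uminus uminus]) auto
  also have "\<dots> = interp h \<psi> x"
    unfolding interp_finite_sum[OF s]
  proof (rule sum.cong[OF refl])
    fix j
    have "\<bar>- x / h - of_int (- j)\<bar> = \<bar>x / h - of_int j\<bar>" by (simp add: abs_minus_commute)
    thus "\<psi> (- j) * of_real (hat (- x / h - of_int (- j))) = \<psi> j * of_real (hat (x / h - of_int j))"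
      by (simp add: hat_def ev)
  qed
  finally show ?thesis .
qed

text \<open>As long as the defect is at most \<open>\<rho>\<close>, the norm of the interpolant is bounded, so \<open>interp_consistency\<close> and the
two lattice conservation laws keep its action and mass within \<open>O(h\<^sup>2)\<close> of their initial values;
\<open>orbital_coercivity\<close> then gives the claimed bound, which improves \<open>\<rho>\<close> to \<open>\<rho>/2\<close>.\<close>
lemma stability_estimate:
  "\<exists>A>0. \<exists>r>0. \<forall>\<delta> h K \<psi>0 \<psi>. 0 < \<delta> \<longrightarrow> 0 < h \<longrightarrow> \<delta>\<^sup>2 \<le> r \<longrightarrow> h\<^sup>2 \<le> r \<longrightarrow> h \<le> 1 \<longrightarrow> \<psi>0 \<in> V K \<longrightarrow>
     H1_dist (interp h \<psi>0) Gamma_orbit \<le> \<delta> \<longrightarrow> DNLS_solution h K \<psi>0 \<psi> \<longrightarrow>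
     (\<forall>t\<ge>0. (H1_dist (interp h (\<psi> t)) Gamma_orbit)\<^sup>2 \<le> A * (\<delta>\<^sup>2 + h\<^sup>2))"
proof -
  obtain K0 \<rho>0 where K0: "K0 > 0" and \<rho>0: "\<rho>0 > 0"
    and co: "\<forall>(u :: real \<Rightarrow> complex) (u' :: real \<Rightarrow> complex). H1_profile u u' \<longrightarrow> (\<forall>x. u (- x) = u x) \<longrightarrow>
     orbit_defect u u' \<le> \<rho>0 \<longrightarrow>
     (\<exists>w. cmod w = 1 \<and> orbit_sq u u' w \<le> K0 * (energy u u' - energy eta eta' + 4 * (mass u - mass eta)\<^sup>2))"
    using orbital_coercivity by (elim exE conjE)
  obtain K1 where K1: "K1 > 0"
    and up: "\<forall>(v :: real \<Rightarrow> complex) (v' :: real \<Rightarrow> complex). H1_profile v v' \<longrightarrow> H1_sq v v' \<le> 1 \<longrightarrow>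
     energy (\<lambda>x. eta x + v x) (\<lambda>x. eta' x + v' x) - energy eta eta' \<le> K1 * H1_sq v v' \<and>
     (mass (\<lambda>x. eta x + v x) - mass eta)\<^sup>2 \<le> K1 * H1_sq v v'"
    using energy_upper by (elim exE conjE)
  define \<rho> where "\<rho> = min \<rho>0 1"
  have \<rho>: "0 < \<rho>" "\<rho> \<le> \<rho>0" "\<rho> \<le> 1" using \<rho>0 by (auto simp: \<rho>_def)
  define B where "B = H1_sq eta eta'"
  have B: "B \<ge> 0" using H1_sq_eta_nonneg by (simp add: B_def)
  define N where "N = 2 + 2 * B"
  have N: "N > 0" using B by (simp add: N_def)
  \<comment> \<open>\<open>36 = 4 + 4 * 8\<close> and \<open>32 = 4 * 8\<close>: the squared mass defect has weight \<open>4\<close> and is at most \<open>8 K1 \<delta>\<^sup>2 + 8 N\<^sup>2 h\<^sup>2\<close>.\<close>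
  define A where "A = K0 * (36 * K1 + 6 * (N + N\<^sup>2) + 32 * N\<^sup>2)"
  have A: "A > 0" unfolding A_def using K0 K1 N by (intro mult_pos_pos add_pos_pos) auto
  \<comment> \<open>The first entry makes the initial defect at most \<open>4 \<delta>\<^sup>2 \<le> \<rho>/2\<close>, the second makes \<open>A (\<delta>\<^sup>2 + h\<^sup>2) \<le> \<rho>/2\<close>.\<close>
  define r where "r = min (\<rho> / 8) (\<rho> / (4 * A))"
  have r: "r > 0" using \<rho> A by (simp add: r_def)
  show ?thesis
  proof (rule exI[of _ A], rule conjI[OF A], rule exI[of _ r], rule conjI[OF r], intro allI impI)
    fix \<delta> h :: real and K :: nat and \<psi>0 :: "int \<Rightarrow> complex" and \<psi> :: "real \<Rightarrow> int \<Rightarrow> complex" and T :: real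
    assume \<delta>: "0 < \<delta>" and h: "0 < h" and \<delta>r: "\<delta>\<^sup>2 \<le> r" and hr: "h\<^sup>2 \<le> r" and h1: "h \<le> 1" and V: "\<psi>0 \<in> V K"
      and dist: "H1_dist (interp h \<psi>0) Gamma_orbit \<le> \<delta>" and sol: "DNLS_solution h K \<psi>0 \<psi>" and T: "0 \<le> T"
    define S where "S = \<delta>\<^sup>2 + h\<^sup>2"
    have AS: "A * S \<le> \<rho> / 2"
    proof -
      have "S \<le> 2 * (\<rho> / (4 * A))" using \<delta>r hr by (simp add: S_def r_def)
      thus ?thesis using A by (simp add: field_simps)
    qed
    have ev0: "\<psi>0 (- j) = \<psi>0 j" for j using V by (simp add: V_def)
    obtain d where fl: "lattice_flow h K (\<lambda>t l. (cmod (\<psi> t l))\<^sup>2) \<psi> d" using DNLS_solution_flow[OF sol] by blast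
    have sup: "lattice_support K (\<psi> t)" if "t \<ge> 0" for t using fl that unfolding lattice_flow_def by blast
    have init: "\<psi> 0 = \<psi>0" by (rule DNLS_solutionD(1)[OF sol])
    let ?u = "\<lambda>t. interp h (\<psi> t)" and ?u' = "\<lambda>t. interp_slope h (\<psi> t)"
    have prof: "H1_profile (?u t) (?u' t)" if "t \<ge> 0" for t by (rule interp_profile[OF sup[OF that] h])
    have even: "?u t (- x) = ?u t x" if "t \<ge> 0" for t x
      by (rule interp_even[OF h sup[OF that] DNLS_even[OF h sol ev0 that]])
    define D where "D t = orbit_defect (?u t) (?u' t)" for t
    \<comment> \<open>A defect of at most \<open>\<rho> \<le> 1\<close> bounds the norm, which makes the consistency errors uniform.\<close>
    have size: "H1_sq (?u t) (?u' t) \<le> N" if t: "t \<ge> 0" and Dt: "D t \<le> \<rho>" for t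
    proof -
      obtain z where z: "cmod z = 1" "orbit_sq (?u t) (?u' t) z = D t"
        using orbit_defect_attained[OF prof[OF t]] unfolding D_def by blast
      have "H1_sq (?u t) (?u' t) = orbit_sq (?u t) (?u' t) 0" by simp
      also have "\<dots> \<le> 2 * orbit_sq (?u t) (?u' t) z + 2 * (cmod (z - 0))\<^sup>2 * H1_sq eta eta'"
        by (rule orbit_sq_change[OF prof[OF t]])
      also have "\<dots> \<le> N" using z Dt \<rho> by (simp add: N_def B_def)
      finally show ?thesis .
    qed
    \<comment> \<open>The infimum need not be attained, hence a phase within \<open>2 \<delta>\<close>.\<close>
    have "H1_dist (?u 0) Gamma_orbit < 2 * \<delta>" using dist \<delta> init by simp
    then obtain z0 where z0: "cmod z0 = 1" "sqrt (orbit_sq (?u 0) (?u' 0) z0) < 2 * \<delta>"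
      using H1_dist_Gamma_orbit(2)[OF prof[of 0]] by auto
    define n0 where "n0 = orbit_sq (?u 0) (?u' 0) z0"
    have n0: "0 \<le> n0" by (simp add: n0_def H1_sq_def)
    have "(sqrt n0)\<^sup>2 \<le> (2 * \<delta>)\<^sup>2" using z0(2) n0 unfolding n0_def[symmetric] by (intro power_mono) auto
    hence n0d: "n0 \<le> 4 * \<delta>\<^sup>2" using n0 by (simp add: power_mult_distrib)
    have n0r: "n0 \<le> \<rho> / 2" using n0d \<delta>r by (simp add: r_def)
    have D0: "D 0 \<le> \<rho> / 2"
      using orbit_defect_le[OF prof[of 0] z0(1)] n0r unfolding D_def n0_def by simp
    note p = rotate_to_perturbation[OF prof[of 0, simplified] z0(1)]
    have "H1_sq (\<lambda>x. cnj z0 * ?u 0 x - eta x) (\<lambda>x. cnj z0 * ?u' 0 x - eta' x) \<le> 1"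
      using p(2) n0r \<rho> by (simp add: n0_def)
    from up[rule_format, OF p(1) this]
    have E0: "energy (?u 0) (?u' 0) - energy eta eta' \<le> K1 * n0" and M0: "(mass (?u 0) - mass eta)\<^sup>2 \<le> K1 * n0"
      unfolding p(2,3,4) n0_def by auto
    have K1n: "K1 * n0 \<le> 4 * K1 * \<delta>\<^sup>2" using mult_left_mono[OF n0d, of K1] K1 by simp
    \<comment> \<open>Conservation transports the initial action and mass to time \<open>t\<close>.\<close>
    have main: "\<exists>w. cmod w = 1 \<and> orbit_sq (?u t) (?u' t) w \<le> A * S" if t: "t \<ge> 0" and Dt: "D t \<le> \<rho>" for t
    proof -
      define n where "n = H1_sq (?u t) (?u' t)"
      define m where "m = H1_sq (?u 0) (?u' 0)"
      have nN: "0 \<le> n" "n \<le> N" using size[OF t Dt] by (auto simp: n_def H1_sq_def)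
      have mN: "0 \<le> m" "m \<le> N" using size[of 0] D0 \<rho> by (auto simp: m_def H1_sq_def)
      define X where "X = lattice_energy h K \<psi>0 + lattice_mass h K \<psi>0 / 16"
      define Y where "Y = lattice_mass h K \<psi>0"
      have cons: "lattice_energy h K (\<psi> t) + lattice_mass h K (\<psi> t) / 16 = X" "lattice_mass h K (\<psi> t) = Y"
        using lattice_flow_energy[OF fl h t] lattice_flow_mass[OF fl t] init by (auto simp: X_def Y_def)
      have sq: "3 * h\<^sup>2 * (k + k\<^sup>2) \<le> 3 * h\<^sup>2 * (N + N\<^sup>2)" "h\<^sup>2 * k \<le> h\<^sup>2 * N" if "0 \<le> k" "k \<le> N" for k
        using that by (auto intro!: mult_left_mono add_mono power_mono)
      have e1: "\<bar>energy (?u t) (?u' t) - X\<bar> \<le> 3 * h\<^sup>2 * (N + N\<^sup>2)"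
        using interp_consistency(2)[OF h sup[OF t]] sq(1)[OF nN] unfolding cons(1) n_def by (rule order_trans)
      have e2: "\<bar>energy (?u 0) (?u' 0) - X\<bar> \<le> 3 * h\<^sup>2 * (N + N\<^sup>2)"
        using interp_consistency(2)[OF h sup[OF order_refl]] sq(1)[OF mN] unfolding X_def m_def init by (rule order_trans)
      have m1: "\<bar>mass (?u t) - Y\<bar> \<le> h\<^sup>2 * N"
        using interp_consistency(1)[OF h sup[OF t]] sq(2)[OF nN] unfolding cons(2) n_def by (rule order_trans)
      have m2: "\<bar>mass (?u 0) - Y\<bar> \<le> h\<^sup>2 * N"
        using interp_consistency(1)[OF h sup[OF order_refl]] sq(2)[OF mN] unfolding Y_def m_def init by (rule order_trans)
      have E: "energy (?u t) (?u' t) - energy eta eta' \<le> 4 * K1 * \<delta>\<^sup>2 + 6 * (N + N\<^sup>2) * h\<^sup>2"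
      proof -
        have "3 * h\<^sup>2 * (N + N\<^sup>2) + 3 * h\<^sup>2 * (N + N\<^sup>2) = 6 * (N + N\<^sup>2) * h\<^sup>2" by (simp add: algebra_simps)
        thus ?thesis using e1 e2 E0 K1n by linarith
      qed
      have "(mass (?u t) - mass eta)\<^sup>2 = ((mass (?u 0) - mass eta) + (mass (?u t) - mass (?u 0)))\<^sup>2" by simp
      also have "\<dots> \<le> 2 * (mass (?u 0) - mass eta)\<^sup>2 + 2 * (mass (?u t) - mass (?u 0))\<^sup>2" by (rule square_add_le)
      also have "(mass (?u t) - mass (?u 0))\<^sup>2 \<le> (2 * (h\<^sup>2 * N))\<^sup>2"
        using m1 m2 by (intro abs_le_square_iff[THEN iffD1]) auto
      also have "(2 * (h\<^sup>2 * N))\<^sup>2 = 4 * N\<^sup>2 * (h\<^sup>2 * h\<^sup>2)" by (simp add: power2_eq_square)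
      also have "\<dots> \<le> 4 * N\<^sup>2 * (1 * h\<^sup>2)"
        using h h1 by (intro mult_left_mono mult_right_mono) (auto simp: power_le_one)
      finally have Mt: "(mass (?u t) - mass eta)\<^sup>2 \<le> 8 * K1 * \<delta>\<^sup>2 + 8 * N\<^sup>2 * h\<^sup>2"
        using M0 K1n by simp
      obtain w where w: "cmod w = 1"
        "orbit_sq (?u t) (?u' t) w \<le> K0 * (energy (?u t) (?u' t) - energy eta eta' + 4 * (mass (?u t) - mass eta)\<^sup>2)"
        using co[rule_format, OF prof[OF t] even[OF t]] Dt \<rho> unfolding D_def by fastforce
      have "energy (?u t) (?u' t) - energy eta eta' + 4 * (mass (?u t) - mass eta)\<^sup>2
         \<le> 36 * K1 * \<delta>\<^sup>2 + (6 * (N + N\<^sup>2) + 32 * N\<^sup>2) * h\<^sup>2"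
        using E Mt by (simp add: algebra_simps)
      also have "\<dots> \<le> (36 * K1 + 6 * (N + N\<^sup>2) + 32 * N\<^sup>2) * S"
      proof -
        have "0 \<le> a * h2 + b * d2" if "0 \<le> a" "0 \<le> b" "0 \<le> h2" "0 \<le> d2" for a b h2 d2 :: real
          using that by simp
        from this[of "36 * K1" "6 * (N + N\<^sup>2) + 32 * N\<^sup>2" "h\<^sup>2" "\<delta>\<^sup>2"] show ?thesis
          using K1 N by (simp add: S_def algebra_simps)
      qed
      finally have "K0 * (energy (?u t) (?u' t) - energy eta eta' + 4 * (mass (?u t) - mass eta)\<^sup>2) \<le> A * S"
        using K0 unfolding A_def mult.assoc by (intro mult_left_mono) auto
      thus ?thesis using w by (intro exI[of _ w]) linarith
    qed
    have "D T \<le> \<rho> / 2"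
    proof (rule bootstrap[where D = D and r = \<rho>, OF _ \<rho>(1) D0 _ T])
      show "continuous_on {0..} D" unfolding D_def by (rule orbit_defect_continuous[OF h sol])
      fix t :: real assume t: "t \<ge> 0" "D t \<le> \<rho>"
      then obtain w where "cmod w = 1" "orbit_sq (?u t) (?u' t) w \<le> A * S" using main by blast
      thus "D t \<le> \<rho> / 2" using orbit_defect_le[OF prof[OF t(1)], of w] AS unfolding D_def by linarith
    qed
    hence "D T \<le> \<rho>" using \<rho>(1) by linarith
    then obtain w where w: "cmod w = 1" "orbit_sq (?u T) (?u' T) w \<le> A * S" using main[OF T] by blast
    have nn: "0 \<le> H1_dist (?u T) Gamma_orbit"
      unfolding H1_dist_def by (rule cINF_greatest) (auto simp: Gamma_orbit_def H1_norm_def)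
    have "(H1_dist (?u T) Gamma_orbit)\<^sup>2 \<le> (sqrt (orbit_sq (?u T) (?u' T) w))\<^sup>2"
      by (intro power_mono H1_dist_Gamma_orbit(1)[OF prof[OF T] w(1)] nn)
    also have "\<dots> = orbit_sq (?u T) (?u' T) w" by (simp add: H1_sq_def)
    finally show "(H1_dist (?u T) Gamma_orbit)\<^sup>2 \<le> A * (\<delta>\<^sup>2 + h\<^sup>2)" using w(2) by (simp add: S_def)
  qed
qed

theorem theorem2p2:
  "\<exists>C\<^sub>1>0::real. \<exists>C\<^sub>2>0::real. \<exists>\<delta>\<^sub>0>0::real. \<exists>\<epsilon>\<^sub>0>0::real.
     \<forall>(\<delta>::real) (h::real) (K::nat).
       0 < \<delta> \<and> \<delta> < \<delta>\<^sub>0 \<and> 0 < h \<and> 1 \<le> K \<and>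
       h + 1 / h\<^sup>2 * exp (- C\<^sub>1 * real K * h) \<le> \<epsilon>\<^sub>0 \<longrightarrow>
       (\<forall>\<psi>0\<in>V K. H1_dist (interp h \<psi>0) Gamma_orbit \<le> \<delta> \<longrightarrow>
          (\<exists>\<psi>. DNLS_solution h K \<psi>0 \<psi>) \<and>
          (\<forall>\<psi>. DNLS_solution h K \<psi>0 \<psi> \<longrightarrow>
             (\<forall>t\<ge>0. H1_dist (interp h (\<psi> t)) Gamma_orbit
                \<le> C\<^sub>2 * (\<delta> + h + 1 / h\<^sup>2 * exp (- C\<^sub>1 * real K * h)))))"
proof -
  obtain A r where A: "A > 0" and r: "r > 0" and st: "\<forall>\<delta> h K \<psi>0 \<psi>. 0 < \<delta> \<longrightarrow> 0 < h \<longrightarrow> \<delta>\<^sup>2 \<le> r \<longrightarrow> h\<^sup>2 \<le> r \<longrightarrow> h \<le> 1 \<longrightarrow> \<psi>0 \<in> V K \<longrightarrow>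
     H1_dist (interp h \<psi>0) Gamma_orbit \<le> \<delta> \<longrightarrow> DNLS_solution h K \<psi>0 \<psi> \<longrightarrow>
     (\<forall>t\<ge>0. (H1_dist (interp h (\<psi> t)) Gamma_orbit)\<^sup>2 \<le> A * (\<delta>\<^sup>2 + h\<^sup>2))"
    using stability_estimate by (elim exE conjE)
  show ?thesis
  proof (rule exI[of _ 1], rule conjI[OF zero_less_one], rule exI[of _ "sqrt A"], rule conjI, use A in simp,
      rule exI[of _ "sqrt r"], rule conjI, use r in simp, rule exI[of _ "min 1 (sqrt r)"], rule conjI, use r in simp,
      intro allI impI ballI, elim conjE)
    fix \<delta> h :: real and K :: nat and \<psi>0 :: "int \<Rightarrow> complex"
    assume V: "\<psi>0 \<in> V K" and dist: "H1_dist (interp h \<psi>0) Gamma_orbit \<le> \<delta>"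
      and \<delta>: "0 < \<delta>" "\<delta> < sqrt r" and h: "0 < h" and small: "h + 1 / h\<^sup>2 * exp (- 1 * real K * h) \<le> min 1 (sqrt r)"
    have e0: "0 \<le> 1 / h\<^sup>2 * exp (- 1 * real K * h)" by simp
    have h1: "h \<le> 1" "h \<le> sqrt r" using small e0 by linarith+
    have "\<delta>\<^sup>2 \<le> (sqrt r)\<^sup>2" "h\<^sup>2 \<le> (sqrt r)\<^sup>2" using \<delta> h h1 by (intro power_mono; simp)+
    hence r2: "\<delta>\<^sup>2 \<le> r" "h\<^sup>2 \<le> r" using r by simp_all
    have sup: "lattice_support K \<psi>0" using V by (simp add: V_def lattice_support_def)
    show "(\<exists>\<psi>. DNLS_solution h K \<psi>0 \<psi>) \<and>
          (\<forall>\<psi>. DNLS_solution h K \<psi>0 \<psi> \<longrightarrow>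
             (\<forall>t\<ge>0. H1_dist (interp h (\<psi> t)) Gamma_orbit
                \<le> sqrt A * (\<delta> + h + 1 / h\<^sup>2 * exp (- 1 * real K * h))))"
    proof (intro conjI allI impI)
      show "\<exists>\<psi>. DNLS_solution h K \<psi>0 \<psi>" by (rule DNLS_exists[OF h sup])
      fix \<psi> t assume sol: "DNLS_solution h K \<psi>0 \<psi>" and t: "(0::real) \<le> t"
      have "(H1_dist (interp h (\<psi> t)) Gamma_orbit)\<^sup>2 \<le> A * (\<delta>\<^sup>2 + h\<^sup>2)"
        using st[rule_format, OF \<delta>(1) h r2 h1(1) V dist sol t] .
      \<comment> \<open>Taking roots turns \<open>A\<close> into the constant \<open>sqrt A\<close> of the theorem.\<close>
      also have "\<dots> \<le> A * (\<delta> + h)\<^sup>2"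
        using A \<delta> h by (intro mult_left_mono) (auto simp: power2_sum)
      also have "\<dots> = (sqrt A * (\<delta> + h))\<^sup>2" using A by (simp add: power_mult_distrib)
      finally have "H1_dist (interp h (\<psi> t)) Gamma_orbit \<le> sqrt A * (\<delta> + h)"
        by (rule power2_le_imp_le) (use A \<delta> h in simp)
      also have "\<dots> \<le> sqrt A * (\<delta> + h + 1 / h\<^sup>2 * exp (- 1 * real K * h))"
        using A e0 by (intro mult_left_mono) auto
      finally show "H1_dist (interp h (\<psi> t)) Gamma_orbit \<le> sqrt A * (\<delta> + h + 1 / h\<^sup>2 * exp (- 1 * real K * h))" .
    qed
  qed
qed

end
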